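(* Let $d \geq 2$ be an integer. Then there is a nonempty Zariski-open subset $U$ of $\mathcal{P}_d$ such that each $[f] \in U(\mathbb{C})$ is the unique $[g] \in \mathcal{P}_d(\mathbb{C})$ such that $\Lambda_g^{(1)} = \Lambda_f^{(1)}$ and $\Lambda_g^{(2)} = \Lambda_f^{(2)}$. Moreover, if $d \in \{2,3\}$, then each $[f] \in \mathcal{P}_d(\mathbb{C})$ is the unique $[g] \in \mathcal{P}_d(\mathbb{C})$ such that $\Lambda_g^{(1)} = \Lambda_f^{(1)}$.
   Context: $\mathrm{Poly}_d = \{a_d z^d + \dots + a_0 : a_d \neq 0\}$ is the affine variety over $\mathbb{Q}$ with coordinate ring $\mathbb{Q}[a_0,\dots,a_d,a_d^{-1}]$. The algebraic group $\mathrm{Aff} = \{\alpha z + \beta : \alpha \neq 0\}$ acts on it by conjugation, $\phi \cdot f = \phi \circ f \circ \phi^{-1}$. $\mathcal{P}_d$ is the affine variety over $\mathbb{Q}$ with $\mathbb{Q}[\mathcal{P}_d] = \mathbb{Q}[\mathrm{Poly}_d]^{\mathrm{Aff}}$ (a finitely generated $\mathbb{Q}$-algebra); it is a geometric quotient of $\mathrm{Poly}_d$ by $\mathrm{Aff}$, so that $\mathcal{P}_d(\mathbb{C}) = \mathrm{Poly}_d(\mathbb{C})/\mathrm{Aff}(\mathbb{C})$; $[f]$ denotes the class of $f$. For $f \in \mathrm{Poly}_d(\mathbb{C})$, the dynatomic polynomials $\Phi_f^{(p)}$ ($p \geq 1$) are the unique polynomials with $f^{\circ p}(z) - z = \prod_{k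 \mid p} \Phi_f^{(k)}(z)$ for all $p \geq 1$. There is a unique monic polynomial $\chi_f^{(p)}(\lambda)$ such that $\chi_f^{(p)}(\lambda)^p = \prod_{z} (\lambda - (f^{\circ p})'(z))$, the product being over the roots $z$ of $\Phi_f^{(p)}$ counted with multiplicity. $\Lambda_f^{(p)}$ is the multiset of roots of $\chi_f^{(p)}$ (generically, the multiset of multipliers of $f$ at its cycles with period $p$); it depends only on $[f]$. *)

theory Defs
  imports Complex_Main "HOL-Computational_Algebra.Computational_Algebra"
begin

definition Poly_deg :: "nat \<Rightarrow> complex poly set" where
  "Poly_deg d = {f. degree f = d}"

text \<open>The conjugate \<open>\<phi> \<circ> f \<circ> \<phi>\<^sup>-\<^sup>1\<close> of \<open>f\<close> by \<open>\<phi>(z) = \<alpha> z + \<beta>\<close>, for \<open>\<alpha> \<noteq> 0\<close>.\<close>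

definition aff_conj :: "complex \<Rightarrow> complex \<Rightarrow> complex poly \<Rightarrow> complex poly" where
  "aff_conj \<alpha> \<beta> f = pcompose [:\<beta>, \<alpha>:] (pcompose f [:- \<beta> / \<alpha>, 1 / \<alpha>:])"

definition conj_rel :: "(complex poly \<times> complex poly) set" where
  "conj_rel = {(f, g). \<exists>\<alpha> \<beta>. \<alpha> \<noteq> 0 \<and> g = aff_conj \<alpha> \<beta> f}"

definition conj_class :: "complex poly \<Rightarrow> complex poly set" where
  "conj_class f = conj_rel `` {f}"

text \<open>The set of complex points of the moduli space \<open>\<P>\<^sub>d\<close>.\<close>

definition moduli :: "nat \<Rightarrow> complex poly set set" where
  "moduli d = Poly_deg d // conj_rel"

text \<open>
  The ring \<open>\<rat>[a\<^sub>0, \<dots>, a\<^sub>d, a\<^sub>d\<^sup>-\<^sup>1]\<close>, each element being represented by the function that it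
  induces on \<open>Poly_deg d\<close>; this is faithful because \<open>\<complex>\<close> is infinite. Only the values on
  \<open>Poly_deg d\<close> are meaningful.
\<close>

inductive_set coord_ring :: "nat \<Rightarrow> (complex poly \<Rightarrow> complex) set" for d :: nat where
  const: "(\<lambda>f. of_rat c) \<in> coord_ring d"
| coord: "i \<le> d \<Longrightarrow> (\<lambda>f. coeff f i) \<in> coord_ring d"
| inv_lead: "(\<lambda>f. inverse (coeff f d)) \<in> coord_ring d"
| add: "h \<in> coord_ring d \<Longrightarrow> k \<in> coord_ring d \<Longrightarrow> (\<lambda>f. h f + k f) \<in> coord_ring d"
| mult: "h \<in> coord_ring d \<Longrightarrow> k \<in> coord_ring d \<Longrightarrow> (\<lambda>f. h f * k f) \<in> coord_ring d"

definition invariant_ring :: "nat \<Rightarrow> (complex poly \<Rightarrow> complex) set" where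
  "invariant_ring d =
     {h \<in> coord_ring d. \<forall>f \<in> Poly_deg d. \<forall>\<alpha> \<beta>. \<alpha> \<noteq> 0 \<longrightarrow> h (aff_conj \<alpha> \<beta> f) = h f}"

text \<open>
  Zariski-open subsets of \<open>\<P>\<^sub>d\<close>, as a variety over \<open>\<rat>\<close>, are identified with their sets of
  complex points: the complements of the zero loci of sets \<open>I\<close> of elements of \<open>\<rat>[\<P>\<^sub>d]\<close>.
  Such an open subset is nonempty if and only if it has a complex point.
\<close>

definition zariski_open :: "nat \<Rightarrow> complex poly set set \<Rightarrow> bool" where
  "zariski_open d U \<longleftrightarrow>
     (\<exists>I \<subseteq> invariant_ring d. U = {conj_class f | f. f \<in> Poly_deg d \<and> (\<exists>h \<in> I. h f \<noteq> 0)})"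

definition iterate :: "complex poly \<Rightarrow> nat \<Rightarrow> complex poly" where
  "iterate f p = (pcompose f ^^ p) [:0, 1:]"

text \<open>Meaningful for \<open>degree f \<ge> 2\<close> and \<open>p \<ge> 1\<close>.\<close>

definition dynatomic :: "complex poly \<Rightarrow> nat \<Rightarrow> complex poly" where
  "dynatomic f p =
     (THE q. \<exists>\<Phi>. (\<forall>n\<ge>1. iterate f n - [:0, 1:] = (\<Prod>k | k dvd n. \<Phi> k)) \<and> q = \<Phi> p)"

definition mult_poly :: "complex poly \<Rightarrow> nat \<Rightarrow> complex poly" where
  "mult_poly f p =
     (THE \<chi>. lead_coeff \<chi> = 1 \<and>
        \<chi> ^ p = (\<Prod>z \<in># proots (dynatomic f p). [:- poly (pderiv (iterate f p)) z, 1:]))"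

definition multipliers :: "complex poly \<Rightarrow> nat \<Rightarrow> complex multiset" where
  "multipliers f p = proots (mult_poly f p)"

end

theory Submission
  imports Defs
begin

text \<open>
  Every class with a nonzero centered constant coefficient has a unique representative
  \<open>1 + \<Sum>\<^sub>k x\<^sub>k z\<^sup>k\<close>, and its coefficients are invariants over \<open>\<rat>\<close>. The property that some
  non-conjugate \<open>g\<close> has the same fixed-point multipliers and at least the same multipliers at
  cycles of period 2 is a first-order condition on \<open>x\<close>, so by elimination of quantifiers over
  \<open>\<rat>\<close> it holds, or fails, on a nonempty principal open set. To exclude the first alternative it
  is enough to meet every such set with a good polynomial, and these are found close to \<open>z\<^sup>d\<close>.

  Let \<open>f\<^sub>n\<close> tend to \<open>z\<^sup>d\<close> in a generic direction, and let \<open>g\<^sub>n\<close> have the same multipliers. The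
  identities \<open>\<Sum>\<^sub>i z\<^sub>i\<^sup>k / (1 - \<lambda>\<^sub>i) = 0\<close> for the fixed points force the normalized \<open>g\<^sub>n\<close> to tend to
  \<open>z\<^sup>d\<close> as well, with fixed points tending to roots of unity, so that the fixed-point multipliers
  of \<open>g\<^sub>n\<close> are those of \<open>f\<^sub>n\<close> up to a permutation of the \<open>(d - 1)\<close>-th roots of unity. To first
  order the multiplier at a 2-cycle is a linear form in the fixed-point multipliers, and for a
  cycle of \<open>z\<^sup>d\<close> consisting of primitive \<open>(d\<^sup>2 - 1)\<close>-th roots of unity the coefficients of this form
  are pairwise distinct. Hence the permutation is a rotation, and then \<open>g\<^sub>n\<close> is conjugate to
  \<open>f\<^sub>n\<close> because the fixed-point multipliers are local coordinates.
\<close>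

section \<open>Elimination of quantifiers over the rational numbers\<close>


text \<open>The limit argument yields single good polynomials and no equation for the bad ones.
  Elimination supplies one, but the open set on which it decides the question is unknown, so the
  good polynomial has to avoid the zeros of an arbitrary invariant \<open>H\<close>; on a line
  through \<open>z^d\<close> only finitely many points are lost. Multisets are not first-order
  objects. For fixed points this is met by naming all of them, for period 2 by keeping only the set
  of values at genuine 2-cycles. That set is the support of the multiset of period 2 as soon as no
  fixed point has multiplier 1 or -1, which is why \<open>degenerate\<close> is excluded along with
  \<open>bad\<close>. The limits of \<open>g\<close> leave finitely many cases: two labellings of
  the (d - 1)-th roots of unity and a point of order dividing d^2 - 1. In each case that is not a
  rotation, equality of the variations is a nontrivial linear condition on the direction, and a
  generic direction violates them all. If x is a primitive (d^2 - 1)-th root of unity, s = x^(d - 1)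
  has order d + 1 >= 3, so s is neither 1 nor -1; complex conjugation on the unit circle then tells
  the coefficients apart.\<close>

inductive_set rat_poly :: "'v set \<Rightarrow> (('v \<Rightarrow> complex) \<Rightarrow> complex) set" for V :: "'v set" where
  rp_const: "(\<lambda>x. of_rat c) \<in> rat_poly V"
| rp_var: "v \<in> V \<Longrightarrow> (\<lambda>x. x v) \<in> rat_poly V"
| rp_add: "h \<in> rat_poly V \<Longrightarrow> k \<in> rat_poly V \<Longrightarrow> (\<lambda>x. h x + k x) \<in> rat_poly V"
| rp_mult: "h \<in> rat_poly V \<Longrightarrow> k \<in> rat_poly V \<Longrightarrow> (\<lambda>x. h x * k x) \<in> rat_poly V"

lemma rp_0: "(\<lambda>x. 0) \<in> rat_poly V"
  using rp_const[of 0 V] by simp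

lemma rp_1: "(\<lambda>x. 1) \<in> rat_poly V"
  using rp_const[of 1 V] by simp

lemma rp_of_nat: "(\<lambda>x. of_nat n) \<in> rat_poly V"
  using rp_const[of "of_nat n" V] by simp

lemma rp_uminus: "h \<in> rat_poly V \<Longrightarrow> (\<lambda>x. - h x) \<in> rat_poly V"
  using rp_mult[OF rp_const[of "-1" V], of h] by simp

lemma rp_diff: "h \<in> rat_poly V \<Longrightarrow> k \<in> rat_poly V \<Longrightarrow> (\<lambda>x. h x - k x) \<in> rat_poly V"
  using rp_add[of h V "\<lambda>x. - k x"] rp_uminus[of k V] by simp

lemma rp_sum:
  assumes "\<And>i. i \<in> I \<Longrightarrow> h i \<in> rat_poly V"
  shows "(\<lambda>x. \<Sum>i\<in>I. h i x) \<in> rat_poly V"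
proof (cases "finite I")
  case True
  then show ?thesis
    using assms by (induction I rule: finite_induct) (auto intro: rp_0 rp_add)
next
  case False
  then show ?thesis by (simp add: rp_0)
qed

lemma rp_prod:
  assumes "\<And>i. i \<in> I \<Longrightarrow> h i \<in> rat_poly V"
  shows "(\<lambda>x. \<Prod>i\<in>I. h i x) \<in> rat_poly V"
proof (cases "finite I")
  case True
  then show ?thesis
    using assms by (induction I rule: finite_induct) (auto intro: rp_1 rp_mult)
next
  case False
  then show ?thesis by (simp add: rp_1)
qed

lemma rp_power: "h \<in> rat_poly V \<Longrightarrow> (\<lambda>x. h x ^ n) \<in> rat_poly V"
  by (induction n) (auto intro: rp_1 rp_mult)

lemma rp_cong:
  assumes "h \<in> rat_poly V" "\<And>v. v \<in> V \<Longrightarrow> x v = y v"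
  shows "h x = h y"
  using assms by (induction rule: rat_poly.induct) auto

section \<open>Quantifier-free formulas and their generic truth value\<close>

inductive definable :: "'v set \<Rightarrow> (('v \<Rightarrow> complex) \<Rightarrow> bool) \<Rightarrow> bool" for V :: "'v set" where
  df_zero: "p \<in> rat_poly V \<Longrightarrow> definable V (\<lambda>x. p x = 0)"
| df_not: "definable V \<phi> \<Longrightarrow> definable V (\<lambda>x. \<not> \<phi> x)"
| df_and: "definable V \<phi> \<Longrightarrow> definable V \<psi> \<Longrightarrow> definable V (\<lambda>x. \<phi> x \<and> \<psi> x)"

lemma df_or:
  assumes "definable V \<phi>" "definable V \<psi>"
  shows "definable V (\<lambda>x. \<phi> x \<or> \<psi> x)"
proof -
  have "definable V (\<lambda>x. \<not> (\<not> \<phi> x \<and> \<not> \<psi> x))"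
    by (rule df_not[OF df_and[OF df_not[OF assms(1)] df_not[OF assms(2)]]])
  then show ?thesis by (simp only: de_Morgan_conj not_not)
qed

lemma df_imp:
  assumes "definable V \<phi>" "definable V \<psi>"
  shows "definable V (\<lambda>x. \<phi> x \<longrightarrow> \<psi> x)"
  unfolding imp_conv_disj by (rule df_or[OF df_not[OF assms(1)] assms(2)])

lemma df_eq:
  assumes "p \<in> rat_poly V" "q \<in> rat_poly V"
  shows "definable V (\<lambda>x. p x = q x)"
  using df_zero[OF rp_diff[OF assms]] by simp

lemma df_True: "definable V (\<lambda>x. True)"
  using df_zero[OF rp_0[of V]] by simp

lemma df_False: "definable V (\<lambda>x. False)"
  using df_not[OF df_True[of V]] by simp

lemma df_ball_fin:
  assumes "finite I" "\<And>i. i \<in> I \<Longrightarrow> definable V (\<phi> i)"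
  shows "definable V (\<lambda>x. \<forall>i\<in>I. \<phi> i x)"
  using assms by (induction I rule: finite_induct) (simp_all add: df_True df_and)

text \<open>In effect the irreducibility of affine space: on the line that joins a point where
  \<open>p\<close> is nonzero to one where \<open>q\<close> is, both restrict to nonzero polynomials
  in one variable.\<close>

lemma rp_nonzero_mult:
  assumes "p \<in> rat_poly V" "q \<in> rat_poly V" "\<exists>x. p x \<noteq> 0" "\<exists>x. q x \<noteq> 0"
  shows "\<exists>x. p x * q x \<noteq> 0"
proof -
  have line: "\<exists>P. \<forall>t. h (\<lambda>i. u i + t * w i) = poly P t" if "h \<in> rat_poly V" for h and u w :: "'a \<Rightarrow> complex"
    using that
  proof (induction rule: rat_poly.induct)
    case (rp_const c)
    show ?case by (rule exI[of _ "[:of_rat c:]"]) simp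
  next
    case (rp_var v)
    show ?case by (rule exI[of _ "[:u v, w v:]"]) simp
  next
    case (rp_add h k)
    then obtain P Q where "\<forall>t. h (\<lambda>i. u i + t * w i) = poly P t" "\<forall>t. k (\<lambda>i. u i + t * w i) = poly Q t"
      by blast
    then show ?case by (intro exI[of _ "P + Q"]) simp
  next
    case (rp_mult h k)
    then obtain P Q where "\<forall>t. h (\<lambda>i. u i + t * w i) = poly P t" "\<forall>t. k (\<lambda>i. u i + t * w i) = poly Q t"
      by blast
    then show ?case by (intro exI[of _ "P * Q"]) simp
  qed
  obtain u v where u: "p u \<noteq> 0" and v: "q v \<noteq> 0" using assms by blast
  obtain P Q where P: "\<And>t. p (\<lambda>i. u i + t * (v i - u i)) = poly P t"
    and Q: "\<And>t. q (\<lambda>i. u i + t * (v i - u i)) = poly Q t"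
    using line[OF assms(1), of u "\<lambda>i. v i - u i"] line[OF assms(2), of u "\<lambda>i. v i - u i"] by blast
  have "P \<noteq> 0" using P[of 0] u by auto
  moreover have "Q \<noteq> 0" using Q[of 1] v by auto
  ultimately have "P * Q \<noteq> 0" by simp
  then obtain t where "poly (P * Q) t \<noteq> 0" using poly_all_0_iff_0 by blast
  then show ?thesis using P[of t] Q[of t] by (metis poly_mult)
qed

text \<open>An equation holds identically or fails on a nonempty principal open set, negation swaps
  the two outcomes, and for a conjunction the two open sets meet by
  \<open>rp_nonzero_mult\<close>.\<close>

lemma definable_generic:
  assumes "definable V \<phi>"
  shows "\<exists>P\<in>rat_poly V. (\<exists>x. P x \<noteq> 0) \<and>
           ((\<forall>x. P x \<noteq> 0 \<longrightarrow> \<phi> x) \<or> (\<forall>x. P x \<noteq> 0 \<longrightarrow> \<not> \<phi> x))"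
  using assms
proof (induction rule: definable.induct)
  case (df_zero p)
  show ?case
  proof (cases "\<exists>x. p x \<noteq> 0")
    case True
    then show ?thesis using df_zero by (intro bexI[of _ p]) auto
  next
    case False
    then show ?thesis by (intro bexI[OF _ rp_1]) auto
  qed
next
  case (df_not \<phi>)
  then show ?case by blast
next
  case (df_and \<phi> \<psi>)
  then obtain P Q where P: "P \<in> rat_poly V" "\<exists>x. P x \<noteq> 0"
      "(\<forall>x. P x \<noteq> 0 \<longrightarrow> \<phi> x) \<or> (\<forall>x. P x \<noteq> 0 \<longrightarrow> \<not> \<phi> x)"
    and Q: "Q \<in> rat_poly V" "\<exists>x. Q x \<noteq> 0"
      "(\<forall>x. Q x \<noteq> 0 \<longrightarrow> \<psi> x) \<or> (\<forall>x. Q x \<noteq> 0 \<longrightarrow> \<not> \<psi> x)" by blast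
  show ?case
    using rp_mult[OF P(1) Q(1)] rp_nonzero_mult[OF P(1) Q(1) P(2) Q(2)] P(3) Q(3)
    by (intro bexI[of _ "\<lambda>x. P x * Q x"]) auto
qed

text \<open>\<open>n\<close> is a formal degree: the coefficient at \<open>n\<close> is a polynomial
  in the parameters and may vanish at some of them. Divisions therefore carry the condition that it
  does not, and the complementary case lowers \<open>n\<close>.\<close>

definition poly_family :: "'v set \<Rightarrow> nat \<Rightarrow> (('v \<Rightarrow> complex) \<Rightarrow> complex poly) \<Rightarrow> bool" where
  "poly_family V n q \<longleftrightarrow> (\<forall>x. degree (q x) \<le> n) \<and> (\<forall>i. (\<lambda>x. coeff (q x) i) \<in> rat_poly V)"

lemma poly_familyI:
  "(\<And>x. degree (q x) \<le> n) \<Longrightarrow> (\<And>i. (\<lambda>x. coeff (q x) i) \<in> rat_poly V) \<Longrightarrow> poly_family V n q"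
  by (simp add: poly_family_def)

lemma pf_degree: "poly_family V n q \<Longrightarrow> degree (q x) \<le> n"
  by (simp add: poly_family_def)

lemma pf_coeff: "poly_family V n q \<Longrightarrow> (\<lambda>x. coeff (q x) i) \<in> rat_poly V"
  by (simp add: poly_family_def)

lemma pf_mono: "poly_family V n q \<Longrightarrow> n \<le> k \<Longrightarrow> poly_family V k q"
  unfolding poly_family_def by (metis le_trans)

lemma pf_add:
  assumes "poly_family V n p" "poly_family V n q"
  shows "poly_family V n (\<lambda>x. p x + q x)"
proof (rule poly_familyI)
  show "degree (p x + q x) \<le> n" for x using assms by (intro degree_add_le pf_degree)
  show "(\<lambda>x. coeff (p x + q x) i) \<in> rat_poly V" for i
    using rp_add[OF pf_coeff[OF assms(1), of i] pf_coeff[OF assms(2), of i]] by simp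
qed

lemma pf_diff:
  assumes "poly_family V n p" "poly_family V n q"
  shows "poly_family V n (\<lambda>x. p x - q x)"
proof (rule poly_familyI)
  show "degree (p x - q x) \<le> n" for x using assms by (intro degree_diff_le pf_degree)
  show "(\<lambda>x. coeff (p x - q x) i) \<in> rat_poly V" for i
    using rp_diff[OF pf_coeff[OF assms(1), of i] pf_coeff[OF assms(2), of i]] by simp
qed

lemma pf_smult:
  assumes "c \<in> rat_poly V" "poly_family V n q"
  shows "poly_family V n (\<lambda>x. smult (c x) (q x))"
proof (rule poly_familyI)
  show "degree (smult (c x) (q x)) \<le> n" for x
    using degree_smult_le[of "c x" "q x"] pf_degree[OF assms(2), of x] by linarith
  show "(\<lambda>x. coeff (smult (c x) (q x)) i) \<in> rat_poly V" for i
    using rp_mult[OF assms(1) pf_coeff[OF assms(2), of i]] by simp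
qed

lemma pf_mult:
  assumes "poly_family V n p" "poly_family V k q"
  shows "poly_family V (n + k) (\<lambda>x. p x * q x)"
proof (rule poly_familyI)
  show "degree (p x * q x) \<le> n + k" for x
    using degree_mult_le[of "p x" "q x"] pf_degree[OF assms(1), of x] pf_degree[OF assms(2), of x]
    by linarith
  show "(\<lambda>x. coeff (p x * q x) i) \<in> rat_poly V" for i
    unfolding coeff_mult by (rule rp_sum, rule rp_mult) (rule pf_coeff[OF assms(1)], rule pf_coeff[OF assms(2)])
qed

lemma pf_const: "c \<in> rat_poly V \<Longrightarrow> poly_family V n (\<lambda>x. [:c x:])"
  unfolding poly_family_def
proof (intro conjI allI)
  fix i assume "c \<in> rat_poly V"
  then show "(\<lambda>x. coeff [:c x:] i) \<in> rat_poly V" by (cases i) (auto simp: rp_0)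
qed simp

lemma pf_monom: "c \<in> rat_poly V \<Longrightarrow> k \<le> n \<Longrightarrow> poly_family V n (\<lambda>x. monom (c x) k)"
  unfolding poly_family_def
proof (intro conjI allI)
  fix i assume "c \<in> rat_poly V"
  then show "(\<lambda>x. coeff (monom (c x) k) i) \<in> rat_poly V" by (cases "k = i") (auto simp: rp_0)
qed (simp add: le_trans[OF degree_monom_le])

lemma pf_power: "poly_family V n p \<Longrightarrow> poly_family V (n * k) (\<lambda>x. p x ^ k)"
proof (induction k)
  case 0
  then show ?case using pf_const[OF rp_1, of V 0] by (simp add: one_pCons)
next
  case (Suc k)
  then show ?case using pf_mult[of V n p "n * k" "\<lambda>x. p x ^ k"] by simp
qed

lemma pf_drop:
  assumes "poly_family V n q" "\<And>x. coeff (q x) n = 0" "n > 0"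
  shows "poly_family V (n - 1) q"
  unfolding poly_family_def
proof (intro conjI allI)
  fix x
  show "degree (q x) \<le> n - 1"
  proof (rule degree_le, intro allI impI)
    fix i assume "n - 1 < i"
    then have "i = n \<or> degree (q x) < i"
      using pf_degree[OF assms(1), of x] by linarith
    then show "coeff (q x) i = 0"
      using assms(2) by (auto simp: coeff_eq_0)
  qed
next
  show "(\<lambda>x. coeff (q x) i) \<in> rat_poly V" for i by (rule pf_coeff[OF assms(1)])
qed

lemma pf_from_rat_poly:
  assumes "p \<in> rat_poly (insert v V)"
  shows "\<exists>n q. poly_family V n q \<and> (\<forall>x t. p (x(v := t)) = poly (q x) t)"
  using assms
proof (induction rule: rat_poly.induct)
  case (rp_const c)
  show ?case
    using pf_const[OF rat_poly.rp_const, of V 0] by (intro exI[of _ 0] exI[of _ "\<lambda>x. [:of_rat c:]"]) simp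
next
  case (rp_var w)
  show ?case
  proof (cases "w = v")
    case True
    then show ?thesis
      using pf_monom[OF rp_1, of 1 1 V] 
      by (intro exI[of _ 1] exI[of _ "\<lambda>x. monom 1 1"]) (auto simp: poly_monom)
  next
    case False
    then show ?thesis
      using pf_const[OF rat_poly.rp_var, of w V 0] rp_var
      by (intro exI[of _ 0] exI[of _ "\<lambda>x. [:x w:]"]) auto
  qed
next
  case (rp_add h k)
  then obtain n p m q where "poly_family V n p" "\<forall>x t. h (x(v := t)) = poly (p x) t"
    "poly_family V m q" "\<forall>x t. k (x(v := t)) = poly (q x) t" by blast
  then show ?case
    using pf_add[OF pf_mono[of V n p "max n m"] pf_mono[of V m q "max n m"]]
    by (intro exI[of _ "max n m"] exI[of _ "\<lambda>x. p x + q x"]) (simp del: fun_upd_apply)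
next
  case (rp_mult h k)
  then obtain n p m q where "poly_family V n p" "\<forall>x t. h (x(v := t)) = poly (p x) t"
    "poly_family V m q" "\<forall>x t. k (x(v := t)) = poly (q x) t" by blast
  then show ?case
    using pf_mult[of V n p m q]
    by (intro exI[of _ "n + m"] exI[of _ "\<lambda>x. p x * q x"]) (simp del: fun_upd_apply)
qed

lemma df_pf_zero:
  assumes "poly_family V n q"
  shows "definable V (\<lambda>x. q x = 0)"
proof -
  have "definable V (\<lambda>x. \<forall>i\<in>{..n}. coeff (q x) i = 0)"
    by (rule df_ball_fin[OF finite_atMost df_zero[OF pf_coeff[OF assms]]])
  moreover have "(\<forall>i\<in>{..n}. coeff (q x) i = 0) \<longleftrightarrow> q x = 0" for x
  proof
    assume H: "\<forall>i\<in>{..n}. coeff (q x) i = 0"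
    have "degree (q x) \<le> n" using assms by (simp add: poly_family_def)
    then have "lead_coeff (q x) = 0" using H by simp
    then show "q x = 0" by simp
  qed simp
  ultimately show ?thesis by simp
qed

text \<open>One step of pseudo-division. Multiplying \<open>q\<close> by the formal leading
  coefficient of \<open>p\<close> avoids denominators, and the terms of degree \<open>k\<close>
  cancel. Where that coefficient is nonzero, neither divisibility by \<open>p\<close> nor the set of
  common roots with \<open>p\<close> changes.\<close>

definition pseudo_step ::
    "nat \<Rightarrow> nat \<Rightarrow> (('v \<Rightarrow> complex) \<Rightarrow> complex poly) \<Rightarrow> (('v \<Rightarrow> complex) \<Rightarrow> complex poly) \<Rightarrow>
     ('v \<Rightarrow> complex) \<Rightarrow> complex poly" where
  "pseudo_step n k p q =
     (\<lambda>x. smult (coeff (p x) n) (q x) - monom (coeff (q x) k) (k - n) * p x)"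

lemma pf_pseudo_step:
  assumes p: "poly_family V n p" and q: "poly_family V k q" and "n \<le> k" "k > 0"
  shows "poly_family V (k - 1) (pseudo_step n k p q)"
proof (rule pf_drop)
  show "poly_family V k (pseudo_step n k p q)"
    unfolding pseudo_step_def
  proof (rule pf_diff)
    show "poly_family V k (\<lambda>x. smult (coeff (p x) n) (q x))"
      by (rule pf_smult[OF pf_coeff[OF p] q])
    show "poly_family V k (\<lambda>x. monom (coeff (q x) k) (k - n) * p x)"
      using pf_mult[OF pf_monom[OF pf_coeff[OF q] order.refl] p, of "k - n" k] \<open>n \<le> k\<close> by simp
  qed
  show "coeff (pseudo_step n k p q x) k = 0" for x
    using \<open>n \<le> k\<close> by (simp add: pseudo_step_def coeff_monom_mult)
qed fact

text \<open>The conjunct on the coefficient makes the formal degree of \<open>p\<close> the true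
  one. Pseudo-division lowers the bound on \<open>q\<close> until \<open>q\<close> has smaller
  degree than \<open>p\<close>, so that divisibility means \<open>q x = 0\<close>, or until
  \<open>p\<close> is seen to be a nonzero constant.\<close>

lemma df_dvd:
  assumes p: "poly_family V n p" and q: "poly_family V k q"
  shows "definable V (\<lambda>x. coeff (p x) n \<noteq> 0 \<and> p x dvd q x)"
  using q
proof (induction k arbitrary: q)
  case (0 q)
  show ?case
  proof (cases "n = 0")
    case True
    have "coeff (p x) n \<noteq> 0 \<and> p x dvd q x \<longleftrightarrow> \<not> coeff (p x) n = 0" for x
    proof -
      have "degree (p x) = 0" using p True by (simp add: poly_family_def)
      then have "p x dvd 1" if "coeff (p x) n \<noteq> 0"
        using that True is_unit_iff_degree[of "p x"] by fastforce
      then show ?thesis by (meson dvd_trans one_dvd)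
    qed
    then show ?thesis using df_not[OF df_zero[OF pf_coeff[OF p, of n]]] by simp
  next
    case False
    have "coeff (p x) n \<noteq> 0 \<and> p x dvd q x \<longleftrightarrow> coeff (p x) n \<noteq> 0 \<and> q x = 0" for x
    proof -
      have "degree (p x) = n" if "coeff (p x) n \<noteq> 0"
        using p that le_degree[of "p x" n] by (force simp: poly_family_def intro: antisym)
      moreover have "degree (q x) = 0" using 0 by (simp add: poly_family_def)
      ultimately show ?thesis using False dvd_imp_degree_le[of "p x" "q x"] by (metis dvd_0_right le_zero_eq not_le le_trans)
    qed
    then show ?thesis
      using df_and[OF df_not[OF df_zero[OF pf_coeff[OF p, of n]]] df_pf_zero[OF 0]] by simp
  qed
next
  case (Suc k q)
  show ?case
  proof (cases "n \<le> Suc k")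
    case True
    have "coeff (p x) n \<noteq> 0 \<and> p x dvd q x \<longleftrightarrow>
        coeff (p x) n \<noteq> 0 \<and> p x dvd pseudo_step n (Suc k) p q x" for x
    proof -
      let ?c = "coeff (p x) n" and ?m = "monom (coeff (q x) (Suc k)) (Suc k - n)"
      have "p x dvd smult ?c (q x) - ?m * p x \<longleftrightarrow> p x dvd smult ?c (q x)"
        by (metis dvd_diff dvd_triv_right diff_add_cancel dvd_add)
      then show ?thesis unfolding pseudo_step_def using dvd_smult_iff by blast
    qed
    then show ?thesis
      using Suc.IH[of "pseudo_step n (Suc k) p q"] pf_pseudo_step[OF p Suc.prems True] by simp
  next
    case False
    have "coeff (p x) n \<noteq> 0 \<and> p x dvd q x \<longleftrightarrow> coeff (p x) n \<noteq> 0 \<and> q x = 0" for x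
    proof -
      have "degree (p x) = n" if "coeff (p x) n \<noteq> 0"
        using p that le_degree[of "p x" n] by (force simp: poly_family_def intro: antisym)
      moreover have "degree (q x) \<le> Suc k" using Suc.prems by (simp add: poly_family_def)
      ultimately show ?thesis using False dvd_imp_degree_le[of "p x" "q x"] by (metis dvd_0_right le_zero_eq not_le le_trans)
    qed
    then show ?thesis
      using df_and[OF df_not[OF df_zero[OF pf_coeff[OF p, of n]]] df_pf_zero[OF Suc.prems]] by simp
  qed
qed

lemma pf_truncate:
  assumes "poly_family V n p" "n > 0"
  shows "poly_family V (n - 1) (\<lambda>x. p x - monom (coeff (p x) n) n)"
  by (rule pf_drop[OF pf_diff[OF assms(1) pf_monom[OF pf_coeff[OF assms(1)] order.refl]]])
     (use assms in simp_all)

text \<open>By the univariate Nullstellensatz, a polynomial \<open>p\<close> of true degree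
  \<open>n\<close> has a root outside the zeros of \<open>r\<close> unless it divides
  \<open>r ^ n\<close>. Where the coefficient at \<open>n\<close> vanishes, that term is removed and
  the induction on \<open>n\<close> applies.\<close>

lemma df_ex_root1:
  assumes p: "poly_family V n p" and r: "poly_family V k r"
  shows "definable V (\<lambda>x. \<exists>t. poly (p x) t = 0 \<and> poly (r x) t \<noteq> 0)"
  using p
proof (induction n arbitrary: p)
  have key: "coeff (p x) n \<noteq> 0 \<and> (\<exists>t. poly (p x) t = 0 \<and> poly (r x) t \<noteq> 0) \<longleftrightarrow>
      coeff (p x) n \<noteq> 0 \<and> \<not> (coeff (p x) n \<noteq> 0 \<and> p x dvd r x ^ n)"
    if p: "poly_family V n p" for n p x
  proof -
    have "degree (p x) = n" if "coeff (p x) n \<noteq> 0"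
      using p that le_degree[of "p x" n] by (force simp: poly_family_def intro: antisym)
    then show ?thesis using nullstellensatz_univariate[of "p x" "r x"] by auto
  qed
  have df_key: "definable V (\<lambda>x. coeff (p x) n \<noteq> 0 \<and> (\<exists>t. poly (p x) t = 0 \<and> poly (r x) t \<noteq> 0))"
    if p: "poly_family V n p" for n p
    using df_and[OF df_not[OF df_zero[OF pf_coeff[OF p, of n]]] df_not[OF df_dvd[OF p pf_power[OF r, of n]]]]
    by (simp only: key[OF p])
  {
    case (0 p)
    have "(\<exists>t. poly (p x) t = 0 \<and> poly (r x) t \<noteq> 0) \<longleftrightarrow> coeff (p x) 0 = 0 \<and> r x \<noteq> 0" for x
    proof -
      have "p x = [:coeff (p x) 0:]" using 0 by (metis degree_0_id le_zero_eq poly_family_def)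
      then have "poly (p x) t = coeff (p x) 0" for t by (metis poly_const_conv)
      then show ?thesis using poly_all_0_iff_0[of "r x"] by auto
    qed
    then show ?case using df_and[OF df_zero[OF pf_coeff[OF 0, of 0]] df_not[OF df_pf_zero[OF r]]] by simp
  next
    case (Suc n p)
    let ?p' = "\<lambda>x. p x - monom (coeff (p x) (Suc n)) (Suc n)"
    have "definable V (\<lambda>x. (coeff (p x) (Suc n) = 0 \<and> (\<exists>t. poly (?p' x) t = 0 \<and> poly (r x) t \<noteq> 0)) \<or>
       (coeff (p x) (Suc n) \<noteq> 0 \<and> (\<exists>t. poly (p x) t = 0 \<and> poly (r x) t \<noteq> 0)))"
    proof (rule df_or[OF df_and df_key[OF Suc.prems]])
      show "definable V (\<lambda>x. coeff (p x) (Suc n) = 0)" by (rule df_zero[OF pf_coeff[OF Suc.prems]])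
      show "definable V (\<lambda>x. \<exists>t. poly (?p' x) t = 0 \<and> poly (r x) t \<noteq> 0)"
        by (rule Suc.IH) (use pf_truncate[OF Suc.prems] in simp)
    qed
    moreover have "(coeff (p x) (Suc n) = 0 \<and> (\<exists>t. poly (?p' x) t = 0 \<and> poly (r x) t \<noteq> 0)) \<or>
       (coeff (p x) (Suc n) \<noteq> 0 \<and> (\<exists>t. poly (p x) t = 0 \<and> poly (r x) t \<noteq> 0)) \<longleftrightarrow>
       (\<exists>t. poly (p x) t = 0 \<and> poly (r x) t \<noteq> 0)" for x
      by (cases "coeff (p x) (Suc n) = 0") simp_all
    ultimately show ?case by simp
  }
qed

text \<open>Euclid's algorithm with parameters. Of two equations, the one of smaller formal degree
  either loses its top term, if the coefficient vanishes, or serves to reduce the other; the common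
  roots stay the same. The measure counts \<open>Suc n\<close> because an equation
  \<open>0 = 0\<close> of formal degree 0 is dropped from the list.\<close>

lemma df_ex_roots:
  assumes "\<And>n p. (n, p) \<in> set ps \<Longrightarrow> poly_family V n p" and r: "poly_family V k r"
  shows "definable V (\<lambda>x. \<exists>t. (\<forall>(n, p)\<in>set ps. poly (p x) t = 0) \<and> poly (r x) t \<noteq> 0)"
  using assms(1)
proof (induction "sum_list (map (\<lambda>(n, p). Suc n) ps)" arbitrary: ps rule: less_induct)
  case less
  let ?Q = "\<lambda>ps x. \<exists>t. (\<forall>(n, p)\<in>set ps. poly (p x) t = 0) \<and> poly (r x) t \<noteq> 0"
  consider "ps = []" | n p where "ps = [(n, p)]" | n p m q rest where "ps = (n, p) # (m, q) # rest"
    by (metis list.exhaust surj_pair)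
  then show ?case
  proof cases
    case 1
    have "(\<exists>t. poly (r x) t \<noteq> 0) \<longleftrightarrow> \<not> r x = 0" for x using poly_all_0_iff_0[of "r x"] by auto
    then show ?thesis using 1 df_not[OF df_pf_zero[OF r]] by simp
  next
    case 2
    then show ?thesis using df_ex_root1[of V n p k r] less.prems r by simp
  next
    case 3
    have main: "definable V (?Q ((n, p) # (m, q) # rest))"
      if IH: "\<And>qs. sum_list (map (\<lambda>(n, p). Suc n) qs) < Suc n + Suc m + sum_list (map (\<lambda>(n, p). Suc n) rest) \<Longrightarrow>
           (\<And>n p. (n, p) \<in> set qs \<Longrightarrow> poly_family V n p) \<Longrightarrow> definable V (?Q qs)"
        and pf: "poly_family V n p" "poly_family V m q" "\<And>n p. (n, p) \<in> set rest \<Longrightarrow> poly_family V n p"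
        and le: "n \<le> m" for n m p q
    proof -
      let ?S = "sum_list (map (\<lambda>(n, p). Suc n) rest)"
      let ?c = "\<lambda>x. coeff (p x) n"
      have A: "definable V (\<lambda>x. ?c x = 0 \<and> ?Q ((n, p) # (m, q) # rest) x)"
      proof (cases "n = 0")
        case True
        have "?c x = 0 \<and> ?Q ((n, p) # (m, q) # rest) x \<longleftrightarrow> ?c x = 0 \<and> ?Q ((m, q) # rest) x" for x
        proof -
          have "p x = [:coeff (p x) 0:]" using pf(1) True by (metis degree_0_id le_zero_eq poly_family_def)
          then have "poly (p x) t = coeff (p x) 0" for t by (metis poly_const_conv)
          then show ?thesis using True by auto
        qed
        moreover have "definable V (\<lambda>x. ?c x = 0 \<and> ?Q ((m, q) # rest) x)"
        proof (rule df_and)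
          show "definable V (\<lambda>x. ?c x = 0)" by (rule df_zero[OF pf_coeff[OF pf(1)]])
          show "definable V (?Q ((m, q) # rest))" by (rule IH) (use pf in auto)
        qed
        ultimately show ?thesis by (simp only:)
      next
        case False
        let ?p' = "\<lambda>x. p x - monom (coeff (p x) n) n"
        have "?c x = 0 \<and> ?Q ((n, p) # (m, q) # rest) x \<longleftrightarrow>
            ?c x = 0 \<and> ?Q ((n - 1, ?p') # (m, q) # rest) x" for x
          by auto
        moreover have "definable V (\<lambda>x. ?c x = 0 \<and> ?Q ((n - 1, ?p') # (m, q) # rest) x)"
        proof (rule df_and)
          show "definable V (\<lambda>x. ?c x = 0)" by (rule df_zero[OF pf_coeff[OF pf(1)]])
          show "definable V (?Q ((n - 1, ?p') # (m, q) # rest))"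
            by (rule IH) (use pf False pf_truncate[OF pf(1)] in auto)
        qed
        ultimately show ?thesis by (simp only:)
      qed
      have B: "definable V (\<lambda>x. ?c x \<noteq> 0 \<and> ?Q ((n, p) # (m, q) # rest) x)"
      proof (cases "m = 0")
        case True
        have "\<not> (?c x \<noteq> 0 \<and> ?Q ((n, p) # (m, q) # rest) x)" for x
        proof -
          have "p x = [:coeff (p x) 0:]" using pf(1) True le by (metis degree_0_id le_zero_eq poly_family_def)
          then have "poly (p x) t = coeff (p x) 0" for t by (metis poly_const_conv)
          then show ?thesis using True le by auto
        qed
        then have "(\<lambda>x. ?c x \<noteq> 0 \<and> ?Q ((n, p) # (m, q) # rest) x) = (\<lambda>x. False)" by blast
        then show ?thesis using df_False by (simp only:)
      next
        case False
        let ?q' = "pseudo_step n m p q"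
        have "?c x \<noteq> 0 \<and> ?Q ((n, p) # (m, q) # rest) x \<longleftrightarrow>
            ?c x \<noteq> 0 \<and> ?Q ((n, p) # (m - 1, ?q') # rest) x" for x
          by (auto simp: pseudo_step_def)
        moreover have "definable V (\<lambda>x. ?c x \<noteq> 0 \<and> ?Q ((n, p) # (m - 1, ?q') # rest) x)"
        proof (rule df_and)
          show "definable V (\<lambda>x. ?c x \<noteq> 0)" by (rule df_not[OF df_zero[OF pf_coeff[OF pf(1)]]])
          show "definable V (?Q ((n, p) # (m - 1, ?q') # rest))"
            by (rule IH) (use pf False pf_pseudo_step[OF pf(1,2) le] in auto)
        qed
        ultimately show ?thesis by (simp only:)
      qed
      have "?Q ((n, p) # (m, q) # rest) = (\<lambda>x. (?c x = 0 \<and> ?Q ((n, p) # (m, q) # rest) x) \<or>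
          (?c x \<noteq> 0 \<and> ?Q ((n, p) # (m, q) # rest) x))" by auto
      then show ?thesis using df_or[OF A B] by (simp only:)
    qed
    show ?thesis
    proof (cases "n \<le> m")
      case True
      show ?thesis unfolding 3
        by (rule main[OF _ _ _ _ True]) (use less 3 in \<open>auto\<close>)
    next
      case False
      have "definable V (?Q ((m, q) # (n, p) # rest))"
        by (rule main) (use less 3 False in \<open>auto\<close>)
      moreover have "?Q ((m, q) # (n, p) # rest) = ?Q ps" unfolding 3 by auto
      ultimately show ?thesis by simp
    qed
  qed
qed


text \<open>A single inequation is enough, since several are merged into one by multiplying their
  polynomials.\<close>

definition basic :: "'v set \<Rightarrow> (('v \<Rightarrow> complex) \<Rightarrow> complex \<Rightarrow> bool) \<Rightarrow> bool" where
  "basic V \<psi> \<longleftrightarrow> (\<exists>ps k r. (\<forall>(n, p)\<in>set ps. poly_family V n p) \<and> poly_family V k r \<and>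
     (\<forall>x t. \<psi> x t \<longleftrightarrow> (\<forall>(n, p)\<in>set ps. poly (p x) t = 0) \<and> poly (r x) t \<noteq> 0))"

definition dnf :: "'v set \<Rightarrow> (('v \<Rightarrow> complex) \<Rightarrow> complex \<Rightarrow> bool) \<Rightarrow> bool" where
  "dnf V \<psi> \<longleftrightarrow> (\<exists>L. (\<forall>\<chi>\<in>set L. basic V \<chi>) \<and> (\<forall>x t. \<psi> x t \<longleftrightarrow> (\<exists>\<chi>\<in>set L. \<chi> x t)))"

lemma basic_zero: 
  assumes "poly_family V n p"
  shows "basic V (\<lambda>x t. poly (p x) t = 0)"
  unfolding basic_def
  by (rule exI[of _ "[(n, p)]"], rule exI[of _ 0], rule exI[of _ "\<lambda>x. [:1:]"])
     (use assms pf_const[OF rp_1] in auto)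

lemma basic_nonzero:
  assumes "poly_family V n p"
  shows "basic V (\<lambda>x t. poly (p x) t \<noteq> 0)"
  unfolding basic_def
  by (rule exI[of _ "[]"], rule exI[of _ n], rule exI[of _ p]) (use assms in auto)

lemma basic_and:
  assumes "basic V \<phi>" "basic V \<psi>"
  shows "basic V (\<lambda>x t. \<phi> x t \<and> \<psi> x t)"
proof -
  obtain ps k r where 1: "\<forall>(n, p)\<in>set ps. poly_family V n p" "poly_family V k r"
     "\<And>x t. \<phi> x t \<longleftrightarrow> (\<forall>(n, p)\<in>set ps. poly (p x) t = 0) \<and> poly (r x) t \<noteq> 0"
    using assms(1) unfolding basic_def by blast
  obtain qs m s where 2: "\<forall>(n, p)\<in>set qs. poly_family V n p" "poly_family V m s"
     "\<And>x t. \<psi> x t \<longleftrightarrow> (\<forall>(n, p)\<in>set qs. poly (p x) t = 0) \<and> poly (s x) t \<noteq> 0"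
    using assms(2) unfolding basic_def by blast
  show ?thesis unfolding basic_def
    by (rule exI[of _ "ps @ qs"], rule exI[of _ "k + m"], rule exI[of _ "\<lambda>x. r x * s x"])
       (use 1 2 pf_mult[OF 1(2) 2(2)] in \<open>simp add: ball_Un; blast\<close>)
qed

lemma dnf_basic: "basic V \<chi> \<Longrightarrow> dnf V \<chi>"
  unfolding dnf_def by (rule exI[of _ "[\<chi>]"]) auto

lemma dnf_False: "dnf V (\<lambda>x t. False)"
  unfolding dnf_def by (rule exI[of _ "[]"]) auto

lemma dnf_True: "dnf V (\<lambda>x t. True)"
  using dnf_basic[OF basic_nonzero[OF pf_const[OF rp_1]], of V] by simp

lemma dnf_or:
  assumes "dnf V \<phi>" "dnf V \<psi>"
  shows "dnf V (\<lambda>x t. \<phi> x t \<or> \<psi> x t)"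
proof -
  obtain L where L0: "(\<forall>\<chi>\<in>set L. basic V \<chi>) \<and> (\<forall>x t. \<phi> x t = (\<exists>\<chi>\<in>set L. \<chi> x t))"
    using assms(1)[unfolded dnf_def] ..
  note L = conjunct1[OF L0] conjunct2[OF L0, rule_format]
  obtain M where M0: "(\<forall>\<chi>\<in>set M. basic V \<chi>) \<and> (\<forall>x t. \<psi> x t = (\<exists>\<chi>\<in>set M. \<chi> x t))"
    using assms(2)[unfolded dnf_def] ..
  note M = conjunct1[OF M0] conjunct2[OF M0, rule_format]
  show ?thesis unfolding dnf_def L(2) M(2)
    by (rule exI[of _ "L @ M"]) (simp add: ball_Un bex_Un L(1) M(1))
qed

lemma dnf_and:
  assumes "dnf V \<phi>" "dnf V \<psi>"
  shows "dnf V (\<lambda>x t. \<phi> x t \<and> \<psi> x t)"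
proof -
  obtain L where L0: "(\<forall>\<chi>\<in>set L. basic V \<chi>) \<and> (\<forall>x t. \<phi> x t = (\<exists>\<chi>\<in>set L. \<chi> x t))"
    using assms(1)[unfolded dnf_def] ..
  note L = conjunct1[OF L0] conjunct2[OF L0, rule_format]
  obtain M where M0: "(\<forall>\<chi>\<in>set M. basic V \<chi>) \<and> (\<forall>x t. \<psi> x t = (\<exists>\<chi>\<in>set M. \<chi> x t))"
    using assms(2)[unfolded dnf_def] ..
  note M = conjunct1[OF M0] conjunct2[OF M0, rule_format]
  let ?N = "map (\<lambda>(\<chi>, \<xi>). (\<lambda>x t. \<chi> x t \<and> \<xi> x t)) (List.product L M)"
  show ?thesis unfolding dnf_def
  proof (rule exI[of _ ?N], intro conjI ballI allI)
    fix \<chi> assume "\<chi> \<in> set ?N"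
    then obtain \<alpha> \<beta> where "\<alpha> \<in> set L" "\<beta> \<in> set M" "\<chi> = (\<lambda>x t. \<alpha> x t \<and> \<beta> x t)" by auto
    then show "basic V \<chi>" using L(1) M(1) basic_and[of V \<alpha> \<beta>] by simp
  next
    fix x t
    have "(\<exists>\<chi>\<in>set ?N. \<chi> x t) \<longleftrightarrow> (\<exists>a\<in>set L \<times> set M. fst a x t \<and> snd a x t)"
      by (simp add: case_prod_unfold)
    then show "(\<phi> x t \<and> \<psi> x t) \<longleftrightarrow> (\<exists>\<chi>\<in>set ?N. \<chi> x t)"
      unfolding L(2) M(2) by fastforce
  qed
qed

lemma dnf_not_basic:
  assumes "basic V \<chi>"
  shows "dnf V (\<lambda>x t. \<not> \<chi> x t)"
proof -
  obtain ps k r where 1: "\<forall>(n, p)\<in>set ps. poly_family V n p" "poly_family V k r"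
     "\<And>x t. \<chi> x t \<longleftrightarrow> (\<forall>(n, p)\<in>set ps. poly (p x) t = 0) \<and> poly (r x) t \<noteq> 0"
    using assms unfolding basic_def by blast
  have "dnf V (\<lambda>x t. \<exists>(n, p)\<in>set ps. poly (p x) t \<noteq> 0)" using 1(1)
  proof (induction ps)
    case Nil
    then show ?case using dnf_False by simp
  next
    case (Cons a ps)
    obtain n p where a: "a = (n, p)" by force
    have "dnf V (\<lambda>x t. poly (p x) t \<noteq> 0 \<or> (\<exists>(n, p)\<in>set ps. poly (p x) t \<noteq> 0))"
    proof (rule dnf_or)
      show "dnf V (\<lambda>x t. poly (p x) t \<noteq> 0)"
        by (rule dnf_basic[OF basic_nonzero]) (use Cons.prems a in auto)
      show "dnf V (\<lambda>x t. \<exists>(n, p)\<in>set ps. poly (p x) t \<noteq> 0)" by (rule Cons.IH) (use Cons.prems in auto)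
    qed
    then show ?case by (simp add: a)
  qed
  then have "dnf V (\<lambda>x t. (\<exists>(n, p)\<in>set ps. poly (p x) t \<noteq> 0) \<or> poly (r x) t = 0)"
    by (rule dnf_or[OF _ dnf_basic[OF basic_zero[OF 1(2)]]])
  moreover have "(\<not> \<chi> x t) \<longleftrightarrow> (\<exists>(n, p)\<in>set ps. poly (p x) t \<noteq> 0) \<or> poly (r x) t = 0" for x t
    unfolding 1(3) by auto
  ultimately show ?thesis by (simp only:)
qed

lemma dnf_not:
  assumes "dnf V \<phi>"
  shows "dnf V (\<lambda>x t. \<not> \<phi> x t)"
proof -
  obtain L where L0: "(\<forall>\<chi>\<in>set L. basic V \<chi>) \<and> (\<forall>x t. \<phi> x t = (\<exists>\<chi>\<in>set L. \<chi> x t))"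
    using assms[unfolded dnf_def] ..
  note L = conjunct1[OF L0] conjunct2[OF L0, rule_format]
  have "dnf V (\<lambda>x t. \<forall>\<chi>\<in>set L. \<not> \<chi> x t)" using L(1)
  proof (induction L)
    case Nil
    then show ?case using dnf_True by simp
  next
    case (Cons a L)
    have "dnf V (\<lambda>x t. \<not> a x t \<and> (\<forall>\<chi>\<in>set L. \<not> \<chi> x t))"
    proof (rule dnf_and)
      show "dnf V (\<lambda>x t. \<not> a x t)" by (rule dnf_not_basic) (use Cons.prems in auto)
      show "dnf V (\<lambda>x t. \<forall>\<chi>\<in>set L. \<not> \<chi> x t)" by (rule Cons.IH) (use Cons.prems in auto)
    qed
    then show ?case by simp
  qed
  then show ?thesis by (simp only: L(2) bex_simps(8) ball_simps)
qed

lemma definable_dnf: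
  assumes "definable (insert v V) \<phi>"
  shows "dnf V (\<lambda>x t. \<phi> (x(v := t)))"
  using assms
proof (induction rule: definable.induct)
  case (df_zero p)
  obtain n q where q: "poly_family V n q \<and> (\<forall>x t. p (x(v := t)) = poly (q x) t)"
    using pf_from_rat_poly[OF df_zero] by (elim exE)
  show ?case
    unfolding conjunct2[OF q, rule_format] by (rule dnf_basic[OF basic_zero[OF conjunct1[OF q]]])
next
  case (df_not \<phi>)
  show ?case by (rule dnf_not[OF df_not.IH])
next
  case (df_and \<phi> \<psi>)
  show ?case by (rule dnf_and[OF df_and.IH])
qed

text \<open>The quantifier commutes with the disjunction of a normal form, and
  \<open>df_ex_roots\<close> removes it from each conjunction.\<close>

theorem definable_ex:
  assumes "definable (insert v V) \<phi>"
  shows "definable V (\<lambda>x. \<exists>t. \<phi> (x(v := t)))"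
proof -
  obtain L where L0: "(\<forall>\<chi>\<in>set L. basic V \<chi>) \<and> (\<forall>x t. \<phi> (x(v := t)) = (\<exists>\<chi>\<in>set L. \<chi> x t))"
    using definable_dnf[OF assms, unfolded dnf_def] ..
  note L = conjunct1[OF L0] conjunct2[OF L0, rule_format]
  have b: "definable V (\<lambda>x. \<exists>t. \<chi> x t)" if bas: "basic V \<chi>" for \<chi>
  proof -
    obtain ps k r where 1: "\<forall>(n, p)\<in>set ps. poly_family V n p" "poly_family V k r"
     "\<And>x t. \<chi> x t \<longleftrightarrow> (\<forall>(n, p)\<in>set ps. poly (p x) t = 0) \<and> poly (r x) t \<noteq> 0"
      using bas unfolding basic_def by blast
    show ?thesis unfolding 1(3) by (rule df_ex_roots[OF _ 1(2)]) (use 1(1) in auto)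
  qed
  have "definable V (\<lambda>x. \<exists>\<chi>\<in>set L. \<exists>t. \<chi> x t)" using L(1)
  proof (induction L)
    case Nil
    then show ?case using df_False by simp
  next
    case (Cons a L)
    have "definable V (\<lambda>x. (\<exists>t. a x t) \<or> (\<exists>\<chi>\<in>set L. \<exists>t. \<chi> x t))"
    proof (rule df_or)
      show "definable V (\<lambda>x. \<exists>t. a x t)" by (rule b) (use Cons.prems in auto)
      show "definable V (\<lambda>x. \<exists>\<chi>\<in>set L. \<exists>t. \<chi> x t)" by (rule Cons.IH) (use Cons.prems in auto)
    qed
    then show ?case by simp
  qed
  moreover have "(\<exists>t. \<phi> (x(v := t))) \<longleftrightarrow> (\<exists>\<chi>\<in>set L. \<exists>t. \<chi> x t)" for x
    unfolding L(2) by blast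
  ultimately show ?thesis by (simp only:)
qed

lemma definable_all:
  assumes "definable (insert v V) \<phi>"
  shows "definable V (\<lambda>x. \<forall>t. \<phi> (x(v := t)))"
proof -
  have "definable V (\<lambda>x. \<not> (\<exists>t. \<not> \<phi> (x(v := t))))"
    by (rule df_not[OF definable_ex[OF df_not[OF assms]]])
  then show ?thesis by simp
qed

text \<open>\<open>override_on x y W\<close> gives new values to all variables in \<open>W\<close>
  at once and keeps the other ones, so this is a block of existential quantifiers.\<close>

lemma definable_ex_set:
  assumes "finite W" "definable (W \<union> V) \<phi>"
  shows "definable V (\<lambda>x. \<exists>y. \<phi> (override_on x y W))"
  using assms
proof (induction W arbitrary: \<phi> rule: finite_induct)
  case empty
  then show ?case by simp
next
  case (insert w W)
  have "definable (W \<union> V) (\<lambda>x. \<exists>t. \<phi> (x(w := t)))"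
    by (rule definable_ex) (use insert.prems in simp)
  then have "definable V (\<lambda>x. \<exists>y. \<exists>t. \<phi> ((override_on x y W)(w := t)))" by (rule insert.IH)
  moreover have "(\<exists>y. \<exists>t. \<phi> ((override_on x y W)(w := t))) \<longleftrightarrow> (\<exists>y. \<phi> (override_on x y (insert w W)))" for x
  proof
    assume "\<exists>y. \<exists>t. \<phi> ((override_on x y W)(w := t))"
    then obtain y t where yt: "\<phi> ((override_on x y W)(w := t))" by blast
    have "(override_on x y W)(w := t) = override_on x (y(w := t)) (insert w W)"
      by (auto simp: override_on_def fun_eq_iff)
    then show "\<exists>y. \<phi> (override_on x y (insert w W))" using yt by metis
  next
    assume "\<exists>y. \<phi> (override_on x y (insert w W))"
    then obtain y where y: "\<phi> (override_on x y (insert w W))" by blast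
    have "(override_on x y W)(w := y w) = override_on x y (insert w W)"
      by (auto simp: override_on_def fun_eq_iff)
    then show "\<exists>y. \<exists>t. \<phi> ((override_on x y W)(w := t))" using y by metis
  qed
  ultimately show ?case by (simp only:)
qed


section \<open>Dynatomic polynomials\<close>

lemma complex_poly_eqI: "(\<And>x. poly p x = poly q x) \<Longrightarrow> p = (q :: complex poly)"
  using poly_eq_poly_eq_iff by blast

lemma poly_iterate: "poly (iterate f n) x = (poly f ^^ n) x"
  by (induction n) (simp_all add: iterate_def poly_pcompose)

lemma iterate_Suc: "iterate f (Suc n) = pcompose f (iterate f n)"
  by (simp add: iterate_def)

lemma iterate_1: "iterate f 1 = f"
  by (simp add: iterate_def)

lemma iterate_2: "iterate f 2 = pcompose f f"
  by (simp add: iterate_def numeral_2_eq_2)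

lemma iterate_add: "iterate f (m + n) = pcompose (iterate f m) (iterate f n)"
  by (rule complex_poly_eqI) (simp add: poly_iterate poly_pcompose funpow_add)

lemma iterate_mult: "iterate f (m * k) = iterate (iterate f m) k"
proof (rule complex_poly_eqI)
  fix x
  have "poly (iterate f m) = poly f ^^ m" by (simp add: poly_iterate fun_eq_iff)
  then show "poly (iterate f (m * k)) x = poly (iterate (iterate f m) k) x"
    by (simp add: poly_iterate funpow_mult mult.commute)
qed

lemma degree_iterate: "degree (iterate f n) = degree f ^ n"
  by (induction n) (simp_all add: iterate_Suc degree_pcompose, simp add: iterate_def)

lemma iterate_minus_X_nonzero:
  assumes "degree f \<ge> 2" "n \<ge> 1"
  shows "iterate f n - [:0, 1:] \<noteq> 0"
proof
  assume "iterate f n - [:0, 1:] = 0"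
  then have "iterate f n = [:0, 1:]" by simp
  then have "degree f ^ n = 1" using degree_iterate[of f n] by simp
  moreover have "degree f ^ 1 \<le> degree f ^ n" by (rule power_increasing) (use assms in auto)
  ultimately show False using assms by simp
qed

section \<open>Local orders of compositions and iterates\<close>

lemma order_eqI:
  fixes p :: "'a::idom poly"
  assumes "p = [:-z, 1:] ^ n * q" "poly q z \<noteq> 0"
  shows "order z p = n"
proof -
  have "p \<noteq> 0" using assms by auto
  then have "order z p = order z ([:-z, 1:] ^ n) + order z q" using assms(1) order_mult by blast
  then show ?thesis using assms(2) by (simp add: order_power_n_n order_0I)
qed

lemma order_factor:
  fixes p :: "'a::idom poly"
  assumes "p \<noteq> 0"
  obtains q where "p = [:-z, 1:] ^ order z p * q" "poly q z \<noteq> 0"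
  using order_decomp[OF assms, of z] poly_eq_0_iff_dvd by blast

text \<open>At an unramified point \<open>p\<close> is a local coordinate: \<open>p - p(x)\<close>
  is \<open>z - x\<close> times a factor that does not vanish at \<open>x\<close>.\<close>

lemma order_pcompose_unramified:
  fixes G p :: "complex poly"
  assumes "poly (pderiv p) x \<noteq> 0" "G \<noteq> 0"
  shows "order x (pcompose G p) = order (poly p x) G"
proof -
  define y where "y = poly p x"
  obtain u where u: "G = [:-y, 1:] ^ order y G * u" "poly u y \<noteq> 0"
    using order_factor[OF assms(2)] by blast
  have "poly (p - [:y:]) x = 0" by (simp add: y_def)
  then obtain w where w: "p - [:y:] = [:-x, 1:] * w" by (metis poly_eq_0_iff_dvd dvdE)
  then have "p = [:y:] + [:-x, 1:] * w" by (metis add.commute diff_add_cancel)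
  then have "pderiv p = pderiv ([:y:] + [:-x, 1:] * w)" by simp
  also have "\<dots> = [:-x, 1:] * pderiv w + w"
    by (simp only: pderiv_add pderiv_mult) (simp add: pderiv_pCons)
  finally have "poly (pderiv p) x = poly w x" by simp
  then have wx: "poly w x \<noteq> 0" using assms(1) by simp
  have "pcompose [:-y, 1:] p = p - [:y:]" by (rule complex_poly_eqI) (simp add: poly_pcompose)
  then have "pcompose [:-y, 1:] p = [:-x, 1:] * w" using w by (simp only:)
  moreover have "pcompose ([:-y, 1:] ^ n) p = pcompose [:-y, 1:] p ^ n" for n
    by (rule complex_poly_eqI) (simp add: poly_pcompose)
  ultimately have "pcompose G p = [:-x, 1:] ^ order y G * (w ^ order y G * pcompose u p)"
    by (subst u(1)) (simp only: pcompose_mult power_mult_distrib mult.assoc)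
  then show ?thesis unfolding y_def[symmetric]
    by (rule order_eqI) (use wx u(2) in \<open>simp add: poly_pcompose y_def\<close>)
qed

text \<open>If \<open>H\<close> is \<open>z + c (z - z\<^sub>0)\<^sup>N + \<dots>\<close> near \<open>z\<^sub>0\<close>, then its \<open>k\<close>-th iterate has \<open>k c\<close> in place of \<open>c\<close>.\<close>

lemma order_iterate_tangent:
  fixes H :: "complex poly"
  assumes fp: "poly H z = z" and der: "poly (pderiv H) z = 1" and nz: "H \<noteq> [:0, 1:]" and "k \<ge> 1"
  shows "order z (iterate H k - [:0, 1:]) = order z (H - [:0, 1:])"
proof -
  define N where "N = order z (H - [:0, 1:])"
  have nz': "H - [:0, 1:] \<noteq> 0" using nz by simp
  then obtain u where u: "H - [:0, 1:] = [:-z, 1:] ^ N * u" "poly u z \<noteq> 0"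
    using order_factor N_def by metis
  have N: "N = Suc (order z (pderiv (H - [:0, 1:])))"
    unfolding N_def by (rule order_pderiv[OF nz']) (simp add: fp)
  have "poly (pderiv (H - [:0, 1:])) z = 0" using der by (simp add: pderiv_diff pderiv_pCons)
  then have "order z (pderiv (H - [:0, 1:])) \<noteq> 0 \<or> pderiv (H - [:0, 1:]) = 0"
    using order_root by blast
  moreover have "pderiv (H - [:0, 1:]) \<noteq> 0"
  proof
    assume "pderiv (H - [:0, 1:]) = 0"
    then obtain c where "H - [:0, 1:] = [:c:]" using pderiv_iszero by blast
    moreover have "poly (H - [:0, 1:]) z = 0" using fp by simp
    ultimately show False using nz' by simp
  qed
  \<comment> \<open>The contact order is at least 2. Hence the factor \<open>?L\<close> by which
    \<open>H\<close> multiplies the local coordinate at \<open>z\<close> takes the value 1 there,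
    and each further composition merely adds one more copy of the value of \<open>u\<close>.\<close>
  ultimately obtain M where M: "N = Suc (Suc M)" using N by (metis not0_implies_Suc)
  have "\<exists>v. iterate H (Suc k) - [:0, 1:] = [:-z, 1:] ^ N * v \<and> poly v z = of_nat (Suc k) * poly u z" for k
  proof (induction k)
    case 0
    show ?case using u by (intro exI[of _ u]) (simp add: iterate_1[simplified])
  next
    case (Suc k)
    then obtain v where v: "iterate H (Suc k) - [:0, 1:] = [:-z, 1:] ^ N * v"
      "poly v z = of_nat (Suc k) * poly u z" by blast
    let ?L = "1 + [:-z, 1:] ^ Suc M * u"
    have "pcompose [:-z, 1:] H = [:-z, 1:] + (H - [:0, 1:])" by (simp add: pcompose_pCons)
    also have "\<dots> = [:-z, 1:] * ?L" unfolding u(1) M by (simp add: algebra_simps)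
    finally have cH: "pcompose [:-z, 1:] H = [:-z, 1:] * ?L" .
    have "iterate H (Suc (Suc k)) = pcompose (iterate H (Suc k)) H"
      using iterate_add[of H "Suc k" 1] by (simp add: iterate_1[simplified])
    then have "iterate H (Suc (Suc k)) - [:0, 1:] =
        pcompose (iterate H (Suc k) - [:0, 1:]) H + (H - [:0, 1:])"
      by (simp add: pcompose_diff pcompose_pCons)
    also have "pcompose (iterate H (Suc k) - [:0, 1:]) H = ([:-z, 1:] * ?L) ^ N * pcompose v H"
    proof -
      have "pcompose ([:-z, 1:] ^ N) H = pcompose [:-z, 1:] H ^ N"
        by (rule complex_poly_eqI) (simp add: poly_pcompose)
      then show ?thesis by (simp only: v(1) pcompose_mult cH)
    qed
    also have "\<dots> + (H - [:0, 1:]) = [:-z, 1:] ^ N * (?L ^ N * pcompose v H + u)"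
      unfolding u(1) by (simp only: power_mult_distrib distrib_left[of "[:-z, 1:] ^ N"] mult.assoc)
    finally show ?case
      using v(2) fp by (intro exI[of _ "?L ^ N * pcompose v H + u"]) (simp add: poly_pcompose algebra_simps)
  qed
  then obtain v where "iterate H k - [:0, 1:] = [:-z, 1:] ^ N * v" "poly v z = of_nat k * poly u z"
    using \<open>k \<ge> 1\<close> by (metis Suc_le_D One_nat_def)
  then show ?thesis
    unfolding N_def[symmetric] by (intro order_eqI[of _ _ _ v]) (use u(2) \<open>k \<ge> 1\<close> in auto)
qed

lemma poly_pderiv_iterate_fixed:
  assumes "poly F z = z"
  shows "poly (pderiv (iterate F k)) z = poly (pderiv F) z ^ k"
proof (induction k)
  case 0
  then show ?case by (simp add: iterate_def pderiv_pCons)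
next
  case (Suc k)
  have "(poly F ^^ k) z = z" using assms by (induction k) auto
  then show ?case using Suc by (simp add: iterate_Suc pderiv_pcompose poly_pcompose poly_iterate)
qed

lemma order_simple_fixed:
  fixes F :: "complex poly"
  assumes "poly F z = z" "poly (pderiv F) z \<noteq> 1"
  shows "order z (F - [:0, 1:]) = 1"
proof -
  have "poly (pderiv (F - [:0, 1:])) z \<noteq> 0" using assms(2) by (simp add: pderiv_diff pderiv_pCons)
  moreover have "F - [:0, 1:] \<noteq> 0" using assms(2) by (auto simp: pderiv_pCons)
  ultimately show ?thesis using order_pderiv[of "F - [:0, 1:]" z] assms(1) by (simp add: order_0I)
qed

text \<open>The exponent of \<open>z\<close> is 1 at its exact period \<open>m\<close>, plus, if its multiplier is a root of unity of
  order \<open>r\<close>, the excess contact order of the \<open>m r\<close>-th iterate with the identity, at \<open>m r\<close>.\<close>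

lemma order_iterate_decomposition:
  assumes deg: "degree f \<ge> 2"
  shows "\<exists>b :: nat \<Rightarrow> nat. \<forall>n\<ge>1. order z (iterate f n - [:0, 1:]) = (\<Sum>k | k dvd n. b k)"
proof (cases "\<exists>n\<ge>1. (poly f ^^ n) z = z")
  case False
  then have "order z (iterate f n - [:0, 1:]) = 0" if "n \<ge> 1" for n
    using that by (intro order_0I) (simp add: poly_iterate)
  then show ?thesis by (intro exI[of _ "\<lambda>k. 0"]) simp
next
  case True
  define m where "m = (LEAST n. n \<ge> 1 \<and> (poly f ^^ n) z = z)"
  have m: "m \<ge> 1" "(poly f ^^ m) z = z"
    using LeastI_ex[OF True[unfolded Bex_def]] True unfolding m_def by (metis (mono_tags, lifting) LeastI_ex)+
  have per: "(poly f ^^ n) z = z \<longleftrightarrow> m dvd n" for n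
  proof
    assume "(poly f ^^ n) z = z"
    then have "(poly f ^^ (n mod m)) z = z" using funpow_mod_eq[OF m(2), of n] by simp
    moreover have "n mod m < m" using m(1) by simp
    ultimately have "\<not> n mod m \<ge> 1" using not_less_Least[of "n mod m"] unfolding m_def by blast
    then have "n mod m = 0" by linarith
    then show "m dvd n" by (simp add: dvd_eq_mod_eq_0)
  next
    assume "m dvd n"
    then show "(poly f ^^ n) z = z" using funpow_mod_eq[OF m(2), of n] by simp
  qed
  define F where "F = iterate f m"
  define l where "l = poly (pderiv F) z"
  have F: "poly F z = z" using m(2) by (simp add: F_def poly_iterate)
  have ord0: "order z (iterate f n - [:0, 1:]) = 0" if "\<not> m dvd n" for n
    using that per[of n] by (intro order_0I) (simp add: poly_iterate)
  have ord1: "order z (iterate f (m * k) - [:0, 1:]) = 1" if "l ^ k \<noteq> 1" for k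
  proof -
    have "(poly F ^^ k) z = z" for k using F by (induction k) auto
    then have "poly (iterate F k) z = z" by (simp add: poly_iterate)
    moreover have "poly (pderiv (iterate F k)) z \<noteq> 1"
      using that poly_pderiv_iterate_fixed[OF F, of k] by (simp add: l_def)
    ultimately show ?thesis unfolding iterate_mult F_def[symmetric] by (rule order_simple_fixed)
  qed
  have fin: "finite {k. k dvd n}" if "n \<ge> 1" for n :: nat using that by simp
  show ?thesis
  proof (cases "\<exists>r\<ge>1. l ^ r = 1")
    case False
    have "order z (iterate f n - [:0, 1:]) = (\<Sum>k | k dvd n. if k = m then 1 else 0)" if n: "n \<ge> 1" for n
    proof (cases "m dvd n")
      case True
      then obtain k where k: "n = m * k" by blast
      then have "k \<ge> 1" using n by (cases k) auto
      then show ?thesis using ord1[of k] False True k fin[OF n] by (simp add: sum.delta)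
    next
      case False
      then show ?thesis using ord0[of n] fin[OF n] by (simp add: sum.delta)
    qed
    then show ?thesis by blast
  next
    case True
    define r where "r = (LEAST r. r \<ge> 1 \<and> l ^ r = 1)"
    have r: "r \<ge> 1" "l ^ r = 1"
      using True unfolding r_def by (metis (mono_tags, lifting) LeastI_ex)+
    have lk: "l ^ k = l ^ (k mod r)" for k
    proof -
      have "l ^ k = l ^ (r * (k div r) + k mod r)" by simp
      also have "\<dots> = (l ^ r) ^ (k div r) * l ^ (k mod r)" by (simp only: power_add power_mult)
      finally show ?thesis using r(2) by simp
    qed
    have lr: "l ^ k = 1 \<longleftrightarrow> r dvd k" for k
    proof
      assume "l ^ k = 1"
      then have "l ^ (k mod r) = 1" using lk by simp
      moreover have "k mod r < r" using r(1) by simp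
      ultimately have "\<not> k mod r \<ge> 1" using not_less_Least[of "k mod r"] unfolding r_def by blast
      then have "k mod r = 0" by linarith
      then show "r dvd k" by (simp add: dvd_eq_mod_eq_0)
    next
      assume "r dvd k"
      then show "l ^ k = 1" using lk[of k] by simp
    qed
    define G where "G = iterate f (m * r)"
    define e where "e = order z (G - [:0, 1:]) - 1"
    have G0: "G - [:0, 1:] \<noteq> 0" unfolding G_def by (rule iterate_minus_X_nonzero[OF deg]) (use m r in simp)
    have Gz: "poly G z = z" using per[of "m * r"] by (simp add: G_def poly_iterate)
    have Gd: "poly (pderiv G) z = 1"
      unfolding G_def iterate_mult F_def[symmetric] poly_pderiv_iterate_fixed[OF F] using r(2) by (simp add: l_def)
    have "order z (G - [:0, 1:]) \<noteq> 0" using G0 Gz order_root[of "G - [:0, 1:]" z] by simp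
    then have e: "order z (G - [:0, 1:]) = 1 + e" by (simp add: e_def)
    \<comment> \<open>The two contributions are added, not assigned by cases, because for
      \<open>r\<close> = 1 both sit at the index \<open>m\<close>.\<close>
    have "order z (iterate f n - [:0, 1:]) =
        (\<Sum>k | k dvd n. (if k = m then 1 else 0) + (if k = m * r then e else 0))" if n: "n \<ge> 1" for n
    proof -
      have S: "(\<Sum>k | k dvd n. (if k = m then 1 else 0) + (if k = m * r then e else 0)) =
          (if m dvd n then 1 else 0) + (if m * r dvd n then e else 0)"
        using fin[OF n] by (simp add: sum.distrib sum.delta)
      show ?thesis
      proof (cases "m dvd n")
        case False
        then have "\<not> m * r dvd n" using dvd_mult_left by blast
        then show ?thesis using ord0[OF False] False S by simp
      next
        case True
        then obtain k where k: "n = m * k" by blast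
        then have k1: "k \<ge> 1" using n by (cases k) auto
        show ?thesis
        proof (cases "r dvd k")
          case False
          then show ?thesis using ord1[of k] lr[of k] k S m(1) by simp
        next
          case True
          then obtain j where j: "k = r * j" by blast
          then have "j \<ge> 1" using k1 by (cases j) auto
          have "iterate f n = iterate G j" by (simp add: k j G_def iterate_mult mult.assoc[symmetric])
          then have "order z (iterate f n - [:0, 1:]) = 1 + e"
            using order_iterate_tangent[OF Gz Gd _ \<open>j \<ge> 1\<close>] G0 e by simp
          then show ?thesis using S k j by simp
        qed
      qed
    qed
    then show ?thesis by blast
  qed
qed

text \<open>Multiplicative Moebius inversion, by recursion over the proper divisors. It provides the
  leading coefficients of the dynatomic polynomials, which their roots leave undetermined.\<close>

fun moebius_quotient :: "(nat \<Rightarrow> complex) \<Rightarrow> nat \<Rightarrow> complex" where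
  "moebius_quotient L n = L n / (\<Prod>k\<in>{k. k dvd n \<and> k < n}. moebius_quotient L k)"

declare moebius_quotient.simps [simp del]

lemma divisors_split: "n \<ge> 1 \<Longrightarrow> {k :: nat. k dvd n} = insert n {k. k dvd n \<and> k < n}"
  by (auto dest: dvd_imp_le)

lemma moebius_quotient:
  assumes "\<And>n. n \<ge> 1 \<Longrightarrow> L n \<noteq> 0" "n \<ge> 1"
  shows "moebius_quotient L n \<noteq> 0" "(\<Prod>k | k dvd n. moebius_quotient L k) = L n"
proof -
  have nz: "moebius_quotient L n \<noteq> 0" if "n \<ge> 1" for n
    using that
  proof (induction n rule: less_induct)
    case (less n)
    have "finite {k. k dvd n \<and> k < n}" by simp
    moreover have "moebius_quotient L k \<noteq> 0" if "k dvd n" "k < n" for k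
      by (rule less.IH[OF that(2)]) (use that in \<open>cases k, auto\<close>)
    ultimately show ?case
      using assms(1)[of n] less.prems by (subst moebius_quotient.simps) (auto simp: prod_zero_iff)
  qed
  then show "moebius_quotient L n \<noteq> 0" using assms(2) .
  have "(\<Prod>k\<in>{k. k dvd n \<and> k < n}. moebius_quotient L k) \<noteq> 0"
  proof -
    have "k \<ge> 1" if "k dvd n" "k < n" for k using that by (cases k) auto
    then show ?thesis using nz by (simp add: prod_zero_iff)
  qed
  moreover have "(\<Prod>k | k dvd n. moebius_quotient L k) =
      moebius_quotient L n * (\<Prod>k\<in>{k. k dvd n \<and> k < n}. moebius_quotient L k)"
    using divisors_split[OF assms(2)] by simp
  ultimately show "(\<Prod>k | k dvd n. moebius_quotient L k) = L n"
    by (subst (asm) (2) moebius_quotient.simps) simp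
qed

lemma proots_prod_linear: "proots (\<Prod>x\<in>#M. [:-g x, 1:]) = image_mset g (M :: 'b multiset)"
  for g :: "'b \<Rightarrow> 'a::idom"
proof (induction M)
  case (add x M)
  have "(\<Prod>x\<in>#M. [:-g x, 1:]) \<noteq> 0" by (auto simp: prod_mset_zero_iff)
  then show ?case using add by (simp add: proots_mult del: mult_pCons_left mult_pCons_right)
qed simp

lemma lead_coeff_prod_linear: "lead_coeff (\<Prod>x\<in>#M. [:-g x, 1:]) = (1 :: 'a::idom)"
  by (induction M) (simp_all add: lead_coeff_mult del: mult_pCons_left mult_pCons_right)

lemma complex_poly_eq_proots:
  fixes p q :: "complex poly"
  assumes "lead_coeff p = lead_coeff q" "proots p = proots q"
  shows "p = q"
  using complex_poly_decompose_multiset assms by metis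

text \<open>The exponents \<open>b z k\<close> prescribe the roots of each factor,
  \<open>moebius_quotient\<close> prescribes its leading coefficient, and a complex polynomial is
  determined by these data.\<close>

lemma dynatomic_family_exists:
  assumes deg: "degree f \<ge> 2"
  shows "\<exists>\<Phi>. \<forall>n\<ge>1. iterate f n - [:0, 1:] = (\<Prod>k | k dvd n. \<Phi> k)"
proof -
  obtain b :: "complex \<Rightarrow> nat \<Rightarrow> nat" where
    b: "\<And>z n. n \<ge> 1 \<Longrightarrow> order z (iterate f n - [:0, 1:]) = (\<Sum>k | k dvd n. b z k)"
    using order_iterate_decomposition[OF deg] by metis
  \<comment> \<open>Only indices \<open>k\<close> >= 1 matter. There \<open>b z k\<close> is at most
    the order of \<open>z\<close> as a zero of the \<open>k\<close>-th iterate minus the identity,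
    so the support is finite and the abstraction is legitimate.\<close>
  define M where "M k = Abs_multiset (\<lambda>z. b z k)" for k
  have fin: "finite {z. 0 < b z k}" if "k \<ge> 1" for k
  proof (rule finite_subset)
    show "finite {z. poly (iterate f k - [:0, 1:]) z = 0}"
      by (rule poly_roots_finite[OF iterate_minus_X_nonzero[OF deg that]])
    show "{z. 0 < b z k} \<subseteq> {z. poly (iterate f k - [:0, 1:]) z = 0}"
    proof safe
      fix z assume "0 < b z k"
      moreover have "b z k \<le> (\<Sum>j | j dvd k. b z j)" by (rule member_le_sum) (use that in auto)
      ultimately have "order z (iterate f k - [:0, 1:]) \<noteq> 0" using b[OF that, of z] by linarith
      then show "poly (iterate f k - [:0, 1:]) z = 0" using order_root by blast
    qed
  qed
  have M: "count (M k) z = b z k" if "k \<ge> 1" for k z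
    using fin[OF that] unfolding M_def by (subst count_Abs_multiset) auto
  define L where "L n = lead_coeff (iterate f n - [:0, 1:])" for n
  have L: "L n \<noteq> 0" if "n \<ge> 1" for n
    unfolding L_def leading_coeff_0_iff by (rule iterate_minus_X_nonzero[OF deg that])
  define \<Phi> where "\<Phi> k = smult (moebius_quotient L k) (\<Prod>x\<in>#M k. [:-x, 1:])" for k
  have "iterate f n - [:0, 1:] = (\<Prod>k | k dvd n. \<Phi> k)" if n: "n \<ge> 1" for n
  proof (rule complex_poly_eq_proots)
    have k1: "k \<ge> 1" if "k dvd n" for k using that n by (cases k) auto
    have \<Phi>_lead: "lead_coeff (\<Phi> k) = moebius_quotient L k" for k
      unfolding \<Phi>_def lead_coeff_smult using lead_coeff_prod_linear[of "\<lambda>x. x" "M k"] by simp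
    show "lead_coeff (iterate f n - [:0, 1:]) = lead_coeff (\<Prod>k | k dvd n. \<Phi> k)"
      unfolding lead_coeff_prod \<Phi>_lead
      by (rule trans[OF _ moebius_quotient(2)[of L n, OF L n, symmetric]]) (simp_all only: L_def)
    have nz: "\<Phi> k \<noteq> 0" if "k \<ge> 1" for k
      unfolding \<Phi>_def using moebius_quotient(1)[OF L that] by (auto simp: prod_mset_zero_iff)
    have "proots (\<Phi> k) = M k" if "k \<ge> 1" for k
      unfolding \<Phi>_def using moebius_quotient(1)[OF L that] proots_prod_linear[of "\<lambda>x. x" "M k"] by simp
    then have "proots (\<Prod>k | k dvd n. \<Phi> k) = (\<Sum>k | k dvd n. M k)"
      using nz k1 by (subst proots_prod) auto
    moreover have "proots (iterate f n - [:0, 1:]) = (\<Sum>k | k dvd n. M k)"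
    proof (rule multiset_eqI)
      fix z
      have "count (proots (iterate f n - [:0, 1:])) z = (\<Sum>k | k dvd n. b z k)"
        using b[OF n] iterate_minus_X_nonzero[OF deg n] by simp
      also have "\<dots> = (\<Sum>k | k dvd n. count (M k) z)" by (rule sum.cong) (use M k1 in auto)
      finally show "count (proots (iterate f n - [:0, 1:])) z = count (\<Sum>k | k dvd n. M k) z"
        by (simp add: count_sum)
    qed
    ultimately show "proots (iterate f n - [:0, 1:]) = proots (\<Prod>k | k dvd n. \<Phi> k)" by simp
  qed
  then show ?thesis by blast
qed

text \<open>The description in \<open>dynatomic\<close> ranges over entire families, so it has a
  value only because a family exists for all \<open>n\<close> simultaneously. Uniqueness at 1 and 2
  follows by cancelling \<open>f - z\<close>.\<close>

lemma dynatomic_1_2: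
  assumes deg: "degree f \<ge> 2"
  shows "dynatomic f 1 = f - [:0, 1:]" "dynatomic f 1 * dynatomic f 2 = iterate f 2 - [:0, 1:]"
proof -
  let ?P = "\<lambda>\<Phi>. \<forall>n\<ge>1. iterate f n - [:0, 1:] = (\<Prod>k | k dvd n. \<Phi> k)"
  have d2: "{k::nat. k dvd 2} = {1, 2}"
    using two_is_prime_nat by (auto simp: prime_nat_iff)
  have one: "\<Phi> 1 = f - [:0, 1:]" if "?P \<Phi>" for \<Phi>
    using spec[OF that, of 1] iterate_1[of f] by simp
  have two: "\<Phi> 1 * \<Phi> 2 = iterate f 2 - [:0, 1:]" if "?P \<Phi>" for \<Phi>
    using spec[OF that, of 2] d2 by simp
  have nz: "f - [:0, 1:] \<noteq> 0" using iterate_minus_X_nonzero[OF deg, of 1] iterate_1[of f] by simp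
  obtain \<Phi> where \<Phi>: "?P \<Phi>" using dynatomic_family_exists[OF deg] by blast
  have D1: "dynatomic f 1 = \<Phi> 1"
    unfolding dynatomic_def
  proof (rule the_equality)
    show "\<exists>\<Phi>'. ?P \<Phi>' \<and> \<Phi> 1 = \<Phi>' 1" using \<Phi> by blast
    show "q = \<Phi> 1" if "\<exists>\<Phi>'. ?P \<Phi>' \<and> q = \<Phi>' 1" for q
    proof -
      from that obtain \<Phi>' where "?P \<Phi>'" "q = \<Phi>' 1" by blast
      then show ?thesis using one[OF \<Phi>] one[of \<Phi>'] by simp
    qed
  qed
  have D2: "dynatomic f 2 = \<Phi> 2"
    unfolding dynatomic_def
  proof (rule the_equality)
    show "\<exists>\<Phi>'. ?P \<Phi>' \<and> \<Phi> 2 = \<Phi>' 2" using \<Phi> by blast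
    show "q = \<Phi> 2" if "\<exists>\<Phi>'. ?P \<Phi>' \<and> q = \<Phi>' 2" for q
    proof -
      from that obtain \<Phi>' where P': "?P \<Phi>'" and q: "q = \<Phi>' 2" by blast
      have "(f - [:0, 1:]) * \<Phi>' 2 = (f - [:0, 1:]) * \<Phi> 2"
        using two[OF \<Phi>] two[OF P'] one[OF \<Phi>] one[OF P'] by simp
      then show ?thesis using nz q by (metis mult_left_cancel)
    qed
  qed
  show "dynatomic f 1 = f - [:0, 1:]" using D1 one[OF \<Phi>] by simp
  show "dynatomic f 1 * dynatomic f 2 = iterate f 2 - [:0, 1:]" using D1 D2 two[OF \<Phi>] by simp
qed


section \<open>Multipliers and conjugation\<close>

definition fixed_multipliers :: "complex poly \<Rightarrow> complex multiset" where
  "fixed_multipliers f = image_mset (poly (pderiv f)) (proots (f - [:0, 1:]))"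

text \<open>A plain set over points of exact period 2, so that inclusion between two such sets is a
  first-order condition.\<close>

definition cycle2_multipliers :: "complex poly \<Rightarrow> complex set" where
  "cycle2_multipliers f = (\<lambda>x. poly (pderiv f) x * poly (pderiv f) (poly f x)) `
     {x. poly f (poly f x) = x \<and> poly f x \<noteq> x}"

text \<open>Free of division and of polynomial composition, hence directly expressible by a formula
  with quantified \<open>\<alpha>\<close>, \<open>\<beta>\<close> and \<open>t\<close>.\<close>

definition conjugate :: "complex poly \<Rightarrow> complex poly \<Rightarrow> bool" where
  "conjugate f g \<longleftrightarrow> (\<exists>\<alpha> \<beta>. \<alpha> \<noteq> 0 \<and> (\<forall>t. poly g (\<alpha> * t + \<beta>) = \<alpha> * poly f t + \<beta>))"

lemma monic_power2_eqD:
  fixes p q :: "complex poly"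
  assumes "lead_coeff p = 1" "lead_coeff q = 1" "p ^ 2 = q ^ 2"
  shows "p = q"
proof -
  have "p = q \<or> p = - q" using assms(3) by (simp add: power2_eq_iff)
  moreover have "p \<noteq> - q"
  proof
    assume "p = - q"
    then have "lead_coeff p = - lead_coeff q" by simp
    then show False using assms by simp
  qed
  ultimately show ?thesis by blast
qed

lemma multipliers_1:
  assumes "degree f \<ge> 2"
  shows "multipliers f 1 = fixed_multipliers f"
proof -
  let ?P = "\<Prod>z\<in>#proots (dynatomic f 1). [:- poly (pderiv (iterate f 1)) z, 1:]"
  have "mult_poly f 1 = ?P"
    unfolding mult_poly_def
    by (rule the_equality) (use lead_coeff_prod_linear in auto)
  then show ?thesis
    unfolding multipliers_def fixed_multipliers_def
    using proots_prod_linear[of "poly (pderiv (iterate f 1))" "proots (dynatomic f 1)"]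
      dynatomic_1_2(1)[OF assms] iterate_1[of f] by simp
qed

text \<open>Selects one point from each 2-cycle; the product over this half is the square root that
  defines the polynomial of multipliers.\<close>

lemma involution_half:
  assumes "finite S" "\<And>x. x \<in> S \<Longrightarrow> \<sigma> x \<in> S \<and> \<sigma> (\<sigma> x) = x \<and> \<sigma> x \<noteq> x"
  shows "\<exists>T. T \<subseteq> S \<and> T \<inter> \<sigma> ` T = {} \<and> T \<union> \<sigma> ` T = S"
  using assms
proof (induction S rule: finite_psubset_induct)
  case (psubset S)
  show ?case
  proof (cases "S = {}")
    case False
    then obtain x where x: "x \<in> S" by blast
    let ?S = "S - {x, \<sigma> x}"
    have "?S \<subset> S" using x by blast
    moreover have "\<sigma> y \<in> ?S \<and> \<sigma> (\<sigma> y) = y \<and> \<sigma> y \<noteq> y" if "y \<in> ?S" for y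
      using that psubset.prems[of y] psubset.prems[OF x] by fastforce
    ultimately obtain T where T: "T \<subseteq> ?S" "T \<inter> \<sigma> ` T = {}" "T \<union> \<sigma> ` T = ?S"
      using psubset.IH[of ?S] by blast
    have "\<sigma> x \<notin> T" "x \<notin> \<sigma> ` T" using T by blast+
    moreover have "\<sigma> x \<noteq> x" "\<sigma> x \<in> S" using psubset.prems[OF x] by blast+
    ultimately show ?thesis using T x by (intro exI[of _ "insert x T"]) auto
  qed auto
qed

lemma dvd_pcompose_diff: "(p - q) dvd (pcompose F p - pcompose F (q :: complex poly))"
proof (induction F)
  case (pCons a F)
  have "pcompose (pCons a F) p - pcompose (pCons a F) q =
      p * (pcompose F p - pcompose F q) + (p - q) * pcompose F q"
    by (simp add: pcompose_pCons algebra_simps)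
  then show ?case using pCons by simp
qed simp

lemma poly_pderiv_iterate_2: "poly (pderiv (iterate f 2)) x = poly (pderiv f) x * poly (pderiv f) (poly f x)"
  by (simp add: iterate_2 pderiv_pcompose poly_pcompose)

text \<open>With G = f(f(z)) - z one has G(f(z)) = f(f(f(z))) - f(z), which is divisible by G; and
  composing with \<open>f\<close> preserves orders at an unramified point.\<close>

lemma order_cycle2_le:
  assumes deg: "degree f \<ge> 2" and "poly (pderiv f) x \<noteq> 0"
  shows "order x (iterate f 2 - [:0, 1:]) \<le> order (poly f x) (iterate f 2 - [:0, 1:])"
proof -
  let ?G = "iterate f 2 - [:0, 1:]"
  have G: "?G \<noteq> 0" by (rule iterate_minus_X_nonzero[OF deg]) simp
  have "?G dvd pcompose f (iterate f 2) - pcompose f [:0, 1:]" by (rule dvd_pcompose_diff)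
  also have "pcompose f (iterate f 2) - pcompose f [:0, 1:] = pcompose ?G f"
    by (rule complex_poly_eqI) (simp add: poly_pcompose iterate_2)
  finally have "?G dvd pcompose ?G f" .
  moreover have "pcompose ?G f \<noteq> 0" using pcompose_eq_0[of ?G f] G deg by auto
  ultimately have "order x ?G \<le> order x (pcompose ?G f)" by (intro dvd_imp_order_le)
  then show ?thesis using order_pcompose_unramified[OF assms(2) G] by simp
qed

text \<open>If the cycle has multiplier 1, both its points are unramified and the previous
  inequality applies in both directions. Otherwise, in particular if a point is critical, both
  orders are 1.\<close>

lemma order_cycle2:
  assumes deg: "degree f \<ge> 2" and x: "poly f (poly f x) = x"
  shows "order (poly f x) (iterate f 2 - [:0, 1:]) = order x (iterate f 2 - [:0, 1:])"
proof (cases "poly (pderiv (iterate f 2)) x = 1")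
  case True
  then have "poly (pderiv f) x \<noteq> 0" "poly (pderiv f) (poly f x) \<noteq> 0"
    unfolding poly_pderiv_iterate_2 by auto
  then show ?thesis
    using order_cycle2_le[OF deg, of x] order_cycle2_le[OF deg, of "poly f x"] x by simp
next
  case False
  have "poly (pderiv (iterate f 2)) (poly f x) \<noteq> 1"
    using False x by (simp add: poly_pderiv_iterate_2 mult.commute)
  moreover have "poly (iterate f 2) x = x" "poly (iterate f 2) (poly f x) = poly f x"
    using x by (simp_all add: iterate_2 poly_pcompose)
  ultimately show ?thesis using order_simple_fixed False by metis
qed

lemma order_dynatomic_2:
  assumes deg: "degree f \<ge> 2"
  shows "order x (iterate f 2 - [:0, 1:]) = order x (f - [:0, 1:]) + order x (dynatomic f 2)"
    "dynatomic f 2 \<noteq> 0"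
proof -
  have "iterate f 2 - [:0, 1:] \<noteq> 0" by (rule iterate_minus_X_nonzero[OF deg]) simp
  then have "(f - [:0, 1:]) * dynatomic f 2 \<noteq> 0" 
    using dynatomic_1_2[OF deg] by simp
  moreover from this have "order x ((f - [:0, 1:]) * dynatomic f 2) =
      order x (f - [:0, 1:]) + order x (dynatomic f 2)"
    by (rule order_mult)
  ultimately show "order x (iterate f 2 - [:0, 1:]) = order x (f - [:0, 1:]) + order x (dynatomic f 2)"
    "dynatomic f 2 \<noteq> 0"
    using dynatomic_1_2[OF deg] by auto
qed

text \<open>The hypothesis makes every fixed point a simple zero of \<open>iterate f 2 - z\<close>,
  so none is a root of the dynatomic polynomial and its roots are the points of exact period 2.
  Multiplier and multiplicity agree at the two points of a cycle, hence the product over one half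
  \<open>T\<close> is the monic square root.\<close>

lemma set_multipliers_2:
  assumes deg: "degree f \<ge> 2" and hyp: "\<And>z. poly f z = z \<Longrightarrow> poly (pderiv f) z ^ 2 \<noteq> 1"
  shows "set_mset (multipliers f 2) = cycle2_multipliers f"
proof -
  let ?A = "proots (dynatomic f 2)" and ?G = "iterate f 2 - [:0, 1:]"
  define g where "g x = poly (pderiv (iterate f 2)) x" for x
  define S where "S = {x. poly f (poly f x) = x \<and> poly f x \<noteq> x}"
  have G: "?G \<noteq> 0" by (rule iterate_minus_X_nonzero[OF deg]) simp
  have e: "f - [:0, 1:] \<noteq> 0" using iterate_minus_X_nonzero[OF deg, of 1] iterate_1[of f] by simp
  have cS: "count ?A x = order x ?G" if "x \<in> S" for x
  proof -
    have "order x (f - [:0, 1:]) = 0" by (rule order_0I) (use that in \<open>simp add: S_def\<close>)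
    then show ?thesis using order_dynatomic_2(1)[OF deg, of x] order_dynatomic_2(2)[OF deg] by simp
  qed
  have setA: "x \<in># ?A \<longleftrightarrow> x \<in> S" for x
  proof -
    have "x \<in># ?A \<longleftrightarrow> order x (dynatomic f 2) \<noteq> 0"
      using order_dynatomic_2(2)[OF deg] by (simp add: order_root)
    also have "\<dots> \<longleftrightarrow> x \<in> S"
    proof (cases "poly f x = x")
      case True
      then have "order x ?G = 1"
        using hyp[OF True] by (intro order_simple_fixed) (auto simp: iterate_2 poly_pcompose pderiv_pcompose power2_eq_square)
      moreover have "order x (f - [:0, 1:]) \<noteq> 0" using e True order_root[of "f - [:0, 1:]" x] by simp
      ultimately show ?thesis using order_dynatomic_2(1)[OF deg, of x] True by (simp add: S_def)
    next
      case False
      then have "order x (f - [:0, 1:]) = 0" by (intro order_0I) simp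
      then have "order x (dynatomic f 2) = order x ?G" using order_dynatomic_2(1)[OF deg, of x] by simp
      then show ?thesis using False G order_root[of ?G x] by (simp add: S_def iterate_2 poly_pcompose)
    qed
    finally show ?thesis .
  qed
  have finS: "finite S" using setA by (metis finite_set_mset finite_subset subsetI)
  have setA': "set_mset ?A = S" using setA by blast
  have inv: "poly f x \<in> S \<and> poly f (poly f x) = x \<and> poly f x \<noteq> x" if "x \<in> S" for x
    using that unfolding S_def mem_Collect_eq by metis
  obtain T where T: "T \<subseteq> S" "T \<inter> poly f ` T = {}" "T \<union> poly f ` T = S"
    using involution_half[OF finS inv] by blast
  have finT: "finite T" using T(1) finS finite_subset by blast
  have inj: "inj_on (poly f) T"
    by (rule inj_on_inverseI[of _ "poly f"]) (use T(1) S_def in auto)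
  define h where "h x = [:- g x, 1:] ^ count ?A x" for x
  have hinv: "h (poly f x) = h x" if "x \<in> T" for x
  proof -
    have x: "x \<in> S" "poly f x \<in> S" using that T by blast+
    then have "poly f (poly f x) = x" by (simp add: S_def)
    then have "g (poly f x) = g x" by (simp add: g_def poly_pderiv_iterate_2 mult.commute)
    moreover have "count ?A (poly f x) = count ?A x"
      using order_cycle2[OF deg, of x] x cS by (simp add: S_def)
    ultimately show ?thesis by (simp add: h_def)
  qed
  define \<chi> where "\<chi> = prod h T"
  have P: "(\<Prod>z\<in>#?A. [:- g z, 1:]) = \<chi> ^ 2"
  proof -
    have "(\<Prod>z\<in>#?A. [:- g z, 1:]) = prod h S"
      unfolding image_prod_mset_multiplicity setA' h_def ..
    also have "\<dots> = prod h T * prod h (poly f ` T)"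
      unfolding T(3)[symmetric] by (rule prod.union_disjoint) (use finT T(2) in auto)
    also have "prod h (poly f ` T) = prod h T"
      unfolding prod.reindex[OF inj] by (rule prod.cong) (use hinv in auto)
    finally show ?thesis by (simp add: \<chi>_def power2_eq_square)
  qed
  have lead: "lead_coeff \<chi> = 1"
    unfolding \<chi>_def lead_coeff_prod h_def by (intro prod.neutral) (simp add: lead_coeff_power)
  have "mult_poly f 2 = \<chi>"
    unfolding mult_poly_def g_def[symmetric] P
    by (rule the_equality) (use lead monic_power2_eqD in auto)
  then have "multipliers f 2 = proots \<chi>" by (simp add: multipliers_def)
  moreover have "\<chi> \<noteq> 0" using lead by auto
  ultimately have "set_mset (multipliers f 2) = set_mset (proots (\<chi> ^ 2))" by simp
  also have "\<dots> = g ` S" unfolding P[symmetric] proots_prod_linear by (simp add: setA')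
  also have "\<dots> = cycle2_multipliers f"
    unfolding cycle2_multipliers_def S_def g_def poly_pderiv_iterate_2 ..
  finally show ?thesis .
qed

section \<open>Conjugacy as an equivalence relation, and its invariants\<close>

lemma conjugate_sym: "conjugate f g \<Longrightarrow> conjugate g f"
  unfolding conjugate_def
proof (elim exE conjE)
  fix \<alpha> \<beta> :: complex
  assume a: "\<alpha> \<noteq> 0" and h: "\<forall>t. poly g (\<alpha> * t + \<beta>) = \<alpha> * poly f t + \<beta>"
  have "poly f (1 / \<alpha> * t + (- \<beta> / \<alpha>)) = 1 / \<alpha> * poly g t + (- \<beta> / \<alpha>)" for t
    using h[rule_format, of "1 / \<alpha> * t + (- \<beta> / \<alpha>)"] a by (simp add: field_simps)
  then show "\<exists>\<alpha> \<beta>. \<alpha> \<noteq> 0 \<and> (\<forall>t. poly f (\<alpha> * t + \<beta>) = \<alpha> * poly g t + \<beta>)"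
    using a by (intro exI[of _ "1 / \<alpha>"] exI[of _ "- \<beta> / \<alpha>"]) simp
qed

lemma conjugate_refl: "conjugate f f"
  unfolding conjugate_def by (intro exI[of _ 1] exI[of _ 0]) simp

lemma conjugate_trans: "conjugate f g \<Longrightarrow> conjugate g h \<Longrightarrow> conjugate f h"
  unfolding conjugate_def
proof (elim exE conjE)
  fix \<alpha> \<beta> \<gamma> \<delta> :: complex
  assume a: "\<alpha> \<noteq> 0" "\<gamma> \<noteq> 0" and h: "\<forall>t. poly g (\<alpha> * t + \<beta>) = \<alpha> * poly f t + \<beta>"
    "\<forall>t. poly h (\<gamma> * t + \<delta>) = \<gamma> * poly g t + \<delta>"
  have "poly h ((\<gamma> * \<alpha>) * t + (\<gamma> * \<beta> + \<delta>)) = (\<gamma> * \<alpha>) * poly f t + (\<gamma> * \<beta> + \<delta>)" for t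
  proof -
    have "poly h (\<gamma> * (\<alpha> * t + \<beta>) + \<delta>) = \<gamma> * (\<alpha> * poly f t + \<beta>) + \<delta>"
      by (simp only: h)
    then show ?thesis by (simp add: algebra_simps)
  qed
  then show "\<exists>\<alpha> \<beta>. \<alpha> \<noteq> 0 \<and> (\<forall>t. poly h (\<alpha> * t + \<beta>) = \<alpha> * poly f t + \<beta>)"
    using a by (intro exI[of _ "\<gamma> * \<alpha>"] exI[of _ "\<gamma> * \<beta> + \<delta>"]) simp
qed

lemma conj_rel_iff: "(f, g) \<in> conj_rel \<longleftrightarrow> conjugate f g"
proof
  assume "(f, g) \<in> conj_rel"
  then obtain \<alpha> \<beta> where a: "\<alpha> \<noteq> 0" and g: "g = aff_conj \<alpha> \<beta> f" by (auto simp: conj_rel_def)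
  have "poly g (\<alpha> * t + \<beta>) = \<alpha> * poly f t + \<beta>" for t
    using a by (simp add: g aff_conj_def poly_pcompose field_simps)
  then show "conjugate f g" using a unfolding conjugate_def by blast
next
  assume "conjugate f g"
  then obtain \<alpha> \<beta> where a: "\<alpha> \<noteq> 0" and h: "\<And>t. poly g (\<alpha> * t + \<beta>) = \<alpha> * poly f t + \<beta>"
    by (auto simp: conjugate_def)
  have "g = aff_conj \<alpha> \<beta> f"
  proof (rule complex_poly_eqI)
    fix t
    show "poly g t = poly (aff_conj \<alpha> \<beta> f) t"
      using h[of "- \<beta> / \<alpha> + t / \<alpha>"] a by (simp add: aff_conj_def poly_pcompose field_simps)
  qed
  then show "(f, g) \<in> conj_rel" using a by (auto simp: conj_rel_def)
qed

lemma conj_class_eq_iff: "conj_class f = conj_class g \<longleftrightarrow> conjugate f g"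
proof
  assume "conj_class f = conj_class g"
  then have "g \<in> conj_class f" using conjugate_refl by (simp add: conj_class_def conj_rel_iff)
  then show "conjugate f g" by (simp add: conj_class_def conj_rel_iff)
next
  assume "conjugate f g"
  then show "conj_class f = conj_class g"
    unfolding conj_class_def by (simp add: set_eq_iff conj_rel_iff) (metis conjugate_sym conjugate_trans)
qed

locale conjugation =
  fixes f g :: "complex poly" and \<alpha> \<beta> :: complex
  assumes \<alpha>: "\<alpha> \<noteq> 0" and conj: "\<And>t. poly g (\<alpha> * t + \<beta>) = \<alpha> * poly f t + \<beta>"
begin

lemma pcompose_eq: "pcompose g [:\<beta>, \<alpha>:] = smult \<alpha> f + [:\<beta>:]"
  by (rule complex_poly_eqI) (use conj in \<open>simp add: poly_pcompose algebra_simps\<close>)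

lemma degree_eq: "degree g = degree f"
proof -
  have "degree g = degree (pcompose g [:\<beta>, \<alpha>:])" using \<alpha> by (simp add: degree_pcompose)
  also have "\<dots> = degree f"
  proof (cases "degree f = 0")
    case True
    then show ?thesis unfolding pcompose_eq using degree_add_le[of "smult \<alpha> f" 0 "[:\<beta>:]"] \<alpha> by simp
  next
    case False
    then show ?thesis unfolding pcompose_eq using \<alpha> by (subst degree_add_eq_left) auto
  qed
  finally show ?thesis .
qed

lemma pderiv_eq: "poly (pderiv g) (\<alpha> * t + \<beta>) = poly (pderiv f) t"
proof -
  have "pderiv (pcompose g [:\<beta>, \<alpha>:]) = pderiv (smult \<alpha> f + [:\<beta>:])" by (simp only: pcompose_eq)
  then have "poly (pderiv (pcompose g [:\<beta>, \<alpha>:])) t = poly (pderiv (smult \<alpha> f + [:\<beta>:])) t" by (simp only:)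
  then show ?thesis
    using \<alpha> by (simp add: pderiv_pcompose pderiv_add pderiv_smult pderiv_pCons poly_pcompose algebra_simps)
qed

lemma order_shift: "q \<noteq> 0 \<Longrightarrow> order (\<alpha> * x + \<beta>) q = order x (pcompose q [:\<beta>, \<alpha>:])"
  using order_pcompose_unramified[of "[:\<beta>, \<alpha>:]" x q] \<alpha> by (simp add: pderiv_pCons algebra_simps)

lemma order_fixed:
  assumes "degree f \<ge> 2"
  shows "order (\<alpha> * x + \<beta>) (g - [:0, 1:]) = order x (f - [:0, 1:])"
proof -
  have "g - [:0, 1:] \<noteq> 0"
    using iterate_minus_X_nonzero[of g 1] iterate_1[of g] degree_eq assms by simp
  moreover have "pcompose (g - [:0, 1:]) [:\<beta>, \<alpha>:] = smult \<alpha> (f - [:0, 1:])"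
    by (rule complex_poly_eqI) (use conj in \<open>simp add: poly_pcompose algebra_simps\<close>)
  ultimately show ?thesis using order_shift[of "g - [:0, 1:]" x] \<alpha> by (simp add: order_smult)
qed

lemma order_fixed_2:
  assumes "degree f \<ge> 2"
  shows "order (\<alpha> * x + \<beta>) (iterate g 2 - [:0, 1:]) = order x (iterate f 2 - [:0, 1:])"
proof -
  have "iterate g 2 - [:0, 1:] \<noteq> 0"
    using iterate_minus_X_nonzero[of g 2] degree_eq assms by simp
  moreover have "pcompose (iterate g 2 - [:0, 1:]) [:\<beta>, \<alpha>:] = smult \<alpha> (iterate f 2 - [:0, 1:])"
  proof (rule complex_poly_eqI)
    fix t
    have "poly g (poly g (\<alpha> * t + \<beta>)) = \<alpha> * poly f (poly f t) + \<beta>" by (simp add: conj)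
    then show "poly (pcompose (iterate g 2 - [:0, 1:]) [:\<beta>, \<alpha>:]) t =
        poly (smult \<alpha> (iterate f 2 - [:0, 1:])) t"
      by (simp add: poly_pcompose iterate_2 algebra_simps)
  qed
  ultimately show ?thesis using order_shift[of "iterate g 2 - [:0, 1:]" x] \<alpha> by (simp add: order_smult)
qed

lemma proots_transfer:
  assumes "p \<noteq> 0" "q \<noteq> 0" "\<And>x. order (\<alpha> * x + \<beta>) q = order x p"
  shows "proots q = image_mset (\<lambda>x. \<alpha> * x + \<beta>) (proots p)"
proof (rule multiset_eqI)
  fix y
  define x where "x = (y - \<beta>) / \<alpha>"
  have y: "y = \<alpha> * x + \<beta>" using \<alpha> by (simp add: x_def)
  have "count (image_mset (\<lambda>x. \<alpha> * x + \<beta>) M) (\<alpha> * x + \<beta>) = count M x" for M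
    using \<alpha> by (induction M) auto
  then show "count (proots q) y = count (image_mset (\<lambda>x. \<alpha> * x + \<beta>) (proots p)) y"
    using assms y by simp
qed

lemma fixed_multipliers_eq:
  assumes "degree f \<ge> 2"
  shows "fixed_multipliers g = fixed_multipliers f"
proof -
  have "f - [:0, 1:] \<noteq> 0" "g - [:0, 1:] \<noteq> 0"
    using iterate_minus_X_nonzero[of g 1] iterate_minus_X_nonzero[of f 1] iterate_1[of g] iterate_1[of f]
      degree_eq assms by simp_all
  then have "proots (g - [:0, 1:]) = image_mset (\<lambda>x. \<alpha> * x + \<beta>) (proots (f - [:0, 1:]))"
    using order_fixed[OF assms] by (intro proots_transfer)
  then show ?thesis
    unfolding fixed_multipliers_def by (simp add: multiset.map_comp comp_def pderiv_eq)
qed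

lemma cycle2_multipliers_subset: "cycle2_multipliers f \<subseteq> cycle2_multipliers g"
proof
  fix l assume "l \<in> cycle2_multipliers f"
  then obtain x where x: "poly f (poly f x) = x" "poly f x \<noteq> x"
    and l: "l = poly (pderiv f) x * poly (pderiv f) (poly f x)" by (auto simp: cycle2_multipliers_def)
  let ?y = "\<alpha> * x + \<beta>"
  have "poly g (poly g ?y) = ?y" "poly g ?y \<noteq> ?y" using x \<alpha> by (simp_all add: conj)
  moreover have "l = poly (pderiv g) ?y * poly (pderiv g) (poly g ?y)" by (simp add: l conj pderiv_eq)
  ultimately show "l \<in> cycle2_multipliers g" unfolding cycle2_multipliers_def by blast
qed

text \<open>The order of a point in the dynatomic polynomial is a difference of two orders, each of
  which the affine map transports; degenerate fixed points are covered as well.\<close>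

lemma multipliers_2_eq:
  assumes "degree f \<ge> 2"
  shows "multipliers g 2 = multipliers f 2"
proof -
  have deg: "degree g \<ge> 2" using assms degree_eq by simp
  have "order (\<alpha> * x + \<beta>) (dynatomic g 2) = order x (dynatomic f 2)" for x
    using order_dynatomic_2(1)[OF deg, of "\<alpha> * x + \<beta>"] order_dynatomic_2(1)[OF assms, of x]
      order_fixed[OF assms, of x] order_fixed_2[OF assms, of x] by linarith
  then have "proots (dynatomic g 2) = image_mset (\<lambda>x. \<alpha> * x + \<beta>) (proots (dynatomic f 2))"
    using order_dynatomic_2(2)[OF deg] order_dynatomic_2(2)[OF assms] by (intro proots_transfer)
  moreover have "poly (pderiv (iterate g 2)) (\<alpha> * x + \<beta>) = poly (pderiv (iterate f 2)) x" for x
    by (simp add: poly_pderiv_iterate_2 conj pderiv_eq)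
  ultimately have "(\<Prod>z\<in>#proots (dynatomic g 2). [:- poly (pderiv (iterate g 2)) z, 1:]) =
      (\<Prod>z\<in>#proots (dynatomic f 2). [:- poly (pderiv (iterate f 2)) z, 1:])"
    by (simp add: multiset.map_comp comp_def)
  then show ?thesis unfolding multipliers_def mult_poly_def by simp
qed

end

lemma conjugate_invariants:
  assumes "conjugate f g" "degree f \<ge> 2"
  shows "degree g = degree f" "fixed_multipliers g = fixed_multipliers f"
    "cycle2_multipliers g = cycle2_multipliers f" "multipliers g 1 = multipliers f 1"
    "multipliers g 2 = multipliers f 2"
proof -
  obtain \<alpha> \<beta> where 1: "conjugation f g \<alpha> \<beta>" using assms(1) by (auto simp: conjugate_def conjugation_def)
  obtain \<gamma> \<delta> where 2: "conjugation g f \<gamma> \<delta>"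
    using conjugate_sym[OF assms(1)] by (auto simp: conjugate_def conjugation_def)
  show d: "degree g = degree f" by (rule conjugation.degree_eq[OF 1])
  show fm: "fixed_multipliers g = fixed_multipliers f" by (rule conjugation.fixed_multipliers_eq[OF 1 assms(2)])
  show "cycle2_multipliers g = cycle2_multipliers f"
    using conjugation.cycle2_multipliers_subset[OF 1] conjugation.cycle2_multipliers_subset[OF 2] by blast
  show "multipliers g 1 = multipliers f 1"
    using multipliers_1[OF assms(2)] multipliers_1[of g] assms(2) d fm by simp
  show "multipliers g 2 = multipliers f 2" by (rule conjugation.multipliers_2_eq[OF 1 assms(2)])
qed


section \<open>Polynomials given by their fixed points\<close>

text \<open>Turns equality of multisets of multipliers into labellings of the two sets of fixed
  points for which multipliers with equal index agree.\<close>

lemma image_mset_eq_lists: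
  assumes "image_mset f A = image_mset g B"
  shows "\<exists>xs ys. mset xs = A \<and> mset ys = B \<and> map f xs = map g ys"
proof -
  obtain xs where xs: "mset xs = A" using ex_mset by blast
  have "\<exists>ys. mset ys = B \<and> map f xs = map g ys" if "mset (map f xs) = image_mset g B"
    using that
  proof (induction xs arbitrary: B)
    case Nil
    then show ?case by (intro exI[of _ "[]"]) simp
  next
    case (Cons x xs)
    then have "f x \<in># image_mset g B" by (metis list.set_intros(1) list.simps(9) set_mset_mset)
    then obtain b where b: "b \<in># B" "g b = f x" by auto
    then obtain B' where B': "B = add_mset b B'" by (metis insert_DiffM)
    then have "mset (map f xs) = image_mset g B'" using Cons.prems b by simp
    then obtain ys where "mset ys = B'" "map f xs = map g ys" using Cons.IH by blast
    then show ?case using b B' by (intro exI[of _ "b # ys"]) simp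
  qed
  then show ?thesis using xs assms by auto
qed

definition from_fixed :: "nat \<Rightarrow> complex \<Rightarrow> (nat \<Rightarrow> complex) \<Rightarrow> complex poly" where
  "from_fixed d a z = [:0, 1:] + smult a (\<Prod>i<d. [:-z i, 1:])"

lemma poly_from_fixed: "poly (from_fixed d a z) t = t + a * (\<Prod>i<d. t - z i)"
  by (simp add: from_fixed_def poly_prod)

lemma degree_from_fixed:
  assumes "d \<ge> 2" "a \<noteq> 0"
  shows "degree (from_fixed d a z) = d" "coeff (from_fixed d a z) d = a"
proof -
  let ?P = "\<Prod>i<d. [:-z i, 1:]"
  have deg: "degree ?P = d" by (simp add: degree_prod_sum_eq)
  have "lead_coeff ?P = 1" by (simp add: lead_coeff_prod)
  then have P: "coeff ?P d = 1" using deg by simp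
  show "degree (from_fixed d a z) = d"
    unfolding from_fixed_def using assms deg by (subst degree_add_eq_right) auto
  show "coeff (from_fixed d a z) d = a"
    unfolding from_fixed_def using assms P by (simp add: coeff_pCons split: nat.splits)
qed

lemma poly_pderiv_prod_linear:
  assumes "finite I" "i \<in> I"
  shows "poly (pderiv (\<Prod>j\<in>I. [:-z j, 1:])) (z i) = (\<Prod>j\<in>I - {i}. z i - (z j :: complex))"
proof -
  have "(\<Prod>j\<in>I. [:-z j, 1:]) = [:-z i, 1:] * (\<Prod>j\<in>I - {i}. [:-z j, 1:])"
    by (rule prod.remove[OF assms])
  then have "pderiv (\<Prod>j\<in>I. [:-z j, 1:]) = [:-z i, 1:] * pderiv (\<Prod>j\<in>I - {i}. [:-z j, 1:])
      + (\<Prod>j\<in>I - {i}. [:-z j, 1:]) * pderiv [:-z i, 1:]" by (simp only: pderiv_mult)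
  then show ?thesis by (simp add: pderiv_pCons poly_prod)
qed

lemma pderiv_from_fixed:
  assumes "i < d"
  shows "poly (pderiv (from_fixed d a z)) (z i) = 1 + a * (\<Prod>j\<in>{..<d} - {i}. z i - z j)"
  using poly_pderiv_prod_linear[of "{..<d}" i z] assms
  by (simp add: from_fixed_def pderiv_add pderiv_smult pderiv_pCons)

lemma proots_from_fixed:
  assumes "a \<noteq> 0"
  shows "proots (from_fixed d a z - [:0, 1:]) = image_mset z (mset_set {..<d})"
proof -
  have "proots (from_fixed d a z - [:0, 1:]) = proots (\<Prod>i\<in>#mset_set {..<d}. [:-z i, 1:])"
    using assms by (simp add: from_fixed_def prod_unfold_prod_mset)
  then show ?thesis by (simp only: proots_prod_linear)
qed

lemma fixed_multipliers_from_fixed: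
  assumes "a \<noteq> 0"
  shows "fixed_multipliers (from_fixed d a z) =
    image_mset (\<lambda>i. 1 + a * (\<Prod>j\<in>{..<d} - {i}. z i - z j)) (mset_set {..<d})"
  unfolding fixed_multipliers_def proots_from_fixed[OF assms] multiset.map_comp
  by (rule image_mset_cong) (simp add: pderiv_from_fixed)

lemma from_fixed_of_list:
  assumes "degree f \<ge> 2" "mset zs = proots (f - [:0, 1:])"
  shows "length zs = degree f" "f = from_fixed (degree f) (lead_coeff f) (\<lambda>i. zs ! i)"
proof -
  have deg: "degree (f - [:0, 1:]) = degree f" using assms(1) by (subst diff_conv_add_uminus, subst degree_add_eq_left) auto
  have "size (mset zs) = degree f" unfolding assms(2) size_proots_complex deg ..
  then show len: "length zs = degree f" by simp
  have lead: "lead_coeff (f - [:0, 1:]) = lead_coeff f"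
    unfolding deg using assms(1) by (simp add: coeff_pCons split: nat.splits)
  have "f - [:0, 1:] = smult (lead_coeff f) (\<Prod>x\<in>#mset zs. [:-x, 1:])"
    using complex_poly_decompose_multiset[of "f - [:0, 1:]"] unfolding lead assms(2) by simp
  also have "(\<Prod>x\<in>#mset zs. [:-x, 1:]) = (\<Prod>x\<leftarrow>zs. [:-x, 1:])"
    by (subst prod_mset_prod_list[symmetric]) simp
  also have "\<dots> = (\<Prod>i<degree f. [:-zs ! i, 1:])"
    using len by (subst prod.list_conv_set_nth) (auto simp: atLeast0LessThan)
  finally show "f = from_fixed (degree f) (lead_coeff f) (\<lambda>i. zs ! i)"
    unfolding from_fixed_def by (simp add: algebra_simps)
qed

lemma fixed_multipliers_eq_labelled:
  assumes "degree f = d" "degree g = d" "d \<ge> 2" "fixed_multipliers f = fixed_multipliers g"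
  shows "\<exists>z w. f = from_fixed d (coeff f d) z \<and> g = from_fixed d (coeff g d) w \<and>
    (\<forall>i<d. coeff f d * (\<Prod>j\<in>{..<d} - {i}. z i - z j) = coeff g d * (\<Prod>j\<in>{..<d} - {i}. w i - w j))"
proof -
  obtain zs ws where l: "mset zs = proots (f - [:0, 1:])" "mset ws = proots (g - [:0, 1:])"
    "map (poly (pderiv f)) zs = map (poly (pderiv g)) ws"
    using image_mset_eq_lists[OF assms(4)[unfolded fixed_multipliers_def]] by blast
  have f: "length zs = d" "f = from_fixed d (coeff f d) (\<lambda>i. zs ! i)"
    using from_fixed_of_list[of f zs] assms l(1) by auto
  have g: "length ws = d" "g = from_fixed d (coeff g d) (\<lambda>i. ws ! i)"
    using from_fixed_of_list[of g ws] assms l(2) by auto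
  have "coeff f d * (\<Prod>j\<in>{..<d} - {i}. zs ! i - zs ! j) = coeff g d * (\<Prod>j\<in>{..<d} - {i}. ws ! i - ws ! j)"
    if i: "i < d" for i
  proof -
    have "poly (pderiv f) (zs ! i) = poly (pderiv g) (ws ! i)"
      using l(3) i f(1) g(1) by (metis nth_map)
    moreover have "poly (pderiv f) (zs ! i) = 1 + coeff f d * (\<Prod>j\<in>{..<d} - {i}. zs ! i - zs ! j)"
      by (subst f(2)) (rule pderiv_from_fixed[OF i])
    moreover have "poly (pderiv g) (ws ! i) = 1 + coeff g d * (\<Prod>j\<in>{..<d} - {i}. ws ! i - ws ! j)"
      by (subst g(2)) (rule pderiv_from_fixed[OF i])
    ultimately show ?thesis by simp
  qed
  then show ?thesis using f(2) g(2) by blast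
qed

lemma conjugate_from_fixed:
  assumes "\<alpha> \<noteq> 0" "b * \<alpha> ^ d = \<alpha> * a" "\<And>i. i < d \<Longrightarrow> w i = \<alpha> * z i + \<beta>"
  shows "conjugate (from_fixed d a z) (from_fixed d b w)"
  unfolding conjugate_def
proof (intro exI conjI allI)
  fix t
  have "(\<Prod>i<d. \<alpha> * t + \<beta> - w i) = (\<Prod>i<d. \<alpha> * (t - z i))"
    by (rule prod.cong) (simp_all add: assms(3) algebra_simps)
  also have "\<dots> = \<alpha> ^ d * (\<Prod>i<d. t - z i)" by (simp add: prod.distrib)
  finally have "b * (\<Prod>i<d. \<alpha> * t + \<beta> - w i) = (b * \<alpha> ^ d) * (\<Prod>i<d. t - z i)" by simp
  then show "poly (from_fixed d b w) (\<alpha> * t + \<beta>) = \<alpha> * poly (from_fixed d a z) t + \<beta>"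
    unfolding poly_from_fixed assms(2) by (simp add: algebra_simps)
qed fact

section \<open>Degrees 2 and 3\<close>

lemma fixed_multipliers_determine_2:
  assumes "degree f = 2" "degree g = 2" "fixed_multipliers f = fixed_multipliers g"
  shows "conjugate f g"
proof -
  define a b where "a = coeff f 2" and "b = coeff g 2"
  obtain z w where f: "f = from_fixed 2 a z" and g: "g = from_fixed 2 b w" and
    h: "\<forall>i<2. a * (\<Prod>j\<in>{..<2} - {i}. z i - z j) = b * (\<Prod>j\<in>{..<2} - {i}. w i - w j)"
    using fixed_multipliers_eq_labelled[of f 2 g] assms unfolding a_def b_def by auto
  have ab: "a \<noteq> 0" "b \<noteq> 0" using assms(1,2) unfolding a_def b_def by (metis leading_coeff_0_iff degree_0 zero_neq_numeral)+
  have S: "{..<2} - {0::nat} = {1}" by auto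
  have e: "a * (z 0 - z 1) = b * (w 0 - w 1)" using h[rule_format, of 0] S by simp
  show ?thesis unfolding f g
  \<comment> \<open>The leading coefficients force \<open>\<alpha> = a / b\<close>, and the
    translation is chosen to send \<open>z 0\<close> to \<open>w 0\<close>; equality of multipliers
    then sends \<open>z 1\<close> to \<open>w 1\<close>.\<close>
  proof (rule conjugate_from_fixed[of "a / b" _ _ _ _ _ "w 0 - a / b * z 0"])
    show "w i = a / b * z i + (w 0 - a / b * z 0)" if "i < 2" for i
    proof -
      have "w 1 = a / b * z 1 + (w 0 - a / b * z 0)" using e ab by (simp add: field_simps)
      then show ?thesis using that by (auto simp: less_2_cases_iff)
    qed
  qed (use ab in \<open>simp_all add: power2_eq_square\<close>)
qed

text \<open>Three distinct fixed points form a triangle whose shape is given by the ratio of two of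
  the equations. Coincidences among fixed points are treated apart in \<open>*\<close>, which by
  symmetry is stated for the first two.\<close>

lemma cubic_match:
  fixes a b z1 z2 z3 w1 w2 w3 :: complex
  assumes ab: "a \<noteq> 0" "b \<noteq> 0"
    and e1: "a * ((z1 - z2) * (z1 - z3)) = b * ((w1 - w2) * (w1 - w3))"
    and e2: "a * ((z2 - z1) * (z2 - z3)) = b * ((w2 - w1) * (w2 - w3))"
    and e3: "a * ((z3 - z1) * (z3 - z2)) = b * ((w3 - w1) * (w3 - w2))"
  shows "\<exists>\<alpha> \<beta>. \<alpha> \<noteq> 0 \<and> b * \<alpha> ^ 2 = a \<and> w1 = \<alpha> * z1 + \<beta> \<and> w2 = \<alpha> * z2 + \<beta> \<and> w3 = \<alpha> * z3 + \<beta>"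
proof -
  have *: "\<exists>\<alpha> \<beta>. \<alpha> \<noteq> 0 \<and> b * \<alpha> ^ 2 = a \<and> w1 = \<alpha> * z1 + \<beta> \<and> w2 = \<alpha> * z2 + \<beta> \<and> w3 = \<alpha> * z3 + \<beta>"
    if e1: "a * ((z1 - z2) * (z1 - z3)) = b * ((w1 - w2) * (w1 - w3))"
      and e2: "a * ((z2 - z1) * (z2 - z3)) = b * ((w2 - w1) * (w2 - w3))"
      and e3: "a * ((z3 - z1) * (z3 - z2)) = b * ((w3 - w1) * (w3 - w2))"
      and z: "z1 = z2" for z1 z2 z3 w1 w2 w3
  proof (cases "z3 = z1")
    case True
    then have "w1 = w2 \<or> w1 = w3" "w3 = w1 \<or> w3 = w2" "w2 = w1 \<or> w2 = w3" using e1 e2 e3 z ab by auto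
    then have w: "w1 = w2" "w1 = w3" by auto
    \<comment> \<open>For a triple fixed point only the leading coefficients restrict
      \<open>\<alpha>\<close>, and either square root serves.\<close>
    have "b * csqrt (a / b) ^ 2 = a" "csqrt (a / b) \<noteq> 0" using ab by simp_all
    then show ?thesis using w z True
      by (intro exI[of _ "csqrt (a / b)"] exI[of _ "w1 - csqrt (a / b) * z1"]) simp
  next
    case False
    have "a * ((z3 - z1) * (z3 - z2)) \<noteq> 0" using False ab z by simp
    then have w3: "w3 \<noteq> w1" "w3 \<noteq> w2" using e3 by auto
    then have w: "w1 = w2" using e1 z ab by auto
    define \<alpha> where "\<alpha> = (w3 - w1) / (z3 - z1)"
    have w31: "w3 - w1 = \<alpha> * (z3 - z1)" using False by (simp add: \<alpha>_def)
    have "\<alpha> \<noteq> 0" using w3 False by (simp add: \<alpha>_def)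
    moreover have "b * \<alpha> ^ 2 = a"
    proof -
      have "a * ((z3 - z1) * (z3 - z1)) = b * \<alpha> ^ 2 * ((z3 - z1) * (z3 - z1))"
        using e3 w z w31 by algebra
      then show ?thesis using False by simp
    qed
    moreover have "w3 = \<alpha> * z3 + (w1 - \<alpha> * z1)" using w31 by algebra
    ultimately show ?thesis using w z by (intro exI[of _ \<alpha>] exI[of _ "w1 - \<alpha> * z1"]) simp
  qed
  consider "z1 = z2" | "z1 = z3" | "z2 = z3" | "z1 \<noteq> z2" "z1 \<noteq> z3" "z2 \<noteq> z3" by blast
  then show ?thesis
  proof cases
    case 1
    then show ?thesis using *[OF e1 e2 e3] by blast
  next
    case 2
    have "\<exists>\<alpha> \<beta>. \<alpha> \<noteq> 0 \<and> b * \<alpha> ^ 2 = a \<and> w1 = \<alpha> * z1 + \<beta> \<and> w3 = \<alpha> * z3 + \<beta> \<and> w2 = \<alpha> * z2 + \<beta>"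
      by (rule *) (use e1 e2 e3 2 in \<open>simp_all add: mult.commute\<close>)
    then show ?thesis by blast
  next
    case 3
    have "\<exists>\<alpha> \<beta>. \<alpha> \<noteq> 0 \<and> b * \<alpha> ^ 2 = a \<and> w2 = \<alpha> * z2 + \<beta> \<and> w3 = \<alpha> * z3 + \<beta> \<and> w1 = \<alpha> * z1 + \<beta>"
      by (rule *) (use e1 e2 e3 3 in \<open>simp_all add: mult.commute\<close>)
    then show ?thesis by blast
  next
    case 4
    have "b * ((w1 - w2) * (w1 - w3)) \<noteq> 0" using e1 4 ab by (metis mult_eq_0_iff right_minus_eq)
    then have w12: "w1 \<noteq> w2" "w1 \<noteq> w3" by auto
    define \<alpha> where "\<alpha> = (w1 - w2) / (z1 - z2)"
    have \<alpha>: "\<alpha> \<noteq> 0" "w1 - w2 = \<alpha> * (z1 - z2)" using w12 4 by (simp_all add: \<alpha>_def)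
    \<comment> \<open>The quotient of \<open>e1\<close> and \<open>e2\<close>, cleared of
      denominators. After cancellation it says that (1 - 3) / (2 - 3) is the same ratio for
      \<open>z\<close> and for \<open>w\<close>: the triangles are similar.\<close>
    have "a * b * ((z1 - z2) * (z1 - z3)) * ((w2 - w1) * (w2 - w3)) =
        a * b * ((z2 - z1) * (z2 - z3)) * ((w1 - w2) * (w1 - w3))"
      using e1 e2 by (metis (no_types, opaque_lifting) mult.assoc mult.commute)
    then have "(a * b * (z1 - z2) * (w1 - w2)) * ((z1 - z3) * (w2 - w3)) =
        (a * b * (z1 - z2) * (w1 - w2)) * ((z2 - z3) * (w1 - w3))" by algebra
    then have "(z1 - z3) * (w2 - w3) = (z2 - z3) * (w1 - w3)"
      using ab 4(1) w12(1) by simp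
    then have "(z1 - z2) * (w2 - w3) = (z2 - z3) * (w1 - w2)" by algebra
    then have "(z1 - z2) * (w2 - w3) = (z1 - z2) * (\<alpha> * (z2 - z3))" unfolding \<alpha>(2) by algebra
    then have w23: "w2 - w3 = \<alpha> * (z2 - z3)" using 4(1) by simp
    have w13: "w1 - w3 = \<alpha> * (z1 - z3)" using \<alpha>(2) w23 by algebra
    have "a * ((z1 - z2) * (z1 - z3)) = b * \<alpha> ^ 2 * ((z1 - z2) * (z1 - z3))"
      using e1 unfolding \<alpha>(2) w13 by algebra
    then have "b * \<alpha> ^ 2 = a" using 4 by simp
    moreover have "w2 = \<alpha> * z2 + (w1 - \<alpha> * z1)" "w3 = \<alpha> * z3 + (w1 - \<alpha> * z1)"
      using \<alpha>(2) w13 by algebra+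
    ultimately show ?thesis using \<alpha>(1) by (intro exI[of _ \<alpha>] exI[of _ "w1 - \<alpha> * z1"]) simp
  qed
qed

lemma fixed_multipliers_determine_3:
  assumes "degree f = 3" "degree g = 3" "fixed_multipliers f = fixed_multipliers g"
  shows "conjugate f g"
proof -
  define a b where "a = coeff f 3" and "b = coeff g 3"
  obtain z w where f: "f = from_fixed 3 a z" and g: "g = from_fixed 3 b w" and
    h: "\<forall>i<3. a * (\<Prod>j\<in>{..<3} - {i}. z i - z j) = b * (\<Prod>j\<in>{..<3} - {i}. w i - w j)"
    using fixed_multipliers_eq_labelled[of f 3 g] assms unfolding a_def b_def by auto
  have ab: "a \<noteq> 0" "b \<noteq> 0" using assms(1,2) unfolding a_def b_def by (metis leading_coeff_0_iff degree_0 zero_neq_numeral)+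
  have S: "{..<3} - {0::nat} = {1, 2}" "{..<3} - {1::nat} = {0, 2}" "{..<3} - {2::nat} = {0, 1}" by auto
  obtain \<alpha> \<beta> where m: "\<alpha> \<noteq> 0" "b * \<alpha> ^ 2 = a" "w 0 = \<alpha> * z 0 + \<beta>" "w 1 = \<alpha> * z 1 + \<beta>" "w 2 = \<alpha> * z 2 + \<beta>"
    using cubic_match[OF ab, of "z 0" "z 1" "z 2" "w 0" "w 1" "w 2"]
      h[rule_format, of 0] h[rule_format, of 1] h[rule_format, of 2] unfolding S by auto
  show ?thesis unfolding f g
  proof (rule conjugate_from_fixed[of \<alpha> _ _ _ _ _ \<beta>])
    show "w i = \<alpha> * z i + \<beta>" if "i < 3" for i
    proof -
      have "i = 0 \<or> i = 1 \<or> i = 2" using that by linarith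
      then show ?thesis using m by auto
    qed
    show "b * \<alpha> ^ 3 = \<alpha> * a" using m(2) by (simp add: power3_eq_cube power2_eq_square)
  qed fact
qed

text \<open>For polynomials that are not degenerate, inclusion of sets follows from equality of the
  multisets of period 2. It is also all that the limit argument uses, since that argument follows
  one 2-cycle of \<open>f\<close> and needs one of \<open>g\<close> with the same
  multiplier.\<close>

definition bad :: "nat \<Rightarrow> complex poly \<Rightarrow> bool" where
  "bad d f \<longleftrightarrow> (\<exists>g. degree g = d \<and> fixed_multipliers f = fixed_multipliers g \<and>
     cycle2_multipliers f \<subseteq> cycle2_multipliers g \<and> \<not> conjugate f g)"

text \<open>At a fixed point of multiplier 1 or -1 the second iterate is tangent to the identity, so
  the point may be a root of the dynatomic polynomial of period 2 without lying on a
  2-cycle.\<close>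

definition degenerate :: "complex poly \<Rightarrow> bool" where
  "degenerate f \<longleftrightarrow> (\<exists>z. poly f z = z \<and> poly (pderiv f) z ^ 2 = 1)"


section \<open>Normal forms and invariants\<close>

text \<open>The coefficient of \<open>t^k\<close> in \<open>f(c + t)\<close>, spelled out with the
  fixed bound \<open>d\<close> so that its membership in the coordinate ring can be read
  off.\<close>

definition taylor_coeff :: "nat \<Rightarrow> complex poly \<Rightarrow> complex \<Rightarrow> nat \<Rightarrow> complex" where
  "taylor_coeff d f c k = (\<Sum>i\<in>{k..d}. coeff f i * of_nat (i choose k) * c ^ (i - k))"

lemma coeff_pcompose_shift:
  assumes "degree f \<le> d"
  shows "coeff (pcompose f [:c, 1:]) k = taylor_coeff d f c k"
proof -
  define Q where "Q = (\<Sum>k\<le>d. monom (taylor_coeff d f c k) k)"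
  have "pcompose f [:c, 1:] = Q"
  proof (rule complex_poly_eqI)
    fix t
    have "poly (pcompose f [:c, 1:]) t = (\<Sum>i\<le>d. coeff f i * (c + t) ^ i)"
      by (subst poly_as_sum_of_monoms'[OF assms, symmetric]) (simp add: poly_pcompose poly_sum poly_monom)
    also have "\<dots> = (\<Sum>i\<le>d. \<Sum>k\<le>i. coeff f i * of_nat (i choose k) * c ^ (i - k) * t ^ k)"
    proof (rule sum.cong[OF refl])
      fix i
      have "(c + t) ^ i = (\<Sum>k\<le>i. of_nat (i choose k) * t ^ k * c ^ (i - k))"
        by (subst add.commute) (rule binomial_ring)
      then show "coeff f i * (c + t) ^ i = (\<Sum>k\<le>i. coeff f i * of_nat (i choose k) * c ^ (i - k) * t ^ k)"
        by (simp add: sum_distrib_left mult_ac)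
    qed
    also have "\<dots> = (\<Sum>k\<le>d. \<Sum>i\<in>{k..d}. coeff f i * of_nat (i choose k) * c ^ (i - k) * t ^ k)"
    proof -
      let ?X = "\<lambda>i k. coeff f i * of_nat (i choose k) * c ^ (i - k) * t ^ k"
      have "(\<Sum>i\<le>d. \<Sum>k\<le>i. ?X i k) = (\<Sum>i\<le>d. \<Sum>k\<in>{k. k \<in> {..d} \<and> k \<le> i}. ?X i k)"
        by (intro sum.cong) auto
      also have "\<dots> = (\<Sum>k\<le>d. \<Sum>i\<in>{i. i \<in> {..d} \<and> k \<le> i}. ?X i k)"
        by (rule sum.swap_restrict) auto
      also have "\<dots> = (\<Sum>k\<le>d. \<Sum>i\<in>{k..d}. ?X i k)"
        by (intro sum.cong) auto
      finally show ?thesis .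
    qed
    also have "\<dots> = poly Q t"
      by (simp add: Q_def poly_sum poly_monom taylor_coeff_def sum_distrib_right)
    finally show "poly (pcompose f [:c, 1:]) t = poly Q t" .
  qed
  moreover have "coeff Q k = (if k \<le> d then taylor_coeff d f c k else 0)"
    by (simp add: Q_def coeff_sum sum.delta)
  moreover have "taylor_coeff d f c k = 0" if "k > d" using that by (simp add: taylor_coeff_def)
  ultimately show ?thesis by auto
qed

text \<open>The barycentre of the zeros of \<open>f\<close>, that is, the point of expansion at
  which the term of degree \<open>d - 1\<close> disappears.\<close>

definition center :: "nat \<Rightarrow> complex poly \<Rightarrow> complex" where
  "center d f = - (coeff f (d - 1) * inverse (of_nat d) * inverse (coeff f d))"

text \<open>These are the coefficients of \<open>f(z + c) - c\<close> with \<open>c\<close> the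
  center, that is, of the conjugate of \<open>f\<close> by the translation that moves the center to
  0.\<close>

definition centered_coeff :: "nat \<Rightarrow> complex poly \<Rightarrow> nat \<Rightarrow> complex" where
  "centered_coeff d f k = taylor_coeff d f (center d f) k - (if k = 0 then center d f else 0)"

text \<open>Conjugation by \<open>z \<mapsto> \<alpha> z\<close> multiplies the \<open>k\<close>-th centered coefficient by \<open>\<alpha>\<^bsup>1 - k\<^esup>\<close>; the
  power of the constant coefficient compensates for this when \<open>k \<ge> 1\<close>.\<close>

definition modulus :: "nat \<Rightarrow> complex poly \<Rightarrow> nat \<Rightarrow> complex" where
  "modulus d f k = centered_coeff d f 0 ^ (k - 1) * centered_coeff d f k"

text \<open>The degrees of the terms left free once the constant term is 1 and the term of degree
  \<open>d - 1\<close> is removed by centering. For \<open>d\<close> = 2 only the degree 2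
  remains.\<close>

definition slice :: "nat \<Rightarrow> nat set" where
  "slice d = {1..d} - {d - 1}"

definition normal_form :: "nat \<Rightarrow> (nat \<Rightarrow> complex) \<Rightarrow> complex poly" where
  "normal_form d x = 1 + (\<Sum>k\<in>slice d. monom (x k) k)"

lemma taylor_coeff_subleading:
  assumes "d \<ge> 2"
  shows "taylor_coeff d f c (d - 1) = coeff f (d - 1) + of_nat d * coeff f d * c"
proof -
  have "{d - 1..d} = {d - 1, d}" using assms by auto
  moreover have "d choose (d - 1) = d" using assms binomial_symmetric[of 1 d] by simp
  ultimately show ?thesis using assms by (simp add: taylor_coeff_def)
qed

lemma centered_coeff_subleading:
  assumes "d \<ge> 2" "degree f = d"
  shows "centered_coeff d f (d - 1) = 0"
proof -
  have "coeff f d \<noteq> 0" using assms by (metis leading_coeff_0_iff degree_0 not_numeral_le_zero)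
  then have "of_nat d * coeff f d * center d f = - coeff f (d - 1)"
    using assms(1) by (simp add: center_def field_simps)
  then show ?thesis using assms(1) unfolding centered_coeff_def taylor_coeff_subleading[OF assms(1)] by simp
qed

lemma center_unique:
  assumes "d \<ge> 2" "degree f = d" "taylor_coeff d f c (d - 1) = 0"
  shows "center d f = c"
proof -
  have "coeff f d \<noteq> 0" using assms by (metis leading_coeff_0_iff degree_0 not_numeral_le_zero)
  moreover have "coeff f (d - 1) = - (of_nat d * coeff f d * c)"
    using assms(3) unfolding taylor_coeff_subleading[OF assms(1)] by (simp add: eq_neg_iff_add_eq_0)
  ultimately show ?thesis using assms(1) by (simp add: center_def field_simps)
qed

lemma modulus_conjugate:
  assumes "d \<ge> 2" "degree f = d" "conjugate f g" "k \<ge> 1"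
  shows "modulus d g k = modulus d f k"
proof -
  obtain \<alpha> \<beta> where \<alpha>: "\<alpha> \<noteq> 0" and h: "\<And>t. poly g (\<alpha> * t + \<beta>) = \<alpha> * poly f t + \<beta>"
    using assms(3) by (auto simp: conjugate_def)
  have dg: "degree g = d" using conjugate_invariants(1)[OF assms(3)] assms by simp
  define c where "c = center d f"
  define c' where "c' = \<alpha> * c + \<beta>"
  have "pcompose g [:c', 1:] = smult \<alpha> (pcompose (pcompose f [:c, 1:]) [:0, 1 / \<alpha>:]) + [:\<beta>:]"
  proof (rule complex_poly_eqI)
    fix s
    have "\<alpha> * (c + s / \<alpha>) + \<beta> = c' + s" using \<alpha> by (simp add: c'_def field_simps)
    then show "poly (pcompose g [:c', 1:]) s =
        poly (smult \<alpha> (pcompose (pcompose f [:c, 1:]) [:0, 1 / \<alpha>:]) + [:\<beta>:]) s"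
      using h[of "c + s / \<alpha>"] by (simp add: poly_pcompose)
  qed
  then have "coeff (pcompose g [:c', 1:]) j =
      \<alpha> * ((1 / \<alpha>) ^ j * coeff (pcompose f [:c, 1:]) j) + coeff [:\<beta>:] j" for j
    by (simp add: coeff_pcompose_linear)
  then have T: "taylor_coeff d g c' j = \<alpha> * ((1 / \<alpha>) ^ j * taylor_coeff d f c j) + (if j = 0 then \<beta> else 0)" for j
    using coeff_pcompose_shift[of g d c' j] coeff_pcompose_shift[of f d c j] dg assms(2)
    by (simp add: coeff_pCons split: nat.splits)
  \<comment> \<open>The center is characterised by the vanishing of this coefficient, a property
    that the affine map carries from \<open>c\<close> to \<open>c'\<close>.\<close>
  have "taylor_coeff d f c (d - 1) = 0"
    using centered_coeff_subleading[OF assms(1,2)] assms(1) by (simp add: centered_coeff_def c_def)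
  then have "taylor_coeff d g c' (d - 1) = 0" using T[of "d - 1"] assms(1) by simp
  then have cg: "center d g = c'" by (rule center_unique[OF assms(1) dg])
  have cc: "centered_coeff d g j = \<alpha> * (1 / \<alpha>) ^ j * centered_coeff d f j" for j
    unfolding centered_coeff_def cg T c_def[symmetric] by (simp add: c'_def algebra_simps)
  obtain m where m: "k = Suc m" using assms(4) by (cases k) auto
  have "(\<alpha> * x) ^ m * (\<alpha> * (1 / \<alpha>) ^ Suc m * y) = x ^ m * y" for x y
    using \<alpha> by (simp add: power_mult_distrib field_simps)
  then show ?thesis unfolding modulus_def cc m by simp
qed

lemma poly_normal_form: "poly (normal_form d x) t = 1 + (\<Sum>k\<in>slice d. x k * t ^ k)"
  by (simp add: normal_form_def poly_sum poly_monom)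

lemma coeff_normal_form:
  "coeff (normal_form d x) k = (if k = 0 then 1 else if k \<in> slice d then x k else 0)"
proof -
  have "finite (slice d)" "0 \<notin> slice d" by (auto simp: slice_def)
  then show ?thesis by (auto simp: normal_form_def coeff_sum sum.delta)
qed

lemma conjugate_normal_form:
  assumes "d \<ge> 2" "degree f = d" "centered_coeff d f 0 \<noteq> 0"
  shows "conjugate f (normal_form d (modulus d f))"
  unfolding conjugate_def
proof (intro exI conjI allI)
  let ?c = "center d f" and ?e = "centered_coeff d f"
  \<comment> \<open>Conjugation by z -> (z - c) / e with \<open>c\<close> the center and
    \<open>e\<close> the constant centered coefficient: it moves the center to 0 and scales the
    constant term to 1.\<close>
  show "1 / ?e 0 \<noteq> 0" using assms(3) by simp
  fix t
  define s where "s = t - ?c"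
  have "degree (pcompose f [:?c, 1:]) \<le> d" using assms(2) by (simp add: degree_pcompose)
  then have "poly (pcompose f [:?c, 1:]) s = (\<Sum>k\<le>d. taylor_coeff d f ?c k * s ^ k)"
    by (subst poly_as_sum_of_monoms'[OF _, symmetric], assumption)
       (simp add: poly_sum poly_monom coeff_pcompose_shift[of f d] assms(2))
  then have "poly f t - ?c = (\<Sum>k\<le>d. taylor_coeff d f ?c k * s ^ k) - ?c"
    by (simp add: poly_pcompose s_def)
  also have "{..d} = insert 0 (insert (d - 1) (slice d))" using assms(1) by (auto simp: slice_def)
  also have "(\<Sum>k\<in>insert 0 (insert (d - 1) (slice d)). taylor_coeff d f ?c k * s ^ k) - ?c =
      ?e 0 + (\<Sum>k\<in>slice d. ?e k * s ^ k)"
  proof -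
    have z: "0 \<notin> insert (d - 1) (slice d)" "d - 1 \<notin> slice d" "finite (slice d)" using assms(1) by (auto simp: slice_def)
    have "taylor_coeff d f ?c (d - 1) = 0"
      using centered_coeff_subleading[OF assms(1,2)] assms(1) by (simp add: centered_coeff_def)
    moreover have "(\<Sum>k\<in>slice d. taylor_coeff d f ?c k * s ^ k) = (\<Sum>k\<in>slice d. ?e k * s ^ k)"
      by (rule sum.cong) (use z in \<open>auto simp: centered_coeff_def\<close>)
    ultimately show ?thesis using z by (simp add: centered_coeff_def)
  qed
  finally have F: "poly f t - ?c = ?e 0 + (\<Sum>k\<in>slice d. ?e k * s ^ k)" .
  have "modulus d f k * (1 / ?e 0 * s) ^ k = 1 / ?e 0 * (?e k * s ^ k)" if "k \<in> slice d" for k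
  proof -
    have "k > 0" using that by (simp add: slice_def)
    then obtain m where m: "k = Suc m" by (cases k) auto
    show ?thesis unfolding modulus_def m using assms(3) by (simp add: field_simps)
  qed
  then have "poly (normal_form d (modulus d f)) (1 / ?e 0 * s) =
      1 + (\<Sum>k\<in>slice d. 1 / ?e 0 * (?e k * s ^ k))"
    unfolding poly_normal_form by simp
  also have "\<dots> = 1 / ?e 0 * (poly f t - ?c)"
    unfolding F sum_distrib_left[symmetric] using assms(3) by (simp add: field_simps)
  finally have "poly (normal_form d (modulus d f)) (1 / ?e 0 * s) = 1 / ?e 0 * (poly f t - ?c)" .
  moreover have "1 / ?e 0 * s = 1 / ?e 0 * t + - ?c / ?e 0"
    "1 / ?e 0 * (poly f t - ?c) = 1 / ?e 0 * poly f t + - ?c / ?e 0"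
    using assms(3) by (simp_all add: s_def field_simps)
  ultimately show "poly (normal_form d (modulus d f)) (1 / ?e 0 * t + - ?c / ?e 0) =
      1 / ?e 0 * poly f t + - ?c / ?e 0" by (simp only:)
qed

lemma taylor_coeff_0: "k \<le> d \<Longrightarrow> taylor_coeff d f 0 k = coeff f k"
proof -
  assume k: "k \<le> d"
  have "taylor_coeff d f 0 k = (\<Sum>i\<in>{k..d}. if i = k then coeff f k else 0)"
    unfolding taylor_coeff_def by (rule sum.cong) auto
  then show ?thesis using k by simp
qed

lemma modulus_normal_form:
  assumes "d \<ge> 2" "k \<in> slice d"
  shows "modulus d (normal_form d x) k = x k"
proof -
  have "coeff (normal_form d x) (d - 1) = 0" using assms(1) by (auto simp: coeff_normal_form slice_def)
  then have c: "center d (normal_form d x) = 0" by (simp add: center_def)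
  have "k \<noteq> 0" "k \<le> d" using assms(2) by (auto simp: slice_def)
  then show ?thesis using assms(2) by (simp add: modulus_def centered_coeff_def c taylor_coeff_0 coeff_normal_form)
qed

lemma degree_normal_form:
  assumes "d \<ge> 2" "x d \<noteq> 0"
  shows "degree (normal_form d x) = d"
proof (rule antisym)
  show "degree (normal_form d x) \<le> d"
    by (rule degree_le) (auto simp: coeff_normal_form slice_def)
  show "d \<le> degree (normal_form d x)"
    by (rule le_degree) (use assms in \<open>auto simp: coeff_normal_form slice_def\<close>)
qed

section \<open>The moduli as elements of the coordinate ring\<close>

lemma coord_ring_sum:
  assumes "\<And>i. i \<in> I \<Longrightarrow> h i \<in> coord_ring d"
  shows "(\<lambda>f. \<Sum>i\<in>I. h i f) \<in> coord_ring d"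
proof -
  have zero: "(\<lambda>f. 0) \<in> coord_ring d" using coord_ring.const[of 0 d] by simp
  show ?thesis
  proof (cases "finite I")
    case True
    then show ?thesis using assms
      by (induction I rule: finite_induct) (simp_all add: zero coord_ring.add)
  qed (simp add: zero)
qed

lemma coord_ring_power: "h \<in> coord_ring d \<Longrightarrow> (\<lambda>f. h f ^ n) \<in> coord_ring d"
proof (induction n)
  case 0
  then show ?case using coord_ring.const[of 1 d] by simp
next
  case (Suc n)
  then show ?case using coord_ring.mult[of h d "\<lambda>f. h f ^ n"] by simp
qed

lemma center_coord_ring:
  assumes "d \<ge> 2"
  shows "center d \<in> coord_ring d"
proof -
  have "(\<lambda>f. of_rat (- inverse (of_nat d)) * (coeff f (d - 1) * inverse (coeff f d))) \<in> coord_ring d"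
    by (rule coord_ring.mult[OF coord_ring.const coord_ring.mult[OF coord_ring.coord coord_ring.inv_lead]]) simp
  moreover have "(\<lambda>f. of_rat (- inverse (of_nat d)) * (coeff f (d - 1) * inverse (coeff f d))) = center d"
    by (simp add: center_def fun_eq_iff of_rat_minus of_rat_inverse mult_ac)
  ultimately show ?thesis by simp
qed

lemma centered_coeff_coord_ring:
  assumes "d \<ge> 2"
  shows "(\<lambda>f. centered_coeff d f k) \<in> coord_ring d"
proof -
  have T: "(\<lambda>f. taylor_coeff d f (center d f) k) \<in> coord_ring d"
    unfolding taylor_coeff_def
  proof (rule coord_ring_sum)
    fix i assume "i \<in> {k..d}"
    then have "(\<lambda>f. coeff f i * of_rat (of_nat (i choose k)) * center d f ^ (i - k)) \<in> coord_ring d"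
      by (intro coord_ring.mult[OF coord_ring.mult[OF coord_ring.coord coord_ring.const]
            coord_ring_power[OF center_coord_ring[OF assms]]]) simp
    then show "(\<lambda>f. coeff f i * of_nat (i choose k) * center d f ^ (i - k)) \<in> coord_ring d" by simp
  qed
  have "(\<lambda>f. of_rat (if k = 0 then - 1 else 0) * center d f) \<in> coord_ring d"
    by (rule coord_ring.mult[OF coord_ring.const center_coord_ring[OF assms]])
  then have "(\<lambda>f. taylor_coeff d f (center d f) k + of_rat (if k = 0 then - 1 else 0) * center d f) \<in> coord_ring d"
    by (rule coord_ring.add[OF T])
  moreover have "taylor_coeff d f (center d f) k + of_rat (if k = 0 then - 1 else 0) * center d f =
      centered_coeff d f k" for f by (simp add: centered_coeff_def)
  ultimately show ?thesis by (simp only:)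
qed

lemma modulus_coord_ring:
  assumes "d \<ge> 2"
  shows "(\<lambda>f. modulus d f k) \<in> coord_ring d"
  unfolding modulus_def
  by (rule coord_ring.mult[OF coord_ring_power[OF centered_coeff_coord_ring[OF assms]]
        centered_coeff_coord_ring[OF assms]])


section \<open>Definability of the exceptional set\<close>

text \<open>\<open>Coef\<close> holds the free parameters of a normal form, \<open>Lead1\<close>,
  \<open>Root1\<close> and \<open>Lead2\<close>, \<open>Root2\<close> the leading coefficients and
  fixed points of \<open>f\<close> and \<open>g\<close>, and \<open>Point\<close> the remaining
  bound variables. With the fixed points named, equality of multisets of multipliers becomes
  equality index by index.\<close>

datatype var = Coef nat | Lead1 | Root1 nat | Lead2 | Root2 nat | Point nat

lemma poly_pderiv_from_fixed:
  "poly (pderiv (from_fixed d a z)) t = 1 + a * (\<Sum>i<d. \<Prod>j\<in>{..<d} - {i}. t - z j)"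
  by (simp add: from_fixed_def pderiv_add pderiv_smult pderiv_pCons pderiv_prod poly_sum poly_prod)

lemma rp_from_fixed:
  assumes "h \<in> rat_poly V" "A \<in> V" "\<And>i. i < d \<Longrightarrow> R i \<in> V"
  shows "(\<lambda>x. poly (from_fixed d (x A) (\<lambda>i. x (R i))) (h x)) \<in> rat_poly V"
    "(\<lambda>x. poly (pderiv (from_fixed d (x A) (\<lambda>i. x (R i)))) (h x)) \<in> rat_poly V"
  unfolding poly_from_fixed poly_pderiv_from_fixed
   apply (rule rp_add[OF assms(1) rp_mult[OF rp_var[OF assms(2)] rp_prod[OF rp_diff[OF assms(1) rp_var[OF assms(3)]]]]], simp)
  apply (rule rp_add[OF rp_1 rp_mult[OF rp_var[OF assms(2)] rp_sum[OF rp_prod[OF rp_diff[OF assms(1) rp_var[OF assms(3)]]]]]], simp)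
  done

lemma pderiv_sum_family: "pderiv (\<Sum>i\<in>I. f i) = (\<Sum>i\<in>I. pderiv (f i))"
  by (induction I rule: infinite_finite_induct) (simp_all add: pderiv_add)

definition poly1 :: "nat \<Rightarrow> (var \<Rightarrow> complex) \<Rightarrow> complex poly" where
  "poly1 d x = from_fixed d (x Lead1) (\<lambda>i. x (Root1 i))"

definition poly2 :: "nat \<Rightarrow> (var \<Rightarrow> complex) \<Rightarrow> complex poly" where
  "poly2 d x = from_fixed d (x Lead2) (\<lambda>i. x (Root2 i))"

definition root_vars :: "nat \<Rightarrow> var set" where
  "root_vars d = {Lead1, Lead2} \<union> Root1 ` {..<d} \<union> Root2 ` {..<d}"

lemma rp_poly12:
  assumes "h \<in> rat_poly V" "root_vars d \<subseteq> V"
  shows "(\<lambda>x. poly (poly1 d x) (h x)) \<in> rat_poly V" "(\<lambda>x. poly (pderiv (poly1 d x)) (h x)) \<in> rat_poly V"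
    "(\<lambda>x. poly (poly2 d x) (h x)) \<in> rat_poly V" "(\<lambda>x. poly (pderiv (poly2 d x)) (h x)) \<in> rat_poly V"
  unfolding poly1_def poly2_def
  by (rule rp_from_fixed[OF assms(1)]; use assms(2) in \<open>auto simp: root_vars_def\<close>)+

lemma poly12_upd [simp]:
  "poly1 d (x(Point i := t)) = poly1 d x" "poly2 d (x(Point i := t)) = poly2 d x"
  by (simp_all add: poly1_def poly2_def)

lemma definable_cycle2_subset:
  assumes "root_vars d \<subseteq> V"
  shows "definable V (\<lambda>x. cycle2_multipliers (poly1 d x) \<subseteq> cycle2_multipliers (poly2 d x))"
proof -
  define M1 where "M1 x s = poly (pderiv (poly1 d x)) s * poly (pderiv (poly1 d x)) (poly (poly1 d x) s)" for x s
  define M2 where "M2 x s = poly (pderiv (poly2 d x)) s * poly (pderiv (poly2 d x)) (poly (poly2 d x) s)" for x s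
  let ?s = "\<lambda>x. x (Point 0)" and ?t = "\<lambda>x. x (Point 1)"
  let ?V1 = "insert (Point 0) V" and ?V2 = "insert (Point 1) (insert (Point 0) V)"
  have s1: "?s \<in> rat_poly ?V1" and s: "?s \<in> rat_poly ?V2" and t: "?t \<in> rat_poly ?V2"
    by (auto intro: rp_var)
  have V1: "root_vars d \<subseteq> ?V1" and V2: "root_vars d \<subseteq> ?V2" using assms by auto
  note f1 = rp_poly12(1,2)[OF _ V1] and f2 = rp_poly12(1,2)[OF _ V2] and g2 = rp_poly12(3,4)[OF _ V2]
  have "definable ?V2 (\<lambda>x. poly (poly2 d x) (poly (poly2 d x) (?t x)) = ?t x \<and> poly (poly2 d x) (?t x) \<noteq> ?t x
      \<and> M1 x (?s x) = M2 x (?t x))"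
    unfolding M1_def M2_def
    by (rule df_and[OF df_eq[OF g2(1)[OF g2(1)[OF t]] t] df_and[OF df_not[OF df_eq[OF g2(1)[OF t] t]]
        df_eq[OF rp_mult[OF f2(2)[OF s] f2(2)[OF f2(1)[OF s]]] rp_mult[OF g2(2)[OF t] g2(2)[OF g2(1)[OF t]]]]]])
  from definable_ex[OF this]
  have "definable ?V1 (\<lambda>x. \<exists>t. poly (poly2 d x) (poly (poly2 d x) t) = t \<and> poly (poly2 d x) t \<noteq> t
      \<and> M1 x (?s x) = M2 x t)"
    by (simp add: M1_def M2_def)
  with df_and[OF df_eq[OF f1(1)[OF f1(1)[OF s1]] s1] df_not[OF df_eq[OF f1(1)[OF s1] s1]]]
  have "definable ?V1 (\<lambda>x. (poly (poly1 d x) (poly (poly1 d x) (?s x)) = ?s x \<and> poly (poly1 d x) (?s x) \<noteq> ?s x) \<longrightarrow>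
      (\<exists>t. poly (poly2 d x) (poly (poly2 d x) t) = t \<and> poly (poly2 d x) t \<noteq> t \<and> M1 x (?s x) = M2 x t))"
    by (rule df_imp)
  from definable_all[OF this]
  have "definable V (\<lambda>x. \<forall>s. (poly (poly1 d x) (poly (poly1 d x) s) = s \<and> poly (poly1 d x) s \<noteq> s) \<longrightarrow>
      (\<exists>t. poly (poly2 d x) (poly (poly2 d x) t) = t \<and> poly (poly2 d x) t \<noteq> t \<and> M1 x s = M2 x t))"
    by (simp add: M1_def M2_def)
  moreover have "cycle2_multipliers (poly1 d x) \<subseteq> cycle2_multipliers (poly2 d x) \<longleftrightarrow>
     (\<forall>s. (poly (poly1 d x) (poly (poly1 d x) s) = s \<and> poly (poly1 d x) s \<noteq> s) \<longrightarrow>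
      (\<exists>t. poly (poly2 d x) (poly (poly2 d x) t) = t \<and> poly (poly2 d x) t \<noteq> t \<and> M1 x s = M2 x t))" for x
    unfolding cycle2_multipliers_def M1_def M2_def by blast
  ultimately show ?thesis by (simp only:)
qed

lemma definable_conjugate:
  assumes "root_vars d \<subseteq> V"
  shows "definable V (\<lambda>x. conjugate (poly1 d x) (poly2 d x))"
proof -
  let ?V1 = "insert (Point 0) V" and ?V2 = "insert (Point 1) (insert (Point 0) V)"
    and ?V3 = "insert (Point 2) (insert (Point 1) (insert (Point 0) V))"
  have a: "(\<lambda>x. x (Point 0)) \<in> rat_poly ?V3" and b: "(\<lambda>x. x (Point 1)) \<in> rat_poly ?V3"
    and t: "(\<lambda>x. x (Point 2)) \<in> rat_poly ?V3" and a2: "(\<lambda>x. x (Point 0)) \<in> rat_poly ?V2"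
    by (auto intro: rp_var)
  have V3: "root_vars d \<subseteq> ?V3" using assms by auto
  have "definable ?V3 (\<lambda>x. poly (poly2 d x) (x (Point 0) * x (Point 2) + x (Point 1)) =
      x (Point 0) * poly (poly1 d x) (x (Point 2)) + x (Point 1))"
    by (rule df_eq[OF rp_poly12(3)[OF rp_add[OF rp_mult[OF a t] b] V3]
        rp_add[OF rp_mult[OF a rp_poly12(1)[OF t V3]] b]])
  from definable_all[OF this]
  have "definable ?V2 (\<lambda>x. \<forall>t. poly (poly2 d x) (x (Point 0) * t + x (Point 1)) =
      x (Point 0) * poly (poly1 d x) t + x (Point 1))" by simp
  with df_not[OF df_zero[OF a2]]
  have "definable ?V2 (\<lambda>x. x (Point 0) \<noteq> 0 \<and> (\<forall>t. poly (poly2 d x) (x (Point 0) * t + x (Point 1)) =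
      x (Point 0) * poly (poly1 d x) t + x (Point 1)))" by (rule df_and)
  from definable_ex[OF this]
  have "definable ?V1 (\<lambda>x. \<exists>b. x (Point 0) \<noteq> 0 \<and> (\<forall>t. poly (poly2 d x) (x (Point 0) * t + b) =
      x (Point 0) * poly (poly1 d x) t + b))" by simp
  from definable_ex[OF this]
  show ?thesis unfolding conjugate_def by simp
qed

text \<open>\<open>link\<close> says that the named fixed points are those of the normal form, and
  \<open>same\<close> matches multipliers by index; the existential quantifier over labellings
  absorbs the permutation hidden in the equality of multisets. The condition at
  \<open>Coef d\<close> keeps the degree equal to \<open>d\<close>.\<close>

lemma definable_bad:
  assumes d: "d \<ge> 2"
  shows "\<exists>\<phi>. definable (Coef ` slice d) \<phi> \<and>
    (\<forall>x. x (Coef d) \<noteq> 0 \<longrightarrow> (\<phi> x \<longleftrightarrow> bad d (normal_form d (\<lambda>k. x (Coef k))) \<or>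
      degenerate (normal_form d (\<lambda>k. x (Coef k)))))"
proof -
  let ?C = "Coef ` slice d" and ?W = "root_vars d"
  let ?V = "?W \<union> ?C"
  define N where "N x = normal_form d (\<lambda>k. x (Coef k))" for x :: "var \<Rightarrow> complex"
  have N_upd: "N (x(Point i := t)) = N x" for x i t by (simp add: N_def)
  have N_ov: "N (override_on x y ?W) = N x" for x y
    by (simp add: N_def normal_form_def override_on_def root_vars_def image_iff)
  have W: "?W \<subseteq> ?V" "finite ?W" by (auto simp: root_vars_def)
  have rpN: "(\<lambda>x. poly (N x) (h x)) \<in> rat_poly V" "(\<lambda>x. poly (pderiv (N x)) (h x)) \<in> rat_poly V"
    if h: "h \<in> rat_poly V" and V: "?C \<subseteq> V" for h V
  proof -
    have v: "Coef k \<in> V" if "k \<in> slice d" for k using that V by blast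
    show "(\<lambda>x. poly (N x) (h x)) \<in> rat_poly V"
      unfolding N_def poly_normal_form
      by (rule rp_add[OF rp_1 rp_sum[OF rp_mult[OF rp_var[OF v] rp_power[OF h]]]])
    have "poly (pderiv (N x)) t = (\<Sum>k\<in>slice d. of_nat k * x (Coef k) * t ^ (k - 1))" for x t
      by (simp add: N_def normal_form_def pderiv_add pderiv_sum_family pderiv_monom poly_sum poly_monom)
    moreover have rpd: "(\<lambda>x. \<Sum>k\<in>slice d. of_nat k * x (Coef k) * h x ^ (k - 1)) \<in> rat_poly V"
      by (rule rp_sum[OF rp_mult[OF rp_mult[OF rp_of_nat rp_var[OF v]] rp_power[OF h]]])
    ultimately show "(\<lambda>x. poly (pderiv (N x)) (h x)) \<in> rat_poly V"
      by (simp only:)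
  qed
  define link where "link x \<longleftrightarrow> N x = poly1 d x" for x
  define same where "same x \<longleftrightarrow> (\<forall>i\<in>{..<d}. x Lead1 * (\<Prod>j\<in>{..<d} - {i}. x (Root1 i) - x (Root1 j)) =
      x Lead2 * (\<Prod>j\<in>{..<d} - {i}. x (Root2 i) - x (Root2 j)))" for x :: "var \<Rightarrow> complex"
  define \<psi> where "\<psi> x \<longleftrightarrow> (x Lead1 \<noteq> 0 \<and> x Lead2 \<noteq> 0) \<and> link x \<and> same x \<and>
      cycle2_multipliers (poly1 d x) \<subseteq> cycle2_multipliers (poly2 d x) \<and> \<not> conjugate (poly1 d x) (poly2 d x)" for x
  have "definable ?V link"
  proof -
    have "definable (insert (Point 0) ?V) (\<lambda>x. poly (N x) (x (Point 0)) = poly (poly1 d x) (x (Point 0)))"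
      by (rule df_eq[OF rpN(1)[OF rp_var] rp_poly12(1)[OF rp_var]]) auto
    from definable_all[OF this]
    have "definable ?V (\<lambda>x. \<forall>t. poly (N x) t = poly (poly1 d x) t)" by (simp add: N_upd)
    moreover have "(\<forall>t. poly (N x) t = poly (poly1 d x) t) \<longleftrightarrow> link x" for x
      unfolding link_def by (metis complex_poly_eqI)
    ultimately show ?thesis by simp
  qed
  moreover have "definable ?V same"
  proof -
    have A: "(\<lambda>x. x Lead1 * (\<Prod>j\<in>{..<d} - {i}. x (Root1 i) - x (Root1 j))) \<in> rat_poly ?V"
      "(\<lambda>x. x Lead2 * (\<Prod>j\<in>{..<d} - {i}. x (Root2 i) - x (Root2 j))) \<in> rat_poly ?V" if "i \<in> {..<d}" for i
      using that by (auto intro!: rp_mult rp_prod rp_diff rp_var simp: root_vars_def)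
    show ?thesis unfolding same_def by (rule df_ball_fin[OF finite_lessThan df_eq[OF A]])
  qed
  moreover have "definable ?V (\<lambda>x. x Lead1 \<noteq> 0 \<and> x Lead2 \<noteq> 0)"
    by (rule df_and[OF df_not[OF df_zero[OF rp_var]] df_not[OF df_zero[OF rp_var]]]) (auto simp: root_vars_def)
  ultimately have "definable ?V \<psi>"
    unfolding \<psi>_def by (intro df_and[OF _ df_and[OF _ df_and[OF _ df_and[OF definable_cycle2_subset[OF W(1)]
      df_not[OF definable_conjugate[OF W(1)]]]]]])
  then have D1: "definable ?C (\<lambda>x. \<exists>y. \<psi> (override_on x y ?W))" by (rule definable_ex_set[OF W(2)])
  have "definable (insert (Point 0) ?C) (\<lambda>x. poly (N x) (x (Point 0)) = x (Point 0) \<and>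
      poly (pderiv (N x)) (x (Point 0)) ^ 2 = 1)"
    by (rule df_and[OF df_eq[OF rpN(1)[OF rp_var] rp_var] df_eq[OF rp_power[OF rpN(2)[OF rp_var]] rp_1]]) auto
  from definable_ex[OF this] have D2: "definable ?C (\<lambda>x. degenerate (N x))"
    by (simp add: N_upd degenerate_def)
  have "(\<exists>y. \<psi> (override_on x y ?W)) \<longleftrightarrow> bad d (N x)" if x: "x (Coef d) \<noteq> 0" for x
  proof
    assume "\<exists>y. \<psi> (override_on x y ?W)"
    then obtain y where y: "\<psi> (override_on x y ?W)" by blast
    let ?y = "override_on x y ?W"
    have eq: "N x = poly1 d ?y" using y N_ov[of x y] by (simp add: \<psi>_def link_def)
    have nz: "?y Lead1 \<noteq> 0" "?y Lead2 \<noteq> 0" using y by (simp_all add: \<psi>_def)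
    have "fixed_multipliers (poly1 d ?y) = fixed_multipliers (poly2 d ?y)"
      unfolding poly1_def poly2_def fixed_multipliers_from_fixed[OF nz(1)] fixed_multipliers_from_fixed[OF nz(2)]
      by (rule image_mset_cong) (use y in \<open>simp add: \<psi>_def same_def\<close>)
    moreover have "degree (poly2 d ?y) = d" unfolding poly2_def by (rule degree_from_fixed(1)[OF d nz(2)])
    ultimately show "bad d (N x)" unfolding bad_def eq using y by (auto simp: \<psi>_def)
  next
    assume "bad d (N x)"
    then obtain g where g: "degree g = d" "fixed_multipliers (N x) = fixed_multipliers g"
      "cycle2_multipliers (N x) \<subseteq> cycle2_multipliers g" "\<not> conjugate (N x) g" by (auto simp: bad_def)
    have dN: "degree (N x) = d" unfolding N_def by (rule degree_normal_form[OF d]) (rule x)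
    obtain z w where zw: "N x = from_fixed d (coeff (N x) d) z" "g = from_fixed d (coeff g d) w"
      "\<forall>i<d. coeff (N x) d * (\<Prod>j\<in>{..<d} - {i}. z i - z j) = coeff g d * (\<Prod>j\<in>{..<d} - {i}. w i - w j)"
      using fixed_multipliers_eq_labelled[OF dN g(1) d g(2)] by blast
    have nz: "coeff (N x) d \<noteq> 0" "coeff g d \<noteq> 0"
      using dN g(1) d by (metis leading_coeff_0_iff degree_0 not_numeral_le_zero)+
    define y where "y v = (case v of Lead1 \<Rightarrow> coeff (N x) d | Lead2 \<Rightarrow> coeff g d | Root1 i \<Rightarrow> z i | Root2 i \<Rightarrow> w i | _ \<Rightarrow> 0)" for v
    let ?y = "override_on x y ?W"
    have lead: "?y Lead1 = coeff (N x) d" "?y Lead2 = coeff g d"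
      by (simp_all add: override_on_def root_vars_def y_def)
    have root: "?y (Root1 i) = z i" "?y (Root2 i) = w i" if "i < d" for i
      using that by (simp_all add: override_on_def root_vars_def y_def)
    have p1: "poly1 d ?y = N x" by (subst zw(1)) (simp add: poly1_def from_fixed_def lead root)
    have p2: "poly2 d ?y = g" by (subst zw(2)) (simp add: poly2_def from_fixed_def lead root)
    have "same ?y" unfolding same_def lead
    proof
      fix i assume i: "i \<in> {..<d}"
      have "(\<Prod>j\<in>{..<d} - {i}. ?y (Root1 i) - ?y (Root1 j)) = (\<Prod>j\<in>{..<d} - {i}. z i - z j)"
        "(\<Prod>j\<in>{..<d} - {i}. ?y (Root2 i) - ?y (Root2 j)) = (\<Prod>j\<in>{..<d} - {i}. w i - w j)"
        using i by (auto intro!: prod.cong simp: root)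
      then show "coeff (N x) d * (\<Prod>j\<in>{..<d} - {i}. ?y (Root1 i) - ?y (Root1 j)) =
          coeff g d * (\<Prod>j\<in>{..<d} - {i}. ?y (Root2 i) - ?y (Root2 j))" using zw(3) i by simp
    qed
    then have "\<psi> ?y" using g nz lead by (simp add: \<psi>_def p1 p2 link_def N_ov)
    then show "\<exists>y. \<psi> (override_on x y ?W)" by blast
  qed
  then show ?thesis
    by (intro exI[of _ "\<lambda>x. (\<exists>y. \<psi> (override_on x y ?W)) \<or> degenerate (N x)"] conjI df_or[OF D1 D2])
       (simp add: N_def)
qed


section \<open>Fixed points and multipliers near a power map\<close>

definition lagrange_basis :: "'i set \<Rightarrow> ('i \<Rightarrow> complex) \<Rightarrow> 'i \<Rightarrow> complex poly" where
  "lagrange_basis I w i = (\<Prod>j\<in>I - {i}. smult (1 / (w i - w j)) [:- w j, 1:])"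

lemma poly_lagrange_basis:
  "poly (lagrange_basis I w i) t = (\<Prod>j\<in>I - {i}. (t - w j) / (w i - w j))"
  by (simp add: lagrange_basis_def poly_prod diff_divide_distrib)

lemma degree_lagrange_basis:
  assumes "finite I" "i \<in> I" "inj_on w I"
  shows "degree (lagrange_basis I w i) = card I - 1"
    "coeff (lagrange_basis I w i) (card I - 1) = 1 / (\<Prod>j\<in>I - {i}. w i - w j)"
proof -
  have ne: "w i - w j \<noteq> 0" if "j \<in> I - {i}" for j using assms that by (auto dest: inj_onD)
  have "degree (smult (1 / (w i - w j)) [:- w j, 1:]) = 1" if "j \<in> I - {i}" for j using ne[OF that] by simp
  moreover have "smult (1 / (w i - w j)) [:- w j, 1:] \<noteq> 0" if "j \<in> I - {i}" for j using ne[OF that] by simp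
  ultimately show deg: "degree (lagrange_basis I w i) = card I - 1"
    unfolding lagrange_basis_def using assms by (subst degree_prod_sum_eq) auto
  have "lead_coeff (lagrange_basis I w i) = (\<Prod>j\<in>I - {i}. 1 / (w i - w j))"
    unfolding lagrange_basis_def lead_coeff_prod by (rule prod.cong) (use ne in auto)
  then show "coeff (lagrange_basis I w i) (card I - 1) = 1 / (\<Prod>j\<in>I - {i}. w i - w j)"
    unfolding deg by (simp add: prod_dividef)
qed

lemma lagrange_interpolation:
  assumes I: "finite I" "inj_on w I" and p: "degree p < card I"
  shows "p = (\<Sum>i\<in>I. smult (poly p (w i)) (lagrange_basis I w i))"
proof (rule poly_eqI_degree[of "w ` I"])
  have c: "card (w ` I) = card I" by (rule card_image[OF I(2)])
  show "degree p < card (w ` I)" using p c by simp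
  have "degree (\<Sum>i\<in>I. smult (poly p (w i)) (lagrange_basis I w i)) \<le> card I - 1"
    by (intro degree_sum_le I(1) order.trans[OF degree_smult_le])
       (simp add: degree_lagrange_basis(1)[OF I(1) _ I(2)])
  then show "degree (\<Sum>i\<in>I. smult (poly p (w i)) (lagrange_basis I w i)) < card (w ` I)"
    using c p by linarith
  fix x assume "x \<in> w ` I"
  then obtain k where k: "k \<in> I" "x = w k" by blast
  have "poly (lagrange_basis I w i) (w k) = (if i = k then 1 else 0)" if i: "i \<in> I" for i
  proof (cases "i = k")
    case True
    have "(w k - w j) / (w k - w j) = 1" if "j \<in> I - {k}" for j
      using I(2) k that by (auto dest: inj_onD)
    then show ?thesis using True by (simp add: poly_lagrange_basis)
  next
    case False
    then have "\<exists>j\<in>I - {i}. (w k - w j) / (w i - w j) = 0" using k by (intro bexI[of _ k]) auto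
    then show ?thesis using False I(1) by (simp add: poly_lagrange_basis prod_zero_iff)
  qed
  then have "(\<Sum>i\<in>I. poly p (w i) * poly (lagrange_basis I w i) (w k)) = (\<Sum>i\<in>I. if i = k then poly p (w i) else 0)"
    by (intro sum.cong) auto
  then show "poly p x = poly (\<Sum>i\<in>I. smult (poly p (w i)) (lagrange_basis I w i)) x"
    using k I(1) by (simp add: poly_sum)
qed

text \<open>Compare the coefficients of top degree in the Lagrange interpolation formula;
  equivalently, the sum of the residues of \<open>p / \<Prod>(z - w i)\<close>.\<close>

lemma divided_difference:
  fixes w :: "'i \<Rightarrow> complex"
  assumes I: "finite I" "inj_on w I" and p: "degree p < card I"
  shows "(\<Sum>i\<in>I. poly p (w i) / (\<Prod>j\<in>I - {i}. w i - w j)) = coeff p (card I - 1)"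
proof -
  have "coeff p (card I - 1) = (\<Sum>i\<in>I. poly p (w i) * coeff (lagrange_basis I w i) (card I - 1))"
    by (subst lagrange_interpolation[OF assms]) (simp add: coeff_sum)
  also have "\<dots> = (\<Sum>i\<in>I. poly p (w i) / (\<Prod>j\<in>I - {i}. w i - w j))"
    by (rule sum.cong[OF refl], subst degree_lagrange_basis(2)[OF I(1) _ I(2)]) simp_all
  finally show ?thesis ..
qed

text \<open>The nodes may coincide, so only sums of weights over equal nodes can be shown to vanish.
  The relations extend to polynomials of degree below \<open>card I\<close>, and they are tested on
  the one with roots at all node values other than \<open>v\<close>.\<close>

lemma vandermonde_kernel:
  fixes u :: "'i \<Rightarrow> complex"
  assumes I: "finite I" and h: "\<And>k. k < card I \<Longrightarrow> (\<Sum>i\<in>I. M i * u i ^ k) = 0"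
  shows "(\<Sum>i\<in>{i \<in> I. u i = v}. M i) = 0"
proof (cases "v \<in> u ` I")
  case True
  have lin: "(\<Sum>i\<in>I. M i * poly p (u i)) = 0" if "degree p < card I" for p
  proof -
    have "(\<Sum>i\<in>I. M i * poly p (u i)) = (\<Sum>i\<in>I. \<Sum>k\<le>degree p. coeff p k * (M i * u i ^ k))"
      by (simp add: poly_altdef sum_distrib_left mult_ac)
    also have "\<dots> = (\<Sum>k\<le>degree p. \<Sum>i\<in>I. coeff p k * (M i * u i ^ k))" by (rule sum.swap)
    also have "\<dots> = (\<Sum>k\<le>degree p. coeff p k * (\<Sum>i\<in>I. M i * u i ^ k))" by (simp add: sum_distrib_left)
    also have "\<dots> = 0" using h that by (intro sum.neutral) auto
    finally show ?thesis .
  qed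
  define p where "p = (\<Prod>x\<in>u ` I - {v}. [:- x, 1:])"
  have "degree p = card (u ` I - {v})" unfolding p_def by (subst degree_prod_sum_eq) auto
  also have "\<dots> < card (u ` I)" using True I by (intro psubset_card_mono) auto
  also have "\<dots> \<le> card I" by (rule card_image_le[OF I])
  finally have "(\<Sum>i\<in>I. M i * poly p (u i)) = 0" by (rule lin)
  moreover have "poly p (u i) = (if u i = v then poly p v else 0)" if "i \<in> I" for i
    unfolding p_def poly_prod using that I by (auto simp: prod_zero_iff)
  ultimately have "(\<Sum>i\<in>I. if u i = v then M i * poly p v else 0) = 0"
    by (simp add: if_distrib[of "\<lambda>x. M _ * x"] cong: sum.cong if_cong)
  then have "(\<Sum>i\<in>{i \<in> I. u i = v}. M i * poly p v) = 0"
    using sum.inter_filter[OF I, of "\<lambda>i. M i * poly p v" "\<lambda>i. u i = v"] by simp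
  then have "(\<Sum>i\<in>{i \<in> I. u i = v}. M i) * poly p v = 0" by (simp add: sum_distrib_right)
  moreover have "poly p v \<noteq> 0" unfolding p_def poly_prod using I by (auto simp: prod_zero_iff)
  ultimately show ?thesis by simp
next
  case False
  then have "{i \<in> I. u i = v} = {}" by blast
  then show ?thesis by (simp only: sum.empty)
qed

section \<open>Limits of fixed points with convergent multipliers\<close>

lemma bounded_complex_convergent_subseq:
  assumes "\<And>n. cmod (s n) \<le> B"
  shows "\<exists>r l. strict_mono r \<and> (\<lambda>n. s (r n :: nat)) \<longlonglongrightarrow> l"
  using Bolzano_Weierstrass_complex_disc[of s B] assms by (auto simp: LIMSEQ_iff)

lemma bounded_family_convergent_subseq:
  fixes a :: "nat \<Rightarrow> 'i \<Rightarrow> complex"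
  assumes "finite I" "\<And>n i. i \<in> I \<Longrightarrow> cmod (a n i) \<le> B"
  shows "\<exists>r l. strict_mono r \<and> (\<forall>i\<in>I. (\<lambda>n. a (r n) i) \<longlonglongrightarrow> l i)"
  using assms
proof (induction I rule: finite_induct)
  case empty
  show ?case by (rule exI[of _ id]) (simp add: strict_mono_def)
next
  case (insert i I)
  then obtain r l where r: "strict_mono r" "\<forall>i\<in>I. (\<lambda>n. a (r n) i) \<longlonglongrightarrow> l i" by auto
  obtain q c where q: "strict_mono q" "(\<lambda>n. a (r (q n)) i) \<longlonglongrightarrow> c"
    using bounded_complex_convergent_subseq[of "\<lambda>n. a (r n) i" B] insert.prems by auto
  have "(\<lambda>n. a (r (q n)) j) \<longlonglongrightarrow> l j" if "j \<in> I" for j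
    using LIMSEQ_subseq_LIMSEQ[OF r(2)[rule_format, OF that] q(1)] by (simp add: comp_def)
  then show ?case using q r(1) insert.hyps
    by (intro exI[of _ "r \<circ> q"] exI[of _ "l(i := c)"]) (auto simp: strict_mono_def)
qed

lemma LIMSEQ_eventually_eq_unique:
  fixes a b :: complex
  assumes "\<forall>\<^sub>F n in sequentially. X n = Y n" "X \<longlonglongrightarrow> a" "Y \<longlonglongrightarrow> b"
  shows "a = b"
proof -
  have "X \<longlonglongrightarrow> b" using tendsto_cong[OF assms(1)] assms(3) by simp
  then show ?thesis using assms(2) LIMSEQ_unique by blast
qed

text \<open>The multiplier at the fixed point \<open>w i\<close> of the polynomial \<open>z + z \<Prod>\<^sub>j (z - w j)\<close>.\<close>

definition nonzero_multiplier :: "nat \<Rightarrow> (nat \<Rightarrow> complex) \<Rightarrow> nat \<Rightarrow> complex" where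
  "nonzero_multiplier m w i = 1 + w i * (\<Prod>j\<in>{..<m} - {i}. w i - w j)"

lemma nonzero_multiplier_distinct:
  assumes "\<forall>i<m. nonzero_multiplier m w i \<noteq> 1"
  shows "inj_on w {..<m}" "\<And>i. i < m \<Longrightarrow> w i \<noteq> 0"
proof -
  show "inj_on w {..<m}"
  proof (rule inj_onI, rule ccontr)
    fix i j assume ij: "i \<in> {..<m}" "j \<in> {..<m}" "w i = w j" "i \<noteq> j"
    then have "(\<Prod>j\<in>{..<m} - {i}. w i - w j) = 0" by (intro prod_zero) auto
    then show False using assms ij by (simp add: nonzero_multiplier_def)
  qed
  show "w i \<noteq> 0" if "i < m" for i using assms that by (auto simp: nonzero_multiplier_def)
qed

text \<open>Since the multiplier minus 1 is \<open>w i\<close> times the product of differences, the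
  sum is minus the divided difference of \<open>z^(k - 1)\<close>. For \<open>k\<close> >= 1 the
  fixed point 0 would contribute nothing, which is why the sum may run over the nonzero
  ones.\<close>

lemma multiplier_moments:
  assumes ne: "\<And>i. i < m \<Longrightarrow> nonzero_multiplier m w i \<noteq> 1" and k: "1 \<le> k" "k \<le> m"
  shows "(\<Sum>i<m. w i ^ k / (1 - nonzero_multiplier m w i)) = (if k = m then -1 else 0)"
proof -
  have d: "inj_on w {..<m}" "\<And>i. i < m \<Longrightarrow> w i \<noteq> 0"
    using nonzero_multiplier_distinct[of m w] ne by blast+
  have "w i ^ k / (1 - nonzero_multiplier m w i) =
      - (poly (monom 1 (k - 1)) (w i) / (\<Prod>j\<in>{..<m} - {i}. w i - w j))" if "i < m" for i
  proof -
    obtain k' where "k = Suc k'" using k by (cases k) auto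
    then show ?thesis using d(2)[OF that] by (simp add: nonzero_multiplier_def poly_monom)
  qed
  then have "(\<Sum>i<m. w i ^ k / (1 - nonzero_multiplier m w i)) =
      - (\<Sum>i<m. poly (monom 1 (k - 1)) (w i) / (\<Prod>j\<in>{..<m} - {i}. w i - w j))"
    by (simp add: sum_negf)
  also have "(\<Sum>i<m. poly (monom 1 (k - 1)) (w i) / (\<Prod>j\<in>{..<m} - {i}. w i - w j)) = coeff (monom 1 (k - 1)) (m - 1)"
    using divided_difference[OF finite_lessThan d(1), of "monom 1 (k - 1)"] k by (simp add: degree_monom_eq)
  finally show ?thesis using k by auto
qed

text \<open>For \<open>R = 1 + \<Prod>(z - u i)\<close> the polynomial \<open>E = z R' - m R\<close>
  has degree below \<open>m\<close> because the top terms cancel, and the hypothesis says that it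
  vanishes at the \<open>m\<close> points \<open>u i\<close>. So \<open>R\<close> is homogeneous,
  that is \<open>z^m\<close>, while \<open>R\<close> equals 1 at each \<open>u i\<close>.\<close>

lemma roots_of_unity_of_multipliers:
  assumes m: "m \<ge> 1" and h: "\<And>i. i < m \<Longrightarrow> nonzero_multiplier m u i = of_nat (m + 1)" and "i < m"
  shows "u i ^ m = 1"
proof -
  have ne: "nonzero_multiplier m u i \<noteq> 1" if "i < m" for i
    using h[OF that] m by simp
  have d: "inj_on u {..<m}" using nonzero_multiplier_distinct[of m u] ne by blast
  define P where "P = (\<Prod>i<m. [:- u i, 1:])"
  define R where "R = 1 + P"
  define E where "E = [:0, 1:] * pderiv R - smult (of_nat m) R"
  have degP: "degree P = m" unfolding P_def by (subst degree_prod_sum_eq) auto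
  have "lead_coeff P = 1" unfolding P_def by (simp add: lead_coeff_prod)
  then have Rm: "coeff R m = 1" using degP m by (simp add: R_def)
  have degR: "degree R \<le> m" unfolding R_def using degP by (intro degree_add_le) auto
  have cE: "coeff E k = (of_nat k - of_nat m) * coeff R k" for k
    by (cases k) (simp_all add: E_def coeff_pderiv algebra_simps)
  have degE: "coeff E k = 0" if "k \<ge> m" for k
    using that degR by (cases "k = m") (simp_all add: cE coeff_eq_0)
  have "poly E (u i) = 0" if i: "i < m" for i
  proof -
    have "P = [:- u i, 1:] * (\<Prod>j\<in>{..<m} - {i}. [:- u j, 1:])"
      unfolding P_def using i by (intro prod.remove) auto
    then have "pderiv P = [:- u i, 1:] * pderiv (\<Prod>j\<in>{..<m} - {i}. [:- u j, 1:])
        + (\<Prod>j\<in>{..<m} - {i}. [:- u j, 1:]) * pderiv [:- u i, 1:]" by (simp only: pderiv_mult)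
    then have "poly (pderiv P) (u i) = (\<Prod>j\<in>{..<m} - {i}. u i - u j)"
      by (simp add: pderiv_pCons poly_prod)
    moreover have "poly P (u i) = 0" unfolding P_def poly_prod using i by (auto simp: prod_zero_iff)
    moreover have "u i * (\<Prod>j\<in>{..<m} - {i}. u i - u j) = of_nat m"
      using h[OF i] by (simp add: nonzero_multiplier_def)
    ultimately show ?thesis by (simp add: E_def R_def pderiv_add)
  qed
  moreover have "card (u ` {..<m}) = m" using card_image[OF d] by simp
  moreover have "degree E < m"
    using m degE by (metis leading_coeff_0_iff degree_0 not_le not_one_le_zero gr0I)
  ultimately have "E = 0"
    by (intro poly_eqI_degree[of "u ` {..<m}"]) (use m in auto)
  then have R0: "coeff R k = 0" if "k < m" for k using cE[of k] that by simp
  have "R = monom 1 m"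
  proof (rule poly_eqI)
    fix k show "coeff R k = coeff (monom 1 m) k"
      using Rm R0 degR by (cases "k < m"; cases "k = m") (auto simp: coeff_eq_0)
  qed
  moreover have "poly R (u i) = 1"
    unfolding R_def P_def using \<open>i < m\<close> by (auto simp: poly_prod prod_zero_iff)
  ultimately show ?thesis by (simp add: poly_monom)
qed

lemma tendsto_nonzero_multiplier:
  assumes "\<And>i. i < m \<Longrightarrow> (\<lambda>n. w n i) \<longlonglongrightarrow> u i" "i < m"
  shows "(\<lambda>n. nonzero_multiplier m (w n) i) \<longlonglongrightarrow> nonzero_multiplier m u i"
  unfolding nonzero_multiplier_def using assms by (intro tendsto_intros) auto

text \<open>After rescaling to a bounded configuration, escaping fixed points would produce a nonzero
  limit all of whose power sums of orders \<open>1, \<dots>, m\<close> vanish.\<close>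

lemma multipliers_compactness:
  assumes m: "m \<ge> 1"
    and lim: "\<And>i. i < m \<Longrightarrow> (\<lambda>n. nonzero_multiplier m (w n) i) \<longlonglongrightarrow> of_nat (m + 1)"
  shows "\<exists>r u. strict_mono r \<and> (\<forall>i<m. (\<lambda>n. w (r n) i) \<longlonglongrightarrow> u i) \<and> inj_on u {..<m} \<and> (\<forall>i<m. u i ^ m = 1)"
proof -
  define \<sigma> where "\<sigma> n = 1 + (\<Sum>i<m. cmod (w n i))" for n
  have \<sigma>: "\<sigma> n \<ge> 1" for n unfolding \<sigma>_def by (simp add: sum_nonneg)
  \<comment> \<open>Index \<open>m\<close> stores a homogenizing coordinate: the fixed points escape
    exactly when its limit \<open>l m\<close> is 0.\<close>
  define a where "a n i = (if i < m then w n i / of_real (\<sigma> n) else 1 / of_real (\<sigma> n))" for n i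
  have "cmod (a n i) \<le> 1" for n i
  proof (cases "i < m")
    case True
    then have "cmod (w n i) \<le> (\<Sum>i<m. cmod (w n i))" by (intro member_le_sum) auto
    then have "cmod (w n i) \<le> \<sigma> n" by (simp add: \<sigma>_def)
    then show ?thesis using \<sigma>[of n] True by (simp add: a_def norm_divide)
  next
    case False
    then show ?thesis using \<sigma>[of n] by (simp add: a_def norm_divide)
  qed
  then obtain r l where r: "strict_mono r" and l': "\<forall>i\<in>{..m}. (\<lambda>n. a (r n) i) \<longlonglongrightarrow> l i"
    using bounded_family_convergent_subseq[of "{..m}" a 1] by blast
  have l: "(\<lambda>n. a (r n) i) \<longlonglongrightarrow> l i" if "i \<le> m" for i using l' that by simp
  have limr: "(\<lambda>n. nonzero_multiplier m (w (r n)) i) \<longlonglongrightarrow> of_nat (m + 1)" if "i < m" for i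
    using LIMSEQ_subseq_LIMSEQ[OF lim[OF that] r] by (simp add: comp_def)
  have mne: "(of_nat (m + 1) :: complex) \<noteq> 1" using m by simp
  have "\<forall>\<^sub>F n in sequentially. \<forall>i\<in>{..<m}. nonzero_multiplier m (w (r n)) i \<noteq> 1"
    by (intro eventually_ball_finite ballI tendsto_imp_eventually_ne[OF limr mne]) auto
  then have ev: "\<forall>\<^sub>F n in sequentially. \<forall>i<m. nonzero_multiplier m (w (r n)) i \<noteq> 1"
    by (rule eventually_mono) blast
  have "l m \<noteq> 0"
  proof
    assume l0: "l m = 0"
    \<comment> \<open>The identities of orders 1 to \<open>m\<close>, rescaled. The value -1 at
      order \<open>m\<close> becomes minus the \<open>m\<close>-th power of the homogenizing
      coordinate and disappears in the limit too.\<close>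
    have pw: "(\<Sum>i<m. l i * l i ^ k) = 0" if k: "k < m" for k
    proof -
      have "\<forall>\<^sub>F n in sequentially. (\<Sum>i<m. a (r n) i ^ Suc k / (1 - nonzero_multiplier m (w (r n)) i)) =
          (if Suc k = m then -1 else 0) * a (r n) m ^ Suc k"
        using ev
      proof eventually_elim
        case (elim n)
        have "a (r n) i ^ Suc k = a (r n) m ^ Suc k * w (r n) i ^ Suc k" if "i < m" for i
          using that by (simp add: a_def power_divide)
        then have "(\<Sum>i<m. a (r n) i ^ Suc k / (1 - nonzero_multiplier m (w (r n)) i)) =
            a (r n) m ^ Suc k * (\<Sum>i<m. w (r n) i ^ Suc k / (1 - nonzero_multiplier m (w (r n)) i))"
          by (simp add: sum_distrib_left del: power_Suc)
        then show ?case
          using multiplier_moments[of m "w (r n)" "Suc k"] elim k by (simp del: power_Suc)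
      qed
      moreover have "(\<lambda>n. \<Sum>i<m. a (r n) i ^ Suc k / (1 - nonzero_multiplier m (w (r n)) i)) \<longlonglongrightarrow>
          (\<Sum>i<m. l i ^ Suc k / (1 - of_nat (m + 1)))"
        by (intro tendsto_intros l limr) (use mne in auto)
      moreover have "(\<lambda>n. (if Suc k = m then -1 else 0) * a (r n) m ^ Suc k) \<longlonglongrightarrow>
          (if Suc k = m then -1 else 0) * l m ^ Suc k"
        by (intro tendsto_intros l) auto
      ultimately have "(\<Sum>i<m. l i ^ Suc k / (1 - of_nat (m + 1))) = (if Suc k = m then -1 else 0) * l m ^ Suc k"
        by (rule LIMSEQ_eventually_eq_unique)
      then have "(\<Sum>i<m. l i ^ Suc k / (1 - of_nat (m + 1))) = 0" using l0 by simp
      then have "(\<Sum>i<m. l i ^ Suc k) / (1 - of_nat (m + 1)) = 0" unfolding sum_divide_distrib .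
      then show ?thesis using m by simp
    qed
    have l_zero: "l i = 0" if i: "i < m" for i
    proof -
      have "(\<Sum>j\<in>{j \<in> {..<m}. l j = l i}. l j) = 0"
        by (rule vandermonde_kernel) (use pw in auto)
      moreover have "(\<Sum>j\<in>{j \<in> {..<m}. l j = l i}. l j) = of_nat (card {j \<in> {..<m}. l j = l i}) * l i"
        by simp
      moreover have "card {j \<in> {..<m}. l j = l i} \<noteq> 0" using i by (auto simp: card_eq_0_iff)
      ultimately show ?thesis by (metis mult_eq_0_iff of_nat_eq_0_iff)
    qed
    \<comment> \<open>By the choice of \<open>\<sigma>\<close> all coordinates together have norm
      sum 1, which is incompatible with the limit 0.\<close>
    have "(\<Sum>i<m. cmod (a (r n) i)) = 1 - cmod (a (r n) m)" for n
    proof -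
      have "(\<Sum>i<m. cmod (a (r n) i)) = (\<Sum>i<m. cmod (w (r n) i)) / \<sigma> (r n)"
        using \<sigma>[of "r n"] by (simp add: a_def norm_divide sum_divide_distrib)
      also have "\<dots> = 1 - 1 / \<sigma> (r n)" using \<sigma>[of "r n"] by (simp add: \<sigma>_def field_simps)
      finally show ?thesis using \<sigma>[of "r n"] by (simp add: a_def norm_divide)
    qed
    moreover have "(\<lambda>n. \<Sum>i<m. cmod (a (r n) i)) \<longlonglongrightarrow> (\<Sum>i<m. cmod (l i))"
      by (intro tendsto_intros l) auto
    moreover have "(\<lambda>n. 1 - cmod (a (r n) m)) \<longlonglongrightarrow> 1 - cmod (l m)" by (intro tendsto_intros l) auto
    ultimately have "(\<Sum>i<m. cmod (l i)) = 1 - cmod (l m)" using LIMSEQ_unique by simp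
    then show False using l0 l_zero by simp
  qed
  define u where "u i = l i / l m" for i
  have wu: "(\<lambda>n. w (r n) i) \<longlonglongrightarrow> u i" if "i < m" for i
  proof -
    have "(\<lambda>n. a (r n) i / a (r n) m) \<longlonglongrightarrow> u i" unfolding u_def
      by (intro tendsto_intros l \<open>l m \<noteq> 0\<close>) (use that in auto)
    moreover have "a (r n) i / a (r n) m = w (r n) i" for n
      using \<sigma>[of "r n"] that by (simp add: a_def)
    ultimately show ?thesis by simp
  qed
  have nm: "nonzero_multiplier m u i = of_nat (m + 1)" if "i < m" for i
    using LIMSEQ_unique[OF tendsto_nonzero_multiplier[OF wu that] limr[OF that]] by simp
  then have "\<forall>i<m. nonzero_multiplier m u i \<noteq> 1" using mne by simp
  then have "inj_on u {..<m}" by (rule nonzero_multiplier_distinct)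
  then show ?thesis using r wu roots_of_unity_of_multipliers[OF m nm] by blast
qed

text \<open>A sequential inverse function theorem. The normalised differences converge along a
  subsequence to a vector of norm sum 1, and the difference of the moment identities becomes in the
  limit a Vandermonde system with distinct nodes, which that vector solves only if it is 0.\<close>

lemma multipliers_locally_injective:
  assumes m: "m \<ge> 1" and u: "inj_on u {..<m}" "\<And>i. i < m \<Longrightarrow> nonzero_multiplier m u i \<noteq> 1"
    and w: "\<And>i. i < m \<Longrightarrow> (\<lambda>n. w n i) \<longlonglongrightarrow> u i" and z: "\<And>i. i < m \<Longrightarrow> (\<lambda>n. z n i) \<longlonglongrightarrow> u i"
    and eq: "\<And>n i. i < m \<Longrightarrow> nonzero_multiplier m (w n) i = nonzero_multiplier m (z n) i"
  shows "\<exists>n. \<forall>i<m. w n i = z n i"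
proof (rule ccontr)
  assume neq: "\<not> (\<exists>n. \<forall>i<m. w n i = z n i)"
  define D where "D n = (\<Sum>i<m. cmod (w n i - z n i))" for n
  have D: "D n > 0" for n
  proof -
    obtain i where "i < m" "w n i \<noteq> z n i" using neq by blast
    then show ?thesis unfolding D_def by (intro sum_pos2[of _ i]) auto
  qed
  define \<delta> where "\<delta> n i = (w n i - z n i) / of_real (D n)" for n i
  have "cmod (\<delta> n i) \<le> 1" if "i \<in> {..<m}" for n i
  proof -
    have "cmod (w n i - z n i) \<le> D n" unfolding D_def using that by (intro member_le_sum) auto
    then show ?thesis using D[of n] by (simp add: \<delta>_def norm_divide)
  qed
  then obtain r l where r: "strict_mono r" and l': "\<forall>i\<in>{..<m}. (\<lambda>n. \<delta> (r n) i) \<longlonglongrightarrow> l i"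
    using bounded_family_convergent_subseq[of "{..<m}" \<delta> 1] by blast
  have l: "(\<lambda>n. \<delta> (r n) i) \<longlonglongrightarrow> l i" if "i < m" for i using l' that by simp
  have wr: "(\<lambda>n. w (r n) i) \<longlonglongrightarrow> u i" and zr: "(\<lambda>n. z (r n) i) \<longlonglongrightarrow> u i" if "i < m" for i
    using LIMSEQ_subseq_LIMSEQ[OF w[OF that] r] LIMSEQ_subseq_LIMSEQ[OF z[OF that] r] by (simp_all add: comp_def)
  have "\<forall>\<^sub>F n in sequentially. \<forall>i\<in>{..<m}. nonzero_multiplier m (w (r n)) i \<noteq> 1"
    by (intro eventually_ball_finite ballI tendsto_imp_eventually_ne[OF tendsto_nonzero_multiplier[OF wr]] u(2)) auto
  then have ev: "\<forall>\<^sub>F n in sequentially. \<forall>i<m. nonzero_multiplier m (w (r n)) i \<noteq> 1"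
    by (rule eventually_mono) blast
  define \<mu> where "\<mu> i = 1 - nonzero_multiplier m u i" for i
  have \<mu>0: "\<mu> i \<noteq> 0" if "i < m" for i using u(2)[OF that] by (simp add: \<mu>_def)
  have pw: "(\<Sum>i<m. (l i / \<mu> i) * u i ^ k) = 0" if k: "k < m" for k
  proof -
    \<comment> \<open>The cofactor of \<open>w - z\<close> in the difference of the powers of
      exponent \<open>k + 1\<close>; in the limit it becomes \<open>k + 1\<close> times the
      \<open>k\<close>-th power of \<open>u i\<close>.\<close>
    define H where "H n i = (\<Sum>j<Suc k. z n i ^ (Suc k - Suc j) * w n i ^ j)" for n i
    have "\<forall>\<^sub>F n in sequentially. (\<Sum>i<m. \<delta> (r n) i * H (r n) i / (1 - nonzero_multiplier m (w (r n)) i)) = 0"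
      using ev
    proof eventually_elim
      case (elim n)
      let ?L = "nonzero_multiplier m (w (r n))"
      have e: "?L i = nonzero_multiplier m (z (r n)) i" if "i < m" for i using eq[OF that] .
      have "(\<Sum>i<m. w (r n) i ^ Suc k / (1 - ?L i)) = (\<Sum>i<m. z (r n) i ^ Suc k / (1 - nonzero_multiplier m (z (r n)) i))"
        using multiplier_moments[of m "w (r n)" "Suc k"] multiplier_moments[of m "z (r n)" "Suc k"] elim e k by simp
      also have "\<dots> = (\<Sum>i<m. z (r n) i ^ Suc k / (1 - ?L i))" using e by (intro sum.cong) auto
      finally have "(\<Sum>i<m. (w (r n) i ^ Suc k - z (r n) i ^ Suc k) / (1 - ?L i)) = 0"
        by (simp add: diff_divide_distrib sum_subtractf)
      moreover have "w (r n) i ^ Suc k - z (r n) i ^ Suc k = of_real (D (r n)) * (\<delta> (r n) i * H (r n) i)" for i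
        unfolding power_diff_sumr2[of "w (r n) i" "Suc k"] H_def \<delta>_def using D[of "r n"] by simp
      ultimately have "of_real (D (r n)) * (\<Sum>i<m. \<delta> (r n) i * H (r n) i / (1 - ?L i)) = 0"
        by (simp add: sum_distrib_left)
      then show ?case using D[of "r n"] by simp
    qed
    moreover have "(\<lambda>n. \<Sum>i<m. \<delta> (r n) i * H (r n) i / (1 - nonzero_multiplier m (w (r n)) i)) \<longlonglongrightarrow>
        (\<Sum>i<m. l i * (\<Sum>j<Suc k. u i ^ (Suc k - Suc j) * u i ^ j) / \<mu> i)"
      unfolding H_def \<mu>_def
      by (intro tendsto_intros l wr zr tendsto_nonzero_multiplier[OF wr]) (use u(2) in auto)
    ultimately have 0: "(\<Sum>i<m. l i * (\<Sum>j<Suc k. u i ^ (Suc k - Suc j) * u i ^ j) / \<mu> i) = 0"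
      by (rule LIMSEQ_eventually_eq_unique[OF _ _ tendsto_const])
    have "(\<Sum>j<Suc k. u i ^ (Suc k - Suc j) * u i ^ j) = of_nat (Suc k) * u i ^ k" for i
    proof -
      have "(\<Sum>j<Suc k. u i ^ (Suc k - Suc j) * u i ^ j) = (\<Sum>j<Suc k. u i ^ k)"
        by (rule sum.cong) (auto simp: power_add[symmetric])
      then show ?thesis by simp
    qed
    then have "of_nat (Suc k) * (\<Sum>i<m. (l i / \<mu> i) * u i ^ k) = 0"
      using 0 by (simp add: sum_distrib_left mult_ac del: of_nat_Suc)
    then show ?thesis by (simp del: of_nat_Suc)
  qed
  have V: "(\<Sum>i\<in>{i \<in> {..<m}. u i = v}. l i / \<mu> i) = 0" for v
    by (rule vandermonde_kernel) (use pw in auto)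
  have l0: "l i = 0" if i: "i < m" for i
  proof -
    have "{j \<in> {..<m}. u j = u i} = {i}" using u(1) i by (auto dest: inj_onD)
    then have "(\<Sum>j\<in>{i}. l j / \<mu> j) = 0" using V[of "u i"] by (simp only:)
    then show ?thesis using \<mu>0[OF i] by simp
  qed
  have "(\<Sum>i<m. cmod (\<delta> (r n) i)) = 1" for n
  proof -
    have "cmod (\<delta> (r n) i) = cmod (w (r n) i - z (r n) i) / D (r n)" for i
      using D[of "r n"] by (simp add: \<delta>_def norm_divide)
    then have "(\<Sum>i<m. cmod (\<delta> (r n) i)) = D (r n) / D (r n)"
      by (simp only: sum_divide_distrib[symmetric] D_def[symmetric])
    then show ?thesis using D[of "r n"] by simp
  qed
  moreover have "(\<lambda>n. \<Sum>i<m. cmod (\<delta> (r n) i)) \<longlonglongrightarrow> (\<Sum>i<m. cmod (l i))" by (intro tendsto_intros l) auto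
  ultimately have "(\<Sum>i<m. cmod (l i)) = 1" by (simp add: LIMSEQ_const_iff)
  then show False using l0 by simp
qed


section \<open>The first-order variation of a multiplier of period 2\<close>

text \<open>For \<open>x\<close> on a 2-cycle of \<open>z\<^bsup>m + 1\<^esup>\<close>, this is up to the factor \<open>m + 1\<close> the derivative of the
  multiplier at this cycle in the direction in which the multipliers at the nonzero fixed points
  \<open>\<zeta>\<close> vary by \<open>e \<zeta>\<close>.\<close>

definition cycle_form :: "nat \<Rightarrow> complex \<Rightarrow> complex poly \<Rightarrow> complex" where
  "cycle_form m x e = poly e x * (x ^ Suc m) ^ m + poly e (x ^ Suc m) * x ^ m"

lemma prod_roots_of_unity:
  assumes m: "m \<ge> 1" and u: "inj_on u {..<m}" "\<forall>i<m. u i ^ m = (1 :: complex)"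
  shows "(\<Prod>i<m. [:- u i, 1:]) = monom 1 m - 1"
proof -
  define P where "P = (\<Prod>i<m. [:- u i, 1:])"
  have degP: "degree P = m" unfolding P_def by (subst degree_prod_sum_eq) auto
  have "lead_coeff P = 1" unfolding P_def by (simp add: lead_coeff_prod)
  then have Pm: "coeff P m = 1" using degP by simp
  define D where "D = P - (monom 1 m - 1)"
  have "coeff D k = 0" if "k \<ge> m" for k
    using that Pm degP m by (cases "k = m") (auto simp: D_def coeff_eq_0 coeff_1)
  then have "degree D < m" using m by (metis leading_coeff_0_iff degree_0 not_le not_one_le_zero gr0I)
  moreover have "card (u ` {..<m}) = m" using card_image[OF u(1)] by simp
  moreover have "poly D x = 0" if xu: "x \<in> u ` {..<m}" for x
  proof -
    obtain i where i: "i < m" "x = u i" using xu by blast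
    then have "poly P x = 0" unfolding P_def poly_prod by (auto simp: prod_zero_iff)
    then show ?thesis using u(2)[rule_format, OF i(1)] i(2) by (simp add: D_def poly_monom)
  qed
  ultimately have "D = 0" by (intro poly_eqI_degree[of "u ` {..<m}"]) (use m in auto)
  then show ?thesis by (simp add: D_def P_def)
qed

text \<open>The numerator is \<open>z^m - 1\<close> without the factor \<open>z - u i\<close>, and
  the denominator is its derivative \<open>m (u i)^(m - 1) = m / u i\<close>.\<close>

lemma lagrange_basis_roots_of_unity:
  assumes m: "m \<ge> 1" and u: "inj_on u {..<m}" "\<forall>i<m. u i ^ m = (1 :: complex)"
    and i: "i < m" and x: "x \<noteq> u i"
  shows "poly (lagrange_basis {..<m} u i) x = u i * (x ^ m - 1) / (of_nat m * (x - u i))"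
proof -
  note P = prod_roots_of_unity[OF m u]
  have "(\<Prod>j<m. x - u j) = x ^ m - 1"
    using arg_cong[OF P, of "\<lambda>p. poly p x"] by (simp add: poly_prod poly_monom)
  moreover have "(\<Prod>j<m. x - u j) = (x - u i) * (\<Prod>j\<in>{..<m} - {i}. x - u j)"
    using i by (intro prod.remove) auto
  ultimately have num: "(\<Prod>j\<in>{..<m} - {i}. x - u j) = (x ^ m - 1) / (x - u i)"
    using x by (simp add: field_simps)
  have "poly (pderiv (monom 1 m - 1)) (u i) = (\<Prod>j\<in>{..<m} - {i}. u i - u j)"
    unfolding P[symmetric] using i by (intro poly_pderiv_prod_linear) auto
  then have "(\<Prod>j\<in>{..<m} - {i}. u i - u j) = of_nat m * u i ^ (m - 1)"
    by (simp add: pderiv_diff pderiv_monom poly_monom)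
  moreover have ui: "u i * u i ^ (m - 1) = 1" using u(2)[rule_format, OF i] m by (metis Suc_diff_1 One_nat_def Suc_le_eq power_Suc)
  then have "u i \<noteq> 0" by auto
  with ui have "u i ^ (m - 1) = 1 / u i" by (simp add: field_simps)
  ultimately have den: "(\<Prod>j\<in>{..<m} - {i}. u i - u j) = of_nat m / u i" by simp
  show ?thesis unfolding poly_lagrange_basis prod_dividef num den using \<open>u i \<noteq> 0\<close> x m by (simp add: field_simps)
qed

lemma root_of_unity_Suc:
  assumes "(s :: complex) ^ (m + 2) = 1"
  shows "s \<noteq> 0" "s ^ Suc m = 1 / s"
proof -
  show s0: "s \<noteq> 0" using assms by auto
  have "s ^ Suc m * s = 1" using assms by (simp add: mult_ac)
  then show "s ^ Suc m = 1 / s" using s0 by (simp add: eq_divide_eq)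
qed

text \<open>The other point of the cycle is \<open>x s\<close>, and its \<open>m\<close>-th power is
  \<open>1 / s\<close>; as \<open>s\<close> is not 1, neither point meets a fixed point
  \<open>u i\<close>. The coefficient of the form at \<open>u i\<close> depends on \<open>i\<close>
  only through \<open>t = x / u i\<close>, by way of \<open>(t - 1) (t s - 1)\<close>.\<close>

lemma cycle_form_basis:
  assumes m: "m \<ge> 1" and u: "inj_on u {..<m}" "\<forall>i<m. u i ^ m = (1 :: complex)"
    and i: "i < m" and x: "x ^ m = s" and s: "s \<noteq> 1" "s ^ (m + 2) = 1"
  shows "cycle_form m x (lagrange_basis {..<m} u i) =
      (s - 1)\<^sup>2 / (of_nat m * s * ((x / u i - 1) * (x / u i * s - 1)))"
    "x / u i \<noteq> 1" "x / u i * s \<noteq> 1"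
proof -
  note s' = root_of_unity_Suc[OF s(2)]
  have u0: "u i \<noteq> 0" using u(2)[rule_format, OF i] m by (metis power_0_left not_one_le_zero zero_neq_one)
  have y: "x ^ Suc m = x * s" using x by simp
  have ym: "(x * s) ^ m = 1 / s" using x s'(2) by (simp add: power_mult_distrib)
  have "1 / s \<noteq> 1" using s(1) s'(1) by (simp add: divide_eq_eq)
  then have n2: "x * s \<noteq> u i" using ym u(2)[rule_format, OF i] by metis
  have n1: "x \<noteq> u i" using x u(2)[rule_format, OF i] s(1) by metis
  show "x / u i \<noteq> 1" "x / u i * s \<noteq> 1" using n1 n2 u0 by (simp_all add: divide_eq_eq)
  have L: "poly (lagrange_basis {..<m} u i) x = u i * (s - 1) / (of_nat m * (x - u i))"
    "poly (lagrange_basis {..<m} u i) (x * s) = u i * (1 / s - 1) / (of_nat m * (x * s - u i))"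
    using lagrange_basis_roots_of_unity[OF m u i n1] lagrange_basis_roots_of_unity[OF m u i n2] x ym by simp_all
  have nz: "x - u i \<noteq> 0" "x * s - u i \<noteq> 0" "(of_nat m :: complex) \<noteq> 0" using n1 n2 m by simp_all
  have "cycle_form m x (lagrange_basis {..<m} u i) =
      u i * (s - 1) / (of_nat m * (x - u i)) * (1 / s) + u i * (1 / s - 1) / (of_nat m * (x * s - u i)) * s"
    unfolding cycle_form_def y ym x L ..
  also have "\<dots> = (u i)\<^sup>2 * (s - 1)\<^sup>2 / (of_nat m * s * ((x - u i) * (x * s - u i)))"
    using nz s'(1) by (simp add: divide_simps power2_eq_square) (simp add: algebra_simps)
  also have "(x - u i) * (x * s - u i) = (u i)\<^sup>2 * ((x / u i - 1) * (x / u i * s - 1))"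
    using u0 by (simp add: field_simps power2_eq_square)
  finally show "cycle_form m x (lagrange_basis {..<m} u i) =
      (s - 1)\<^sup>2 / (of_nat m * s * ((x / u i - 1) * (x / u i * s - 1)))"
    using u0 by simp
qed

lemma norm_1_of_power: "(z :: complex) ^ n = 1 \<Longrightarrow> n \<ge> 1 \<Longrightarrow> cmod z = 1"
  by (metis norm_one norm_power norm_ge_zero power_eq_imp_eq_base power_one zero_le_one Suc_le_eq One_nat_def)

lemma unit_cnj: "cmod z = 1 \<Longrightarrow> cnj z = 1 / z"
  using complex_div_cnj[of 1 z] by simp

text \<open>Two distinct values \<open>t, t'\<close> with the same image have sum \<open>1 + 1 / s\<close>. Together with the
  conjugate equation this makes them the roots \<open>1\<close> and \<open>1 / s\<close> of \<open>(X - 1) (X - 1 / s)\<close>.\<close>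

lemma unit_quadratic_injective:
  assumes n: "cmod t = 1" "cmod t' = 1" "cmod s = 1" and s: "s \<noteq> -1"
    and ne: "t \<noteq> 1" "t * s \<noteq> 1" and eq: "(t - 1) * (t * s - 1) = (t' - 1) * (t' * s - 1)"
  shows "t = t'"
proof (rule ccontr)
  assume tt: "t \<noteq> t'"
  have z: "t \<noteq> 0" "t' \<noteq> 0" "s \<noteq> 0" using n by auto
  have "(t - t') * (s * (t + t') - (1 + s)) = 0" using eq by algebra
  then have sum: "s * (t + t') = 1 + s" using tt by simp
  then have "cnj (s * (t + t')) = cnj (1 + s)" by simp
  then have "1 / s * (1 / t + 1 / t') = 1 + 1 / s" using n by (simp add: unit_cnj)
  then have "s * (t + t') = s * ((1 + s) * (t * t'))" using z by (simp add: field_simps)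
  then have "t + t' = (1 + s) * (t * t')" using z(3) by simp
  then have "1 + s = s * ((1 + s) * (t * t'))" using sum by simp
  then have "(1 + s) * (s * (t * t') - 1) = 0" by algebra
  moreover have "1 + s \<noteq> 0" using s by (metis add.commute eq_neg_iff_add_eq_0)
  ultimately have prod: "s * (t * t') = 1" by simp
  have "(t - 1) * (t * s - 1) = 0" using sum prod by algebra
  then show False using ne by simp
qed

text \<open>Equality on constants identifies the two cycles up to the choice of a starting point.
  Equality on the interpolation basis then compares coefficients, and injectivity of
  \<open>(t - 1) (t s - 1)\<close> on the relevant points of the unit circle gives
  \<open>x / v k = y / u k\<close> for all \<open>k\<close>, so \<open>\<rho> = x / y\<close> for a
  suitable starting point \<open>y\<close>.\<close>

lemma cycle_form_rigidity:
  assumes m: "m \<ge> 1" and u: "inj_on u {..<m}" "\<forall>i<m. u i ^ m = (1 :: complex)"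
    and v: "inj_on v {..<m}" "\<forall>i<m. v i ^ m = (1 :: complex)"
    and x: "x ^ m = s" and s: "s \<noteq> 1" "s \<noteq> -1" "s ^ (m + 2) = 1"
    and y: "y ^ (m * (m + 2)) = 1"
    and eq: "\<And>e. degree e < m \<Longrightarrow> cycle_form m x e =
        cycle_form m y (\<Sum>i<m. smult (poly e (v i)) (lagrange_basis {..<m} u i))"
  shows "\<exists>\<rho>. \<rho> ^ m = 1 \<and> (\<forall>i<m. v i = \<rho> * u i)"
proof -
  define s' where "s' = y ^ m"
  have s'p: "s' ^ (m + 2) = 1" using y by (simp only: s'_def power_mult)
  note S = root_of_unity_Suc[OF s(3)] and S' = root_of_unity_Suc[OF s'p]
  have pw: "(z ^ Suc m) ^ m = (z ^ m) ^ Suc m" for z :: complex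
    by (metis mult.commute power_mult)
  \<comment> \<open>Testing on \<open>e = 1\<close> gives \<open>s + 1/s = s' + 1/s'\<close>. If
    \<open>s'\<close> is \<open>1/s\<close>, the second point of the cycle of \<open>y\<close> has
    \<open>m\<close>-th power \<open>s\<close> and the same form.\<close>
  have "(\<Sum>i<m. smult (poly 1 (v i)) (lagrange_basis {..<m} u i)) = (1 :: complex poly)"
    using lagrange_interpolation[OF finite_lessThan u(1), of 1] m by simp
  then have "cycle_form m x 1 = cycle_form m y 1" using eq[of 1] m by simp
  then have "1 / s + s = 1 / s' + s'"
    unfolding cycle_form_def pw x s'_def[symmetric] using S(2) S'(2) by simp
  then have "(s - s') * (s * s' - 1) = 0" using S(1) S'(1) by (simp add: field_simps)
  then have ss: "s' = s \<or> s * s' = 1" by auto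
  obtain y0 where y0: "y0 ^ m = s" "\<And>e. cycle_form m y0 e = cycle_form m y e"
  proof (cases "s' = s")
    case True
    then show ?thesis using that[of y] by (simp add: s'_def)
  next
    case False
    then have "s = 1 / s'" using ss S'(1) by (simp add: eq_divide_eq)
    then have 1: "(y ^ Suc m) ^ m = s" unfolding pw s'_def[symmetric] S'(2) by simp
    have "(y ^ Suc m) ^ Suc m = y ^ (m * (m + 2)) * y" 
      by (simp add: power_mult[symmetric] power_add[symmetric] algebra_simps)
    then have 2: "(y ^ Suc m) ^ Suc m = y" using y by simp
    have "cycle_form m (y ^ Suc m) e = cycle_form m y e" for e
      unfolding cycle_form_def 2 by (simp only: add.commute)
    then show ?thesis using that[of "y ^ Suc m"] 1 by blast
  qed
  have norm: "cmod z = 1" if "z ^ m = s \<or> z ^ m = 1" for z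
  proof (rule norm_1_of_power)
    have "(z ^ m) ^ (m + 2) = 1" using that s(3) by auto
    then show "z ^ (m * (m + 2)) = 1" by (simp only: power_mult)
    show "m * (m + 2) \<ge> 1" using m by simp
  qed
  have "v k = x / y0 * u k" if k: "k < m" for k
  proof -
    \<comment> \<open>The polynomial that is 1 at \<open>v k\<close> and 0 at the other
      \<open>v i\<close>; relabelled to the nodes \<open>u\<close> it is the basis polynomial at
      \<open>u k\<close>.\<close>
    let ?e = "lagrange_basis {..<m} v k"
    have "degree ?e < m" using degree_lagrange_basis(1)[OF finite_lessThan _ v(1), of k] k by simp
    have "poly ?e (v i) = (if i = k then 1 else 0)" if i: "i < m" for i
    proof (cases "i = k")
      case True
      have "(v k - v j) / (v k - v j) = 1" if "j \<in> {..<m} - {k}" for j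
        using v(1) k that by (auto dest: inj_onD)
      then show ?thesis using True by (simp add: poly_lagrange_basis)
    next
      case False
      then show ?thesis using i by (auto simp: poly_lagrange_basis prod_zero_iff)
    qed
    then have "(\<Sum>i<m. smult (poly ?e (v i)) (lagrange_basis {..<m} u i)) =
        (\<Sum>i<m. if i = k then lagrange_basis {..<m} u i else 0)" by (intro sum.cong) auto
    also have "\<dots> = lagrange_basis {..<m} u k" using k by simp
    finally have E: "cycle_form m x ?e = cycle_form m y0 (lagrange_basis {..<m} u k)"
      using eq[OF \<open>degree ?e < m\<close>] y0(2) by simp
    define t t' where "t = x / v k" and "t' = y0 / u k"
    note X = cycle_form_basis[OF m v k x s(1,3), folded t_def]
      and Y = cycle_form_basis[OF m u k y0(1) s(1,3), folded t'_def]
    have nz: "(s - 1)\<^sup>2 \<noteq> 0" "of_nat m * s \<noteq> 0" "(t - 1) * (t * s - 1) \<noteq> 0" "(t' - 1) * (t' * s - 1) \<noteq> 0"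
      using s(1) S(1) m X(2,3) Y(2,3) by auto
    have "(s - 1)\<^sup>2 / (of_nat m * s * ((t - 1) * (t * s - 1))) = (s - 1)\<^sup>2 / (of_nat m * s * ((t' - 1) * (t' * s - 1)))"
      using E X(1) Y(1) by simp
    then have "(t - 1) * (t * s - 1) = (t' - 1) * (t' * s - 1)"
      using nz by (simp add: frac_eq_eq)
    moreover have "cmod t = 1" "cmod t' = 1" "cmod s = 1"
      using norm[of x] norm[of "v k"] norm[of y0] norm[of "u k"] x v(2)[rule_format, OF k] y0(1) u(2)[rule_format, OF k] norm_1_of_power[OF s(3)]
      by (simp_all add: t_def t'_def norm_divide)
    ultimately have "t = t'" using unit_quadratic_injective[of t t' s] s(2) X(2,3) by blast
    moreover have "v k \<noteq> 0" "u k \<noteq> 0" "y0 \<noteq> 0"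
      using norm[of "v k"] norm[of "u k"] norm[of y0] u(2)[rule_format, OF k] v(2)[rule_format, OF k] y0(1) by auto
    ultimately show ?thesis by (simp add: t_def t'_def field_simps)
  qed
  moreover have "(x / y0) ^ m = 1" using x y0(1) S(1) by (simp add: power_divide)
  ultimately show ?thesis by blast
qed


section \<open>Perturbations of a power map\<close>

text \<open>Being polynomial on every line is all that is required to find common points of
  nonvanishing, and it avoids a notion of polynomial in the coordinates of \<open>c\<close>.\<close>

definition line_poly :: "((nat \<Rightarrow> complex) \<Rightarrow> complex) \<Rightarrow> bool" where
  "line_poly \<phi> \<longleftrightarrow> (\<forall>u w. \<exists>P. \<forall>t. \<phi> (\<lambda>i. u i + t * w i) = poly P t)"

lemma line_poly_affine:
  assumes "\<And>u w t. \<phi> (\<lambda>i. u i + t * w i) = a u w + t * b u w"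
  shows "line_poly \<phi>"
  unfolding line_poly_def
proof (intro allI)
  fix u w
  show "\<exists>P. \<forall>t. \<phi> (\<lambda>i. u i + t * w i) = poly P t"
    by (rule exI[of _ "[:a u w, b u w:]"]) (simp add: assms)
qed

lemma line_poly_const: "line_poly (\<lambda>c. k)"
  unfolding line_poly_def by (intro allI exI[of _ "[:k:]"]) simp

lemma line_poly_add:
  assumes "line_poly \<phi>" "line_poly \<psi>"
  shows "line_poly (\<lambda>c. \<phi> c + \<psi> c)"
  unfolding line_poly_def
proof (intro allI)
  fix u w
  obtain P Q where "\<forall>t. \<phi> (\<lambda>i. u i + t * w i) = poly P t" "\<forall>t. \<psi> (\<lambda>i. u i + t * w i) = poly Q t"
    using assms unfolding line_poly_def by meson
  then show "\<exists>P. \<forall>t. \<phi> (\<lambda>i. u i + t * w i) + \<psi> (\<lambda>i. u i + t * w i) = poly P t"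
    by (intro exI[of _ "P + Q"]) simp
qed

lemma line_poly_mult:
  assumes "line_poly \<phi>" "line_poly \<psi>"
  shows "line_poly (\<lambda>c. \<phi> c * \<psi> c)"
  unfolding line_poly_def
proof (intro allI)
  fix u w
  obtain P Q where "\<forall>t. \<phi> (\<lambda>i. u i + t * w i) = poly P t" "\<forall>t. \<psi> (\<lambda>i. u i + t * w i) = poly Q t"
    using assms unfolding line_poly_def by meson
  then show "\<exists>P. \<forall>t. \<phi> (\<lambda>i. u i + t * w i) * \<psi> (\<lambda>i. u i + t * w i) = poly P t"
    by (intro exI[of _ "P * Q"]) simp
qed

text \<open>By induction: a line from a point good for all earlier functions to a point good for the
  new one reduces the claim to a product of two nonzero polynomials in one variable.\<close>

lemma line_poly_common_nonzero:
  assumes "finite S" "\<And>s. s \<in> S \<Longrightarrow> line_poly (\<phi> s)" "\<And>s. s \<in> S \<Longrightarrow> \<exists>c. \<phi> s c \<noteq> 0"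
  shows "\<exists>c. \<forall>s\<in>S. \<phi> s c \<noteq> 0"
proof -
  have "line_poly (\<lambda>c. \<Prod>s\<in>S. \<phi> s c) \<and> (\<exists>c. (\<Prod>s\<in>S. \<phi> s c) \<noteq> 0)"
    using assms
  proof (induction S rule: finite_induct)
    case empty
    then show ?case using line_poly_const[of 1] by simp
  next
    case (insert s S)
    then have IH: "line_poly (\<lambda>c. \<Prod>s\<in>S. \<phi> s c)" "\<exists>c. (\<Prod>s\<in>S. \<phi> s c) \<noteq> 0" by auto
    have s: "line_poly (\<phi> s)" "\<exists>c. \<phi> s c \<noteq> 0" using insert.prems by auto
    obtain u v where uv: "(\<Prod>s\<in>S. \<phi> s u) \<noteq> 0" "\<phi> s v \<noteq> 0" using IH(2) s(2) by blast
    define l where "l t = (\<lambda>i. u i + t * (v i - u i))" for t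
    have l01: "l 0 = u" "l 1 = v" by (simp_all add: l_def fun_eq_iff)
    obtain P Q where P: "\<And>t. (\<Prod>s\<in>S. \<phi> s (l t)) = poly P t" and Q: "\<And>t. \<phi> s (l t) = poly Q t"
      using IH(1) s(1) unfolding line_poly_def l_def by meson
    have "P \<noteq> 0" "Q \<noteq> 0" using P[of 0] Q[of 1] uv l01 by auto
    then have "P * Q \<noteq> 0" by simp
    then obtain t where "poly (P * Q) t \<noteq> 0" using poly_all_0_iff_0 by blast
    then have "(\<Prod>s\<in>insert s S. \<phi> s (l t)) \<noteq> 0" using P Q insert.hyps by simp
    moreover have "line_poly (\<lambda>c. \<Prod>s\<in>insert s S. \<phi> s c)"
      using line_poly_mult[OF s(1) IH(1)] insert.hyps by simp
    ultimately show ?case by blast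
  qed
  then show ?thesis using assms(1) by (auto simp: prod_zero_iff)
qed

text \<open>The polynomials are chosen so that \<open>R = quotient_poly m c\<close> satisfies \<open>z R' - m R = error_poly m c\<close>.
  The multiplier of \<open>z R\<close> at a nonzero fixed point \<open>z\<close>, where \<open>R\<close> has the value 1, is then
  exactly \<open>m + 1 + error_poly m c z\<close>.\<close>

definition error_poly :: "nat \<Rightarrow> (nat \<Rightarrow> complex) \<Rightarrow> complex poly" where
  "error_poly m c = (\<Sum>k<m. monom (c k) k)"

definition quotient_poly :: "nat \<Rightarrow> (nat \<Rightarrow> complex) \<Rightarrow> complex poly" where
  "quotient_poly m c = monom 1 m + (\<Sum>k<m. monom (c k / (of_nat k - of_nat m)) k)"

definition perturbed_power :: "nat \<Rightarrow> (nat \<Rightarrow> complex) \<Rightarrow> complex poly" where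
  "perturbed_power m c = [:0, 1:] * quotient_poly m c"

lemma coeff_error_poly: "coeff (error_poly m c) k = (if k < m then c k else 0)"
  by (simp add: error_poly_def coeff_sum sum.delta)

lemma coeff_quotient_poly:
  "coeff (quotient_poly m c) k = (if k = m then 1 else if k < m then c k / (of_nat k - of_nat m) else 0)"
  by (simp add: quotient_poly_def coeff_sum sum.delta)

lemma degree_quotient_poly: "degree (quotient_poly m c) = m"
proof (rule antisym)
  show "degree (quotient_poly m c) \<le> m" by (rule degree_le) (simp add: coeff_quotient_poly)
  show "m \<le> degree (quotient_poly m c)" by (rule le_degree) (simp add: coeff_quotient_poly)
qed

lemma perturbed_power_monic: "degree (perturbed_power m c) = Suc m" "coeff (perturbed_power m c) (Suc m) = 1"
proof -
  have "quotient_poly m c \<noteq> 0" using coeff_quotient_poly[of m c m] by auto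
  then show "degree (perturbed_power m c) = Suc m"
    by (simp add: perturbed_power_def degree_quotient_poly)
  show "coeff (perturbed_power m c) (Suc m) = 1" by (simp add: perturbed_power_def coeff_quotient_poly)
qed

lemma error_poly_eq:
  "[:0, 1:] * pderiv (quotient_poly m c) - smult (of_nat m) (quotient_poly m c) = error_poly m c"
proof (rule poly_eqI)
  fix k
  have key: "coeff ([:0, 1:] * pderiv R - smult (of_nat m) R) k = (of_nat k - of_nat m) * coeff R k" for R :: "complex poly"
    by (cases k) (simp_all add: coeff_pderiv algebra_simps)
  show "coeff ([:0, 1:] * pderiv (quotient_poly m c) - smult (of_nat m) (quotient_poly m c)) k = coeff (error_poly m c) k"
    unfolding key by (simp add: coeff_quotient_poly coeff_error_poly)
qed

lemma error_poly_scale: "error_poly m (\<lambda>i. t * c i) = smult t (error_poly m c)"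
  by (rule poly_eqI) (simp add: coeff_error_poly)

lemma error_poly_of_coeffs: "degree e < m \<Longrightarrow> error_poly m (coeff e) = e"
  by (rule poly_eqI) (auto simp: coeff_error_poly coeff_eq_0)

text \<open>Every \<open>perturbed_power\<close> is monic, so the inverse of the leading coefficient
  is constant and no denominator appears.\<close>

lemma coord_ring_line_poly:
  assumes "h \<in> coord_ring (Suc m)"
  shows "line_poly (\<lambda>c. h (perturbed_power m c))"
  using assms
proof (induction rule: coord_ring.induct)
  case (coord i)
  show ?case
  proof (cases i)
    case 0
    then show ?thesis using line_poly_const[of 0] by (simp add: perturbed_power_def)
  next
    case (Suc j)
    show ?thesis
      by (rule line_poly_affine[of _ "\<lambda>u w. if j = m then 1 else if j < m then u j / (of_nat j - of_nat m) else 0"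
            "\<lambda>u w. if j = m then 0 else if j < m then w j / (of_nat j - of_nat m) else 0"])
         (simp add: Suc perturbed_power_def coeff_quotient_poly add_divide_distrib)
  qed
next
  case inv_lead
  show ?case using line_poly_const[of 1] by (simp add: perturbed_power_monic)
qed (simp_all add: line_poly_const line_poly_add line_poly_mult)

text \<open>Moving a fixed point to 0 and scaling by an \<open>m\<close>-th root of the leading
  coefficient gives a monic multiple of \<open>z\<close>; any such polynomial belongs to the
  family.\<close>

lemma conjugate_perturbed_power:
  assumes "degree f = Suc m" "m \<ge> 1"
  shows "\<exists>c. conjugate f (perturbed_power m c)"
proof -
  define a where "a = lead_coeff f"
  have a0: "a \<noteq> 0" unfolding a_def leading_coeff_0_iff using assms(1) by auto
  have "degree (f - [:0, 1:]) = Suc m"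
    using assms by (subst diff_conv_add_uminus, subst degree_add_eq_left) auto
  then obtain p where "poly (f - [:0, 1:]) p = 0"
    using alg_closed_imp_poly_has_root[of "f - [:0, 1:]"] by auto
  then have p: "poly f p = p" by simp
  obtain \<alpha> where pow: "\<alpha> ^ m = a" using nth_root_exists[of m a] assms(2) by auto
  have \<alpha>0: "\<alpha> \<noteq> 0" using pow a0 assms(2) by auto
  define \<beta> where "\<beta> = - \<alpha> * p"
  define g where "g = aff_conj \<alpha> \<beta> f"
  have "poly g (\<alpha> * t + \<beta>) = \<alpha> * poly f t + \<beta>" for t
    using \<alpha>0 by (simp add: g_def aff_conj_def poly_pcompose field_simps)
  then interpret conjugation f g \<alpha> \<beta> using \<alpha>0 by unfold_locales
  have cg: "conjugate f g" unfolding conjugate_def using \<alpha>0 conj by blast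
  have dg: "degree g = Suc m" using degree_eq assms by simp
  have "coeff (pcompose g [:\<beta>, \<alpha>:]) (Suc m) = \<alpha> * a"
    unfolding pcompose_eq using assms by (simp add: a_def)
  moreover have "lead_coeff (pcompose g [:\<beta>, \<alpha>:]) = lead_coeff g * \<alpha> ^ Suc m"
    using \<alpha>0 dg lead_coeff_comp[of "[:\<beta>, \<alpha>:]" g] by simp
  moreover have "degree (pcompose g [:\<beta>, \<alpha>:]) = Suc m" using \<alpha>0 dg by (simp add: degree_pcompose)
  ultimately have "\<alpha> * a = lead_coeff g * \<alpha> ^ Suc m" by (simp only:)
  then have "lead_coeff g * (\<alpha> * a) = \<alpha> * a" by (simp only: power_Suc pow)
  then have lg: "coeff g (Suc m) = 1" using \<alpha>0 a0 dg by simp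
  have "poly g 0 = 0" using conj[of p] p by (simp add: \<beta>_def)
  then have g0: "coeff g 0 = 0" by (simp add: poly_0_coeff_0)
  \<comment> \<open>Inverts the division by \<open>k - m\<close> in \<open>quotient_poly\<close>;
    only the values at \<open>k < m\<close> enter.\<close>
  define c where "c k = (of_nat k - of_nat m) * coeff g (Suc k)" for k
  have "g = perturbed_power m c"
  proof (rule poly_eqI)
    fix i
    show "coeff g i = coeff (perturbed_power m c) i"
    proof (cases i)
      case 0
      then show ?thesis using g0 by (simp add: perturbed_power_def)
    next
      case (Suc j)
      then show ?thesis using lg dg
        by (cases "j < m"; cases "j = m") (simp_all add: perturbed_power_def coeff_quotient_poly c_def coeff_eq_0)
    qed
  qed
  then show ?thesis using cg by blast
qed

definition from_nonzero :: "nat \<Rightarrow> (nat \<Rightarrow> complex) \<Rightarrow> complex poly" where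
  "from_nonzero m w = [:0, 1:] * (1 + (\<Prod>i<m. [:- w i, 1:]))"

lemma poly_from_nonzero: "poly (from_nonzero m w) t = t * (1 + (\<Prod>i<m. t - w i))"
  by (simp add: from_nonzero_def poly_prod)

lemma pderiv_from_nonzero:
  assumes "i < m"
  shows "poly (pderiv (from_nonzero m w)) (w i) = nonzero_multiplier m w i"
proof -
  have "poly (\<Prod>i<m. [:- w i, 1:]) (w i) = 0" using assms by (auto simp: poly_prod prod_zero_iff)
  moreover have "poly (pderiv (\<Prod>i<m. [:- w i, 1:])) (w i) = (\<Prod>j\<in>{..<m} - {i}. w i - w j)"
    using assms by (intro poly_pderiv_prod_linear) auto
  moreover have "pderiv ([:0, 1:] * (1 + P)) = [:0, 1:] * pderiv P + (1 + P)" for P :: "complex poly"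
    by (simp only: pderiv_mult pderiv_add) (simp add: pderiv_pCons)
  ultimately show ?thesis by (simp add: from_nonzero_def nonzero_multiplier_def)
qed

text \<open>The fixed point 0 of \<open>f\<close> is paired with a fixed point \<open>b\<close> of
  \<open>g\<close> of the same multiplier. Once \<open>b\<close> is moved to 0 and \<open>g\<close>
  is made monic, the remaining fixed points are paired by
  \<open>image_mset_eq_lists\<close>.\<close>

lemma matched_nonzero_fixed_points:
  assumes f: "degree f = Suc m" "coeff f (Suc m) = 1" "poly f 0 = 0" and m: "m \<ge> 1"
    and g: "degree g = Suc m" and eq: "fixed_multipliers f = fixed_multipliers g"
  shows "\<exists>z w. f = from_nonzero m z \<and> conjugate g (from_nonzero m w) \<and>
    (\<forall>i<m. nonzero_multiplier m z i = nonzero_multiplier m w i)"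
proof -
  have f0: "f - [:0, 1:] \<noteq> 0" using iterate_minus_X_nonzero[of f 1] iterate_1[of f] f m by simp
  have g0: "g - [:0, 1:] \<noteq> 0" using iterate_minus_X_nonzero[of g 1] iterate_1[of g] g m by simp
  have "0 \<in># proots (f - [:0, 1:])" using f0 f(3) by simp
  then obtain A where A: "proots (f - [:0, 1:]) = add_mset 0 A" by (metis insert_DiffM)
  have "poly (pderiv f) 0 \<in># fixed_multipliers f" unfolding fixed_multipliers_def A by simp
  then have "poly (pderiv f) 0 \<in># fixed_multipliers g" unfolding eq .
  then obtain b where b: "b \<in># proots (g - [:0, 1:])" "poly (pderiv g) b = poly (pderiv f) 0"
    unfolding fixed_multipliers_def by auto
  then obtain B where B: "proots (g - [:0, 1:]) = add_mset b B" by (metis insert_DiffM)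
  have "image_mset (poly (pderiv f)) A = image_mset (poly (pderiv g)) B"
    using eq b(2) unfolding fixed_multipliers_def A B by simp
  then obtain zs ws where l: "mset zs = A" "mset ws = B" "map (poly (pderiv f)) zs = map (poly (pderiv g)) ws"
    using image_mset_eq_lists by blast
  have F: "length (0 # zs) = Suc m" "f = from_fixed (Suc m) 1 (\<lambda>i. (0 # zs) ! i)"
    using from_fixed_of_list[of f "0 # zs"] A l(1) f m by auto
  have G: "length (b # ws) = Suc m" "g = from_fixed (Suc m) (lead_coeff g) (\<lambda>i. (b # ws) ! i)"
    using from_fixed_of_list[of g "b # ws"] B l(2) g m by auto
  define a where "a = lead_coeff g"
  have a0: "a \<noteq> 0" unfolding a_def leading_coeff_0_iff using g by auto
  obtain \<alpha> where \<alpha>: "\<alpha> ^ m = a" using nth_root_exists[of m a] m by auto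
  have \<alpha>0: "\<alpha> \<noteq> 0" using \<alpha> a0 m by auto
  define z where "z i = zs ! i" for i
  define w where "w i = \<alpha> * (ws ! i - b)" for i
  have fz: "f = from_nonzero m z"
  proof (rule complex_poly_eqI)
    fix t
    have "poly f t = t + (\<Prod>i<Suc m. t - (0 # zs) ! i)" by (subst F(2)) (simp only: poly_from_fixed mult_1)
    also have "\<dots> = poly (from_nonzero m z) t"
      unfolding prod.lessThan_Suc_shift by (simp add: poly_from_nonzero z_def algebra_simps)
    finally show "poly f t = poly (from_nonzero m z) t" .
  qed
  have h: "poly (from_nonzero m w) (\<alpha> * t + - \<alpha> * b) = \<alpha> * poly g t + - \<alpha> * b" for t
  proof -
    have "poly g t = t + a * (\<Prod>i<Suc m. t - (b # ws) ! i)"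
      by (subst G(2)) (simp only: poly_from_fixed a_def)
    then have gt: "poly g t = t + a * ((t - b) * (\<Prod>i<m. t - ws ! i))"
      unfolding prod.lessThan_Suc_shift by simp
    have "(\<Prod>i<m. \<alpha> * t + - \<alpha> * b - w i) = (\<Prod>i<m. \<alpha> * (t - ws ! i))"
      by (rule prod.cong) (simp_all add: w_def algebra_simps)
    then have "(\<Prod>i<m. \<alpha> * t + - \<alpha> * b - w i) = a * (\<Prod>i<m. t - ws ! i)"
      using \<alpha> by (simp add: prod.distrib)
    then show ?thesis unfolding poly_from_nonzero gt by (simp only:) (simp add: algebra_simps)
  qed
  interpret conjugation g "from_nonzero m w" \<alpha> "- \<alpha> * b" by unfold_locales (use \<alpha>0 h in auto)
  have "nonzero_multiplier m z i = nonzero_multiplier m w i" if i: "i < m" for i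
  proof -
    have "nonzero_multiplier m z i = poly (pderiv f) (zs ! i)"
      using pderiv_from_nonzero[OF i, of z] fz by (simp add: z_def)
    also have "\<dots> = poly (pderiv g) (ws ! i)" using l(3) i F(1) G(1) by (metis nth_map length_Cons Suc_inject)
    also have "\<dots> = poly (pderiv (from_nonzero m w)) (w i)"
      using pderiv_eq[of "ws ! i"] by (simp add: w_def algebra_simps)
    finally show ?thesis using pderiv_from_nonzero[OF i, of w] by simp
  qed
  moreover have "conjugate g (from_nonzero m w)" unfolding conjugate_def using \<alpha>0 h by blast
  ultimately show ?thesis using fz by blast
qed

text \<open>The modulus of \<open>p\<close> at \<open>\<eta>\<close> is the product of the distances
  to its roots, hence at least the \<open>D\<close>-th power of the smallest one.\<close>

lemma monic_root_near:
  fixes p :: "complex poly"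
  assumes "lead_coeff p = 1" "degree p = D" "D \<ge> 1"
  shows "\<exists>x. poly p x = 0 \<and> cmod (\<eta> - x) ^ D \<le> cmod (poly p \<eta>)"
proof -
  obtain r where r: "smult (lead_coeff p) (\<Prod>i<degree p. [:- r i, 1:]) = p" by (rule complex_poly_decompose')
  then have P: "poly p t = (\<Prod>i<D. t - r i)" for t
    using assms arg_cong[OF r, of "\<lambda>q. poly q t"] by (simp add: poly_prod)
  have "finite {..<D}" "{..<D} \<noteq> {}" using assms(3) by (auto simp: lessThan_empty_iff)
  then obtain i where i: "i < D" "\<And>j. j < D \<Longrightarrow> cmod (\<eta> - r i) \<le> cmod (\<eta> - r j)"
    using ex_min_if_finite[of "(\<lambda>j. cmod (\<eta> - r j)) ` {..<D}"] by (force simp: not_less)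
  have "(\<Prod>j<D. cmod (\<eta> - r i)) \<le> (\<Prod>j<D. cmod (\<eta> - r j))" by (rule prod_mono) (use i in auto)
  then have "cmod (\<eta> - r i) ^ D \<le> cmod (poly p \<eta>)" unfolding P by (simp add: prod_norm)
  moreover have "poly p (r i) = 0" unfolding P using i(1) by (auto simp: prod_zero_iff)
  ultimately show ?thesis by blast
qed

lemma monic_roots_converge:
  fixes p :: "nat \<Rightarrow> complex poly"
  assumes "\<And>n. lead_coeff (p n) = 1" "\<And>n. degree (p n) = D" "D \<ge> 1" "(\<lambda>n. poly (p n) \<eta>) \<longlonglongrightarrow> 0"
  shows "\<exists>x. (\<forall>n. poly (p n) (x n) = 0) \<and> x \<longlonglongrightarrow> \<eta>"
proof -
  obtain x where x: "\<And>n. poly (p n) (x n) = 0" "\<And>n. cmod (\<eta> - x n) ^ D \<le> cmod (poly (p n) \<eta>)"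
    using monic_root_near[OF assms(1,2,3), of _ \<eta>] by metis
  have "(\<lambda>n. cmod (\<eta> - x n) ^ D) \<longlonglongrightarrow> 0"
    by (rule tendsto_sandwich[of "\<lambda>n. 0" _ _ "\<lambda>n. cmod (poly (p n) \<eta>)"])
       (use x(2) tendsto_norm_zero[OF assms(4)] in auto)
  then have "(\<lambda>n. root D (cmod (\<eta> - x n) ^ D)) \<longlonglongrightarrow> root D 0" by (rule tendsto_real_root)
  then have "(\<lambda>n. cmod (\<eta> - x n)) \<longlonglongrightarrow> 0" using assms(3) by (simp add: real_root_power_cancel)
  then have "(\<lambda>n. \<eta> - x n) \<longlonglongrightarrow> 0" by (rule tendsto_norm_zero_cancel)
  then have "(\<lambda>n. \<eta> - (\<eta> - x n)) \<longlonglongrightarrow> \<eta> - 0" by (intro tendsto_intros)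
  then show ?thesis using x(1) by auto
qed

text \<open>On the cycle \<open>R\<close> takes the values \<open>y / x\<close> and
  \<open>x / y\<close>, of product 1, and \<open>f' = (m + 1) R + E\<close>. So the constant
  \<open>(m + 1)^2\<close> splits off exactly, and the remainder involves \<open>E\<close>, which is
  small near the power map.\<close>

lemma cycle2_identity:
  fixes R :: "complex poly" and m :: nat
  defines "f \<equiv> [:0, 1:] * R" and "E \<equiv> [:0, 1:] * pderiv R - smult (of_nat m) R"
  assumes "poly f (poly f x) = x" "x \<noteq> 0"
  shows "poly R x * poly R (poly f x) = 1"
    "poly (pderiv f) x * poly (pderiv f) (poly f x) = (of_nat (Suc m))\<^sup>2 +
       of_nat (Suc m) * (poly E x * poly R (poly f x) + poly E (poly f x) * poly R x) +
       poly E x * poly E (poly f x)"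
proof -
  define y where "y = poly f x"
  have yx: "y = x * poly R x" "x = y * poly R y" using assms(3) by (simp_all add: y_def f_def)
  then have "x * (poly R x * poly R y) = x * 1" by (metis mult.assoc mult.right_neutral)
  then have RR: "poly R x * poly R y = 1" using assms(4) by simp
  have "pderiv f = [:0, 1:] * pderiv R + R"
    unfolding f_def by (simp only: pderiv_mult) (simp add: pderiv_pCons)
  then have d: "poly (pderiv f) t = of_nat (Suc m) * poly R t + poly E t" for t
    by (simp add: E_def algebra_simps)
  show "poly R x * poly R (poly f x) = 1" using RR by (simp add: y_def)
  have "poly (pderiv f) x * poly (pderiv f) y =
      (of_nat (Suc m))\<^sup>2 * (poly R x * poly R y) +
       of_nat (Suc m) * (poly E x * poly R y + poly E y * poly R x) + poly E x * poly E y"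
    unfolding d by (simp add: power2_eq_square algebra_simps del: of_nat_Suc)
  then show "poly (pderiv f) x * poly (pderiv f) (poly f x) = (of_nat (Suc m))\<^sup>2 +
       of_nat (Suc m) * (poly E x * poly R (poly f x) + poly E (poly f x) * poly R x) +
       poly E x * poly E (poly f x)" using RR by (simp add: y_def)
qed

text \<open>Beyond the radius \<open>B + 3\<close> all factors have modulus at least 3, so the
  quotient by \<open>t\<close> has modulus at least 3 - 1 = 2. Moduli then double at every step and
  no such point is periodic.\<close>

lemma cycle2_point_bound:
  assumes "\<And>i. i < m \<Longrightarrow> cmod (w i) \<le> B" "B \<ge> 0" "m \<ge> 1"
    and "poly (from_nonzero m w) (poly (from_nonzero m w) y) = y"
  shows "cmod y \<le> B + 3"
proof (rule ccontr)
  assume "\<not> cmod y \<le> B + 3"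
  then have y: "cmod y > B + 3" by simp
  have grow: "cmod (poly (from_nonzero m w) t) \<ge> 2 * cmod t" if t: "cmod t > B + 3" for t
  proof -
    have "3 \<le> cmod (t - w i)" if "i < m" for i
      using assms(1)[OF that] t norm_triangle_ineq2[of t "w i"] by linarith
    then have "(\<Prod>i<m. 3) \<le> (\<Prod>i<m. cmod (t - w i))" by (intro prod_mono) auto
    moreover have "(3::real) ^ 1 \<le> 3 ^ m" by (rule power_increasing) (use assms(3) in auto)
    ultimately have "3 \<le> cmod (\<Prod>i<m. t - w i)" by (simp add: prod_norm)
    then have "2 \<le> cmod (1 + (\<Prod>i<m. t - w i))"
      using norm_diff_ineq[of "\<Prod>i<m. t - w i" 1] by (simp add: add.commute)
    then have "cmod t * 2 \<le> cmod t * cmod (1 + (\<Prod>i<m. t - w i))" by (intro mult_left_mono) auto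
    then show ?thesis by (simp add: poly_from_nonzero norm_mult mult.commute)
  qed
  have 1: "cmod (poly (from_nonzero m w) y) \<ge> 2 * cmod y" by (rule grow[OF y])
  then have "cmod (poly (from_nonzero m w) y) > B + 3" using y assms(2) by linarith
  from grow[OF this] show False using 1 y assms by simp
qed


section \<open>Estimates and limits for small perturbations\<close>

lemma poly_quotient_poly_scaled:
  "poly (quotient_poly m (\<lambda>k. \<epsilon> * c k)) t = t ^ m + \<epsilon> * (\<Sum>k<m. c k / (of_nat k - of_nat m) * t ^ k)"
  by (simp add: quotient_poly_def poly_sum poly_monom sum_distrib_left mult_ac)

lemma tendsto_quotient_poly:
  assumes "\<epsilon> \<longlonglongrightarrow> 0" "t \<longlonglongrightarrow> t0"
  shows "(\<lambda>n. poly (quotient_poly m (\<lambda>k. \<epsilon> n * c k)) (t n)) \<longlonglongrightarrow> t0 ^ m"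
proof -
  have "(\<lambda>n. t n ^ m + \<epsilon> n * (\<Sum>k<m. c k / (of_nat k - of_nat m) * t n ^ k)) \<longlonglongrightarrow>
      t0 ^ m + 0 * (\<Sum>k<m. c k / (of_nat k - of_nat m) * t0 ^ k)"
    by (intro tendsto_add tendsto_mult tendsto_power tendsto_sum tendsto_const assms)
  then show ?thesis by (simp add: poly_quotient_poly_scaled)
qed

text \<open>Cauchy's bound for the roots of \<open>quotient_poly - 1\<close>, uniform in
  \<open>\<epsilon>\<close>: the denominators \<open>k - m\<close> have modulus at least 1.\<close>

lemma unit_level_bound:
  assumes m: "m \<ge> 1" and \<epsilon>: "cmod \<epsilon> \<le> 1" and z: "poly (quotient_poly m (\<lambda>k. \<epsilon> * c k)) z = 1"
  shows "cmod z \<le> 1 + (\<Sum>k<m. cmod (c k))"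
proof (cases "cmod z \<le> 1")
  case True
  then show ?thesis by (simp add: sum_nonneg add_increasing2)
next
  case False
  then have z1: "cmod z \<ge> 1" by simp
  have p: "cmod z ^ k \<le> cmod z ^ (m - 1)" if "k < m" for k
    by (rule power_increasing) (use that z1 in auto)
  have c: "cmod (c k / (of_nat k - of_nat m)) \<le> cmod (c k)" if "k < m" for k
  proof -
    have "(of_nat k - of_nat m :: complex) = - of_nat (m - k)" using that by (simp add: of_nat_diff)
    then have "cmod (of_nat k - of_nat m) = real (m - k)" by (simp only: norm_minus_cancel norm_of_nat)
    then show ?thesis using that by (simp add: norm_divide divide_le_eq mult_le_cancel_left1)
  qed
  have "z ^ m = 1 - \<epsilon> * (\<Sum>k<m. c k / (of_nat k - of_nat m) * z ^ k)"
    using z unfolding poly_quotient_poly_scaled by (simp add: eq_diff_eq)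
  then have "cmod (z ^ m) \<le> 1 + cmod (\<epsilon> * (\<Sum>k<m. c k / (of_nat k - of_nat m) * z ^ k))"
    using norm_triangle_ineq4[of 1 "\<epsilon> * (\<Sum>k<m. c k / (of_nat k - of_nat m) * z ^ k)"] by simp
  also have "cmod (\<epsilon> * (\<Sum>k<m. c k / (of_nat k - of_nat m) * z ^ k)) =
      cmod \<epsilon> * cmod (\<Sum>k<m. c k / (of_nat k - of_nat m) * z ^ k)" by (rule norm_mult)
  also have "\<dots> \<le> 1 * (\<Sum>k<m. cmod (c k / (of_nat k - of_nat m) * z ^ k))"
    by (rule mult_mono[OF \<epsilon> norm_sum]) auto
  also have "\<dots> \<le> (\<Sum>k<m. cmod (c k) * cmod z ^ (m - 1))"
    unfolding mult_1
  proof (rule sum_mono)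
    fix k assume "k \<in> {..<m}"
    then have "cmod (c k / (of_nat k - of_nat m)) * cmod z ^ k \<le> cmod (c k) * cmod z ^ (m - 1)"
      by (intro mult_mono c p) auto
    then show "cmod (c k / (of_nat k - of_nat m) * z ^ k) \<le> cmod (c k) * cmod z ^ (m - 1)"
      by (simp only: norm_mult norm_power)
  qed
  also have "1 + \<dots> \<le> cmod z ^ (m - 1) + (\<Sum>k<m. cmod (c k) * cmod z ^ (m - 1))"
    using z1 by (simp add: one_le_power)
  also have "\<dots> = (1 + (\<Sum>k<m. cmod (c k))) * cmod z ^ (m - 1)"
    by (simp add: sum_distrib_right algebra_simps)
  finally have "cmod (z ^ m) \<le> (1 + (\<Sum>k<m. cmod (c k))) * cmod z ^ (m - 1)" by simp
  moreover have "cmod (z ^ m) = cmod z * cmod z ^ (m - 1)"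
    using m by (cases m) (simp_all add: norm_mult norm_power)
  ultimately have "cmod z * cmod z ^ (m - 1) \<le> (1 + (\<Sum>k<m. cmod (c k))) * cmod z ^ (m - 1)"
    by (simp only:)
  moreover have "cmod z ^ (m - 1) > 0" using z1 by (intro zero_less_power) linarith
  ultimately show ?thesis by (simp add: mult_le_cancel_right)
qed

lemma perturbed_power_fixed_multiplier:
  assumes "poly (quotient_poly m c) z = 1"
  shows "poly (pderiv (perturbed_power m c)) z = of_nat (Suc m) + poly (error_poly m c) z"
proof -
  have "pderiv (perturbed_power m c) = [:0, 1:] * pderiv (quotient_poly m c) + quotient_poly m c"
    unfolding perturbed_power_def by (simp only: pderiv_mult) (simp add: pderiv_pCons)
  then show ?thesis using assms unfolding error_poly_eq[symmetric] by (simp add: algebra_simps)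
qed

lemma error_poly_bound:
  assumes "cmod z \<le> K" "K \<ge> 0"
  shows "cmod (poly (error_poly m c) z) \<le> (\<Sum>k<m. cmod (c k) * K ^ k)"
proof -
  have "cmod (poly (error_poly m c) z) \<le> (\<Sum>k<m. cmod (c k * z ^ k))"
    by (simp add: error_poly_def poly_sum poly_monom norm_sum)
  also have "\<dots> \<le> (\<Sum>k<m. cmod (c k) * K ^ k)"
    by (rule sum_mono) (use assms in \<open>auto simp: norm_mult norm_power intro!: mult_left_mono power_mono\<close>)
  finally show ?thesis .
qed

lemma pderiv_perturbed_power:
  "pderiv (perturbed_power m c) = [:0, 1:] * pderiv (quotient_poly m c) + quotient_poly m c"
  unfolding perturbed_power_def by (simp only: pderiv_mult) (simp add: pderiv_pCons)

lemma norm_power2_eq_1: "(z :: complex) ^ 2 = 1 \<Longrightarrow> cmod z = 1"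
  by (rule norm_1_of_power[of z 2]) auto

text \<open>The multiplier at 0 is near 0 and those at the nonzero fixed points are near
  \<open>m + 1\<close>, at least 2; none lies on the unit circle. \<open>K\<close> bounds the error
  polynomial on a disc that contains the nonzero fixed points, and \<open>\<delta>\<close> keeps
  \<open>\<epsilon>\<close>, \<open>\<epsilon> K\<close> and \<open>\<epsilon> S\<close>
  small.\<close>

lemma perturbed_power_not_degenerate:
  assumes m: "m \<ge> 1"
  shows "\<exists>\<delta>>0. \<forall>\<epsilon>. cmod \<epsilon> < \<delta> \<longrightarrow> \<not> degenerate (perturbed_power m (\<lambda>k. \<epsilon> * c k))"
proof -
  define S where "S = (\<Sum>k<m. cmod (c k))"
  define K where "K = (\<Sum>k<m. cmod (c k) * (1 + S) ^ k)"
  have S0: "S \<ge> 0" and K0: "K \<ge> 0" unfolding S_def K_def by (intro sum_nonneg; simp add: sum_nonneg)+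
  define \<delta> where "\<delta> = 1 / (2 + K + S)"
  have "\<not> degenerate (perturbed_power m (\<lambda>k. \<epsilon> * c k))" if \<epsilon>: "cmod \<epsilon> < \<delta>" for \<epsilon>
  proof
    have \<epsilon>': "cmod \<epsilon> * (2 + K + S) < 1" using \<epsilon> S0 K0 by (simp add: \<delta>_def field_simps)
    then have small: "cmod \<epsilon> * 2 + cmod \<epsilon> * K + cmod \<epsilon> * S < 1" by (simp add: algebra_simps)
    moreover have "0 \<le> cmod \<epsilon> * K" "0 \<le> cmod \<epsilon> * S" using S0 K0 by simp_all
    ultimately have eK: "cmod \<epsilon> * K < 1" and eS: "cmod \<epsilon> * S < 1" and e1: "cmod \<epsilon> \<le> 1"
      using norm_ge_zero[of \<epsilon>] by linarith+
    let ?R = "quotient_poly m (\<lambda>k. \<epsilon> * c k)"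
    assume "degenerate (perturbed_power m (\<lambda>k. \<epsilon> * c k))"
    then obtain z where z: "poly (perturbed_power m (\<lambda>k. \<epsilon> * c k)) z = z"
      "poly (pderiv (perturbed_power m (\<lambda>k. \<epsilon> * c k))) z ^ 2 = 1" unfolding degenerate_def by blast
    note n1 = norm_power2_eq_1[OF z(2)]
    have zR: "z * poly ?R z = z" using z(1) by (simp add: perturbed_power_def)
    show False
    proof (cases "z = 0")
      case True
      have "coeff ?R 0 = \<epsilon> * c 0 / (- of_nat m)" using m by (simp add: coeff_quotient_poly)
      then have "cmod (poly ?R 0) = cmod \<epsilon> * cmod (c 0) / real m"
        by (simp add: poly_0_coeff_0 norm_divide norm_mult)
      also have "\<dots> \<le> cmod \<epsilon> * cmod (c 0) / 1" by (rule divide_left_mono) (use m in auto)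
      also have "\<dots> = cmod \<epsilon> * cmod (c 0)" by simp
      also have "\<dots> \<le> cmod \<epsilon> * S"
        unfolding S_def using m by (intro mult_left_mono member_le_sum) auto
      finally have "cmod (poly ?R 0) < 1" using eS by linarith
      then show False using n1 True by (simp add: pderiv_perturbed_power)
    next
      case False
      then have R1: "poly ?R z = 1" using zR by simp
      have "cmod z \<le> 1 + S" unfolding S_def by (rule unit_level_bound[OF m e1 R1])
      then have "cmod (poly (error_poly m c) z) \<le> K" unfolding K_def using S0 by (intro error_poly_bound) auto
      then have "cmod (\<epsilon> * poly (error_poly m c) z) \<le> cmod \<epsilon> * K" by (simp add: norm_mult mult_left_mono)
      then have "cmod (\<epsilon> * poly (error_poly m c) z) < 1" using eK by linarith
      moreover have "poly (pderiv (perturbed_power m (\<lambda>k. \<epsilon> * c k))) z = of_nat (Suc m) + \<epsilon> * poly (error_poly m c) z"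
        using perturbed_power_fixed_multiplier[OF R1] by (simp add: error_poly_scale)
      moreover have "cmod (of_nat (Suc m) :: complex) \<ge> 2" using m by (simp only: norm_of_nat)
      ultimately show False
        using n1 norm_diff_ineq[of "of_nat (Suc m)" "\<epsilon> * poly (error_poly m c) z"] by simp
    qed
  qed
  moreover have "\<delta> > 0" using S0 K0 by (simp add: \<delta>_def)
  ultimately show ?thesis by blast
qed

lemma nonzero_multiplier_rotate:
  assumes "\<rho> ^ m = 1" "i < m"
  shows "nonzero_multiplier m (\<lambda>i. \<rho> * w i) i = nonzero_multiplier m w i"
proof -
  have "(\<Prod>j\<in>{..<m} - {i}. \<rho> * w i - \<rho> * w j) = \<rho> ^ (m - 1) * (\<Prod>j\<in>{..<m} - {i}. w i - w j)"
    using assms(2) by (simp add: right_diff_distrib[symmetric] prod.distrib card_Diff_singleton)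
  moreover have "\<rho> * \<rho> ^ (m - 1) = 1" using assms by (metis power_eq_if less_nat_zero_code)
  ultimately show ?thesis by (simp add: nonzero_multiplier_def)
qed

lemma conjugate_rotate:
  assumes "\<rho> ^ m = 1" "m \<ge> 1"
  shows "conjugate (from_nonzero m (\<lambda>i. \<rho> * w i)) (from_nonzero m w)"
proof -
  have "\<rho> \<noteq> 0" using assms by (auto simp: power_0_left)
  have "poly (from_nonzero m (\<lambda>i. \<rho> * w i)) (\<rho> * t + 0) = \<rho> * poly (from_nonzero m w) t + 0" for t
  proof -
    have "(\<Prod>i<m. \<rho> * t - \<rho> * w i) = \<rho> ^ m * (\<Prod>i<m. t - w i)"
      by (simp add: right_diff_distrib[symmetric] prod.distrib)
    then show ?thesis using assms(1) by (simp add: poly_from_nonzero)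
  qed
  then have "conjugate (from_nonzero m w) (from_nonzero m (\<lambda>i. \<rho> * w i))"
    unfolding conjugate_def using \<open>\<rho> \<noteq> 0\<close> by blast
  then show ?thesis by (rule conjugate_sym)
qed

lemma tendsto_perturbed_power:
  assumes "\<epsilon> \<longlonglongrightarrow> 0" "t \<longlonglongrightarrow> t0"
  shows "(\<lambda>n. poly (perturbed_power m (\<lambda>k. \<epsilon> n * c k)) (t n)) \<longlonglongrightarrow> t0 ^ Suc m"
  using tendsto_mult[OF assms(2) tendsto_quotient_poly[OF assms]] by (simp add: perturbed_power_def)

lemma iterate_2_minus_X_monic:
  assumes "degree f = d" "d \<ge> 2" "lead_coeff f = 1"
  shows "degree (iterate f 2 - [:0, 1:]) = d\<^sup>2" "lead_coeff (iterate f 2 - [:0, 1:]) = 1"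
proof -
  have d: "degree (iterate f 2) = d\<^sup>2" using degree_iterate[of f 2] assms(1) by simp
  have l: "lead_coeff (iterate f 2) = 1"
    using assms lead_coeff_comp[of f f] by (simp add: iterate_2)
  have d1: "1 < d\<^sup>2" using assms(2) by (simp add: power2_eq_square) (metis One_nat_def Suc_1 Suc_le_eq less_1_mult)
  show deg: "degree (iterate f 2 - [:0, 1:]) = d\<^sup>2"
    using d d1 by (subst diff_conv_add_uminus, subst degree_add_eq_left) auto
  have "coeff [:0, 1:] (d\<^sup>2) = (0 :: complex)" using d1 by (intro coeff_eq_0) simp
  then show "lead_coeff (iterate f 2 - [:0, 1:]) = 1"
    unfolding deg using l d by simp
qed

lemma tendsto_lagrange_basis:
  assumes "inj_on u {..<m}" "\<And>i. i < m \<Longrightarrow> (\<lambda>n. w n i) \<longlonglongrightarrow> u i" "t \<longlonglongrightarrow> t0" "i < m"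
  shows "(\<lambda>n. poly (lagrange_basis {..<m} (w n) i) (t n)) \<longlonglongrightarrow> poly (lagrange_basis {..<m} u i) t0"
  unfolding poly_lagrange_basis
proof (intro tendsto_prod tendsto_divide tendsto_diff assms(2,3,4))
  fix j assume j: "j \<in> {..<m} - {i}"
  then show "j < m" by simp
  show "u i - u j \<noteq> 0" using assms(1,4) j by (auto dest: inj_onD)
qed auto


section \<open>Generic polynomials\<close>

text \<open>\<open>z n\<close> and \<open>w n\<close> are the nonzero fixed points of
  \<open>f\<close> and \<open>g\<close>, with limits \<open>v\<close> and \<open>u\<close> along a
  subsequence. A 2-cycle of \<open>f\<close> is followed to the cycle of \<open>\<eta>\<close>,
  together with a 2-cycle of \<open>g\<close> of the same multiplier. Equality of the two
  multipliers, divided by \<open>\<epsilon>\<close>, passes to the limit.\<close>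

lemma limit_configuration:
  fixes \<epsilon> :: "nat \<Rightarrow> complex"
  assumes m: "m \<ge> 1" and \<epsilon>: "\<epsilon> \<longlonglongrightarrow> 0" "\<And>n. \<epsilon> n \<noteq> 0" "\<And>n. cmod (\<epsilon> n) \<le> 1"
    and F: "\<And>n. perturbed_power m (\<lambda>k. \<epsilon> n * c k) = from_nonzero m (z n)"
    and mult: "\<And>n i. i < m \<Longrightarrow> nonzero_multiplier m (z n) i = nonzero_multiplier m (w n) i"
    and cyc: "\<And>n. cycle2_multipliers (from_nonzero m (z n)) \<subseteq> cycle2_multipliers (from_nonzero m (w n))"
    and nconj: "\<And>n. \<not> conjugate (from_nonzero m (z n)) (from_nonzero m (w n))"
    and \<eta>: "\<eta> ^ m \<noteq> 1" "\<eta> ^ (m * (m + 2)) = 1"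
  shows "\<exists>y u v. y ^ (m * (m + 2)) = 1 \<and> inj_on u {..<m} \<and> (\<forall>i<m. u i ^ m = 1) \<and>
    inj_on v {..<m} \<and> (\<forall>i<m. v i ^ m = 1) \<and> \<not> (\<exists>\<rho>. \<rho> ^ m = 1 \<and> (\<forall>i<m. v i = \<rho> * u i)) \<and>
    cycle_form m \<eta> (error_poly m c) =
      cycle_form m y (\<Sum>i<m. smult (poly (error_poly m c) (v i)) (lagrange_basis {..<m} u i))"
proof -
  define e where "e = error_poly m c"
  define d :: complex where "d = of_nat (Suc m)"
  define K where "K = 1 + (\<Sum>k<m. cmod (c k))"
  have K0: "K \<ge> 0" unfolding K_def by (simp add: sum_nonneg)
  have Qz: "quotient_poly m (\<lambda>k. \<epsilon> n * c k) = 1 + (\<Prod>i<m. [:- z n i, 1:])" for n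
  proof -
    have "[:0, 1:] * quotient_poly m (\<lambda>k. \<epsilon> n * c k) = [:0, 1:] * (1 + (\<Prod>i<m. [:- z n i, 1:]))"
      using F[of n] unfolding perturbed_power_def from_nonzero_def .
    then show ?thesis by (metis mult_left_cancel pCons_eq_0_iff zero_neq_one)
  qed
  have Q1: "poly (quotient_poly m (\<lambda>k. \<epsilon> n * c k)) (z n i) = 1" if "i < m" for n i
    unfolding Qz using that by (auto simp: poly_prod prod_zero_iff)
  have zb: "cmod (z n i) \<le> K" if "i < m" for n i
    unfolding K_def by (rule unit_level_bound[OF m \<epsilon>(3) Q1[OF that]])
  have lam: "nonzero_multiplier m (z n) i = d + \<epsilon> n * poly e (z n i)" if i: "i < m" for n i
    using pderiv_from_nonzero[OF i, of "z n"] perturbed_power_fixed_multiplier[OF Q1[OF i], of n]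
    unfolding F[symmetric] error_poly_scale e_def d_def by simp
  have limz: "(\<lambda>n. nonzero_multiplier m (z n) i) \<longlonglongrightarrow> of_nat (m + 1)" if i: "i < m" for i
  proof -
    define K' where "K' = (\<Sum>k<m. cmod (c k) * K ^ k)"
    have "(\<lambda>n. \<epsilon> n * poly e (z n i)) \<longlonglongrightarrow> 0"
    proof (rule tendsto_0_le[OF \<epsilon>(1), of _ K'], intro always_eventually allI)
      fix n show "cmod (\<epsilon> n * poly e (z n i)) \<le> cmod (\<epsilon> n) * K'"
        unfolding norm_mult e_def K'_def by (intro mult_left_mono error_poly_bound zb[OF i] K0) auto
    qed
    then have "(\<lambda>n. d + \<epsilon> n * poly e (z n i)) \<longlonglongrightarrow> d + 0" by (intro tendsto_add tendsto_const)
    then show ?thesis unfolding lam[OF i] by (simp add: d_def)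
  qed
  obtain r1 v where r1: "strict_mono r1" and v: "\<forall>i<m. (\<lambda>n. z (r1 n) i) \<longlonglongrightarrow> v i"
    "inj_on v {..<m}" "\<forall>i<m. v i ^ m = 1"
    using multipliers_compactness[OF m limz] by blast
  have "(\<lambda>n. nonzero_multiplier m (w (r1 n)) i) \<longlonglongrightarrow> of_nat (m + 1)" if i: "i < m" for i
    using LIMSEQ_subseq_LIMSEQ[OF limz[OF i] r1] mult[OF i] by (simp add: comp_def)
  then obtain r2 u where r2: "strict_mono r2" and u: "\<forall>i<m. (\<lambda>n. w (r1 (r2 n)) i) \<longlonglongrightarrow> u i"
    "inj_on u {..<m}" "\<forall>i<m. u i ^ m = 1"
    using multipliers_compactness[OF m, of "\<lambda>n. w (r1 n)"] by blast
  define r where "r n = r1 (r2 n)" for n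
  have r: "strict_mono r" using r1 r2 by (simp add: strict_mono_def r_def)
  have zr: "(\<lambda>n. z (r n) i) \<longlonglongrightarrow> v i" if "i < m" for i
    using LIMSEQ_subseq_LIMSEQ[OF v(1)[rule_format, OF that] r2] by (simp add: comp_def r_def)
  have wr: "(\<lambda>n. w (r n) i) \<longlonglongrightarrow> u i" if "i < m" for i using u(1) that by (simp add: r_def)
  have \<epsilon>r: "(\<lambda>n. \<epsilon> (r n)) \<longlonglongrightarrow> 0" using LIMSEQ_subseq_LIMSEQ[OF \<epsilon>(1) r] by (simp add: comp_def)
  have limzr: "(\<lambda>n. nonzero_multiplier m (z (r n)) i) \<longlonglongrightarrow> of_nat (m + 1)" if "i < m" for i
    using LIMSEQ_subseq_LIMSEQ[OF limz[OF that] r] by (simp add: comp_def)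
  \<comment> \<open>If the limits differed by a rotation, the rotated fixed points of
    \<open>g\<close> and those of \<open>f\<close> would have the same limit and the same
    multipliers. They would coincide for some \<open>n\<close>, and \<open>f\<close> and
    \<open>g\<close> would be conjugate.\<close>
  have nrot: "\<not> (\<exists>\<rho>. \<rho> ^ m = 1 \<and> (\<forall>i<m. v i = \<rho> * u i))"
  proof
    assume "\<exists>\<rho>. \<rho> ^ m = 1 \<and> (\<forall>i<m. v i = \<rho> * u i)"
    then obtain \<rho> where \<rho>: "\<rho> ^ m = 1" "\<And>i. i < m \<Longrightarrow> v i = \<rho> * u i" by blast
    have "\<exists>n. \<forall>i<m. \<rho> * w (r n) i = z (r n) i"
    proof (rule multipliers_locally_injective[OF m v(2)])
      fix i assume i: "i < m"
      show "nonzero_multiplier m v i \<noteq> 1"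
        using LIMSEQ_unique[OF tendsto_nonzero_multiplier[OF zr i] limzr[OF i]] m by simp
      show "(\<lambda>n. \<rho> * w (r n) i) \<longlonglongrightarrow> v i"
        unfolding \<rho>(2)[OF i] by (intro tendsto_mult tendsto_const wr i)
      show "(\<lambda>n. z (r n) i) \<longlonglongrightarrow> v i" by (rule zr[OF i])
      show "nonzero_multiplier m (\<lambda>i. \<rho> * w (r n) i) i = nonzero_multiplier m (z (r n)) i" for n
        using nonzero_multiplier_rotate[OF \<rho>(1) i] mult[OF i] by simp
    qed
    then obtain n where n: "\<forall>i<m. \<rho> * w (r n) i = z (r n) i" by blast
    have "(\<Prod>i<m. [:- (\<rho> * w (r n) i), 1:]) = (\<Prod>i<m. [:- z (r n) i, 1:])"
      by (rule prod.cong) (use n in auto)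
    then have "from_nonzero m (\<lambda>i. \<rho> * w (r n) i) = from_nonzero m (z (r n))" by (simp add: from_nonzero_def)
    then show False using conjugate_rotate[OF \<rho>(1) m, of "w (r n)"] nconj[of "r n"] by simp
  qed
  define f where "f n = perturbed_power m (\<lambda>k. \<epsilon> (r n) * c k)" for n
  define g where "g n = from_nonzero m (w (r n))" for n
  have fz: "f n = from_nonzero m (z (r n))" for n unfolding f_def by (rule F)
  have f: "degree (f n) = Suc m" "lead_coeff (f n) = 1" for n
    using perturbed_power_monic[of m] by (simp_all add: f_def)
  have limf: "(\<lambda>n. poly (f (q n)) (t n)) \<longlonglongrightarrow> t0 ^ Suc m" if "strict_mono q" "t \<longlonglongrightarrow> t0" for q t t0
    unfolding f_def using LIMSEQ_subseq_LIMSEQ[OF \<epsilon>r that(1)] that(2)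
    by (intro tendsto_perturbed_power) (simp_all add: comp_def)
  have \<eta>2: "(\<eta> ^ Suc m) ^ Suc m = \<eta>"
  proof -
    have "(\<eta> ^ Suc m) ^ Suc m = \<eta> ^ (m * (m + 2)) * \<eta>"
      by (simp add: power_mult[symmetric] power_add[symmetric] algebra_simps)
    then show ?thesis using \<eta>(2) by simp
  qed
  have id: "strict_mono (\<lambda>n::nat. n)" by (simp add: strict_mono_def)
  have "(\<lambda>n. poly (f n) (poly (f n) \<eta>)) \<longlonglongrightarrow> \<eta>"
    using limf[OF id limf[OF id tendsto_const[of \<eta>]]] unfolding \<eta>2 .
  then have "(\<lambda>n. poly (f n) (poly (f n) \<eta>) - \<eta>) \<longlonglongrightarrow> \<eta> - \<eta>" by (intro tendsto_diff tendsto_const)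
  then have "(\<lambda>n. poly (iterate (f n) 2 - [:0, 1:]) \<eta>) \<longlonglongrightarrow> 0" by (simp add: iterate_2 poly_pcompose)
  then obtain x where x: "\<And>n. poly (iterate (f n) 2 - [:0, 1:]) (x n) = 0" "x \<longlonglongrightarrow> \<eta>"
    using monic_roots_converge[of "\<lambda>n. iterate (f n) 2 - [:0, 1:]" "(Suc m)\<^sup>2" \<eta>]
      iterate_2_minus_X_monic[OF f(1) _ f(2)] m by auto
  have x2: "poly (f n) (poly (f n) (x n)) = x n" for n
    using x(1)[of n] by (simp add: iterate_2 poly_pcompose)
  define good where "good n y \<longleftrightarrow> poly (g n) (poly (g n) y) = y \<and> poly (g n) y \<noteq> y \<and>
      poly (pderiv (f n)) (x n) * poly (pderiv (f n)) (poly (f n) (x n)) =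
      poly (pderiv (g n)) y * poly (pderiv (g n)) (poly (g n) y)" for n y
  \<comment> \<open>The default 0, for those \<open>n\<close> where \<open>x n\<close> happens to be
    fixed, keeps the sequence \<open>y\<close> total and bounded.\<close>
  have "\<exists>y. (poly (f n) (x n) \<noteq> x n \<longrightarrow> good n y) \<and> (poly (f n) (x n) = x n \<longrightarrow> y = 0)" for n
  proof (cases "poly (f n) (x n) = x n")
    case False
    then have "poly (pderiv (f n)) (x n) * poly (pderiv (f n)) (poly (f n) (x n)) \<in> cycle2_multipliers (f n)"
      unfolding cycle2_multipliers_def using x2 by blast
    then have "poly (pderiv (f n)) (x n) * poly (pderiv (f n)) (poly (f n) (x n)) \<in> cycle2_multipliers (g n)"
      using cyc[of "r n"] unfolding fz g_def by blast
    then show ?thesis using False unfolding cycle2_multipliers_def good_def by auto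
  qed simp
  then obtain y where y: "\<And>n. poly (f n) (x n) \<noteq> x n \<Longrightarrow> good n (y n)" "\<And>n. poly (f n) (x n) = x n \<Longrightarrow> y n = 0"
    by metis
  obtain b where b: "\<And>i n. i < m \<Longrightarrow> cmod (w (r n) i) \<le> b i"
  proof -
    have "\<exists>B. \<forall>n. cmod (w (r n) i) \<le> B" if "i < m" for i
      using convergent_imp_Bseq[OF convergentI[OF wr[OF that]]] unfolding Bseq_def by blast
    then show ?thesis using that by metis
  qed
  define B where "B = (\<Sum>i<m. \<bar>b i\<bar>)"
  have B0: "B \<ge> 0" unfolding B_def by (simp add: sum_nonneg)
  have wB: "cmod (w (r n) i) \<le> B" if "i < m" for n i
  proof -
    have "\<bar>b i\<bar> \<le> B" unfolding B_def by (rule member_le_sum) (use that in auto)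
    then show ?thesis using b[OF that, of n] by linarith
  qed
  have "cmod (y n) \<le> B + 3" for n
  proof (cases "poly (f n) (x n) = x n")
    case True
    then show ?thesis using y(2) B0 by simp
  next
    case False
    then have "poly (g n) (poly (g n) (y n)) = y n" using y(1) unfolding good_def by blast
    then show ?thesis unfolding g_def by (intro cycle2_point_bound[OF wB B0 m])
  qed
  then obtain q ys where q: "strict_mono q" "(\<lambda>n. y (q n)) \<longlonglongrightarrow> ys"
    using bounded_complex_convergent_subseq by blast
  define X Y where "X n = x (q n)" and "Y n = y (q n)" for n
  define Z W where "Z n = z (r (q n))" and "W n = w (r (q n))" for n
  define a where "a n = \<epsilon> (r (q n))" for n
  define X' where "X' n = poly (f (q n)) (X n)" for n
  define Y' where "Y' n = poly (g (q n)) (Y n)" for n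
  define R where "R n = quotient_poly m (\<lambda>k. a n * c k)" for n
  define S where "S n = 1 + (\<Prod>i<m. [:- W n i, 1:])" for n
  define E where "E n = [:0, 1:] * pderiv (S n) - smult (of_nat m) (S n)" for n
  \<comment> \<open>The error polynomial of \<open>g\<close>, divided by the small parameter
    \<open>a n\<close>: it interpolates at the fixed points of \<open>g\<close> the values that the
    direction \<open>e\<close> takes at those of \<open>f\<close>.\<close>
  define A where "A n t = (\<Sum>i<m. poly e (Z n i) * poly (lagrange_basis {..<m} (W n) i) t)" for n t
  define A0 where "A0 = (\<Sum>i<m. smult (poly e (v i)) (lagrange_basis {..<m} u i))"
  have X: "X \<longlonglongrightarrow> \<eta>" using LIMSEQ_subseq_LIMSEQ[OF x(2) q(1)] by (simp add: comp_def X_def[abs_def])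
  have Y: "Y \<longlonglongrightarrow> ys" using q(2) by (simp add: Y_def[abs_def])
  have Z: "(\<lambda>n. Z n i) \<longlonglongrightarrow> v i" and W: "(\<lambda>n. W n i) \<longlonglongrightarrow> u i" if "i < m" for i
    using LIMSEQ_subseq_LIMSEQ[OF zr[OF that] q(1)] LIMSEQ_subseq_LIMSEQ[OF wr[OF that] q(1)]
    by (simp_all add: comp_def Z_def W_def)
  have a: "a \<longlonglongrightarrow> 0" "\<And>n. a n \<noteq> 0"
    using LIMSEQ_subseq_LIMSEQ[OF \<epsilon>r q(1)] \<epsilon>(2) by (simp_all add: comp_def a_def[abs_def])
  have X': "X' \<longlonglongrightarrow> \<eta> ^ Suc m" using limf[OF q(1) X] by (simp add: X'_def[abs_def])
  have limR: "(\<lambda>n. poly (R n) (t n)) \<longlonglongrightarrow> t0 ^ m" if "t \<longlonglongrightarrow> t0" for t t0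
    unfolding R_def by (rule tendsto_quotient_poly[OF a(1) that])
  have limS: "(\<lambda>n. poly (S n) (t n)) \<longlonglongrightarrow> t0 ^ m" if t: "t \<longlonglongrightarrow> t0" for t t0
  proof -
    have "(\<lambda>n. 1 + (\<Prod>i<m. t n - W n i)) \<longlonglongrightarrow> 1 + (\<Prod>i<m. t0 - u i)"
      by (intro tendsto_add tendsto_const tendsto_prod tendsto_diff t W) auto
    moreover have "(\<Prod>i<m. t0 - u i) = t0 ^ m - 1"
      using arg_cong[OF prod_roots_of_unity[OF m u(2,3)], of "\<lambda>p. poly p t0"] by (simp add: poly_prod poly_monom)
    ultimately show ?thesis by (simp add: S_def poly_prod)
  qed
  have gS: "g (q n) = [:0, 1:] * S n" for n by (simp add: g_def from_nonzero_def S_def W_def)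
  have fR: "f (q n) = [:0, 1:] * R n" for n by (simp add: f_def perturbed_power_def R_def a_def)
  have ER: "[:0, 1:] * pderiv (R n) - smult (of_nat m) (R n) = smult (a n) e" for n
    unfolding R_def error_poly_eq error_poly_scale e_def ..
  have "(\<lambda>n. Y n * poly (S n) (Y n)) \<longlonglongrightarrow> ys * ys ^ m" by (intro tendsto_mult Y limS)
  then have Y': "Y' \<longlonglongrightarrow> ys ^ Suc m" by (simp add: Y'_def[abs_def] gS)
  have limA: "(\<lambda>n. A n (t n)) \<longlonglongrightarrow> poly A0 t0" if "t \<longlonglongrightarrow> t0" for t t0
  proof -
    have pe: "(\<lambda>n. poly e (Z n i)) \<longlonglongrightarrow> poly e (v i)" if "i < m" for i
      by (rule tendsto_poly) (rule Z[OF that])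
    have "(\<lambda>n. A n (t n)) \<longlonglongrightarrow> (\<Sum>i<m. poly e (v i) * poly (lagrange_basis {..<m} u i) t0)"
      unfolding A_def by (intro tendsto_sum tendsto_mult pe tendsto_lagrange_basis[OF u(2) W that]) auto
    then show ?thesis by (simp add: A0_def poly_sum)
  qed
  \<comment> \<open>The top term of \<open>E n\<close> cancels, so it has degree below
    \<open>m\<close> and is determined by its values at the fixed points of \<open>g\<close>. These
    are the multipliers minus \<open>m + 1\<close>, which are shared with \<open>f\<close>.\<close>
  have EA: "poly (E n) t = a n * A n t" if inj: "inj_on (W n) {..<m}" for n t
  proof -
    have "coeff (E n) k = (of_nat k - of_nat m) * coeff (S n) k" for k
      by (cases k) (simp_all add: E_def coeff_pderiv algebra_simps)
    moreover have "degree (S n) \<le> m"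
      unfolding S_def by (intro degree_add_le) (simp_all add: degree_prod_sum_eq)
    ultimately have "coeff (E n) k = 0" if "k \<ge> m" for k
      using that by (cases "k = m") (simp_all add: coeff_eq_0)
    then have "degree (E n) < m" using m by (metis leading_coeff_0_iff degree_0 not_le not_one_le_zero gr0I)
    then have "E n = (\<Sum>i<m. smult (poly (E n) (W n i)) (lagrange_basis {..<m} (W n) i))"
      using lagrange_interpolation[OF finite_lessThan inj, of "E n"] by simp
    also have "\<dots> = (\<Sum>i<m. smult (a n * poly e (Z n i)) (lagrange_basis {..<m} (W n) i))"
    proof (rule sum.cong[OF refl])
      fix i assume "i \<in> {..<m}"
      then have i: "i < m" by simp
      have "poly (\<Prod>i<m. [:- W n i, 1:]) (W n i) = 0" using i by (auto simp: poly_prod prod_zero_iff)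
      moreover have "poly (pderiv (\<Prod>i<m. [:- W n i, 1:])) (W n i) = (\<Prod>j\<in>{..<m} - {i}. W n i - W n j)"
        using i by (intro poly_pderiv_prod_linear) auto
      ultimately have "poly (E n) (W n i) = nonzero_multiplier m (W n) i - d"
        by (simp add: E_def S_def pderiv_add nonzero_multiplier_def d_def)
      also have "\<dots> = a n * poly e (Z n i)"
        using lam[OF i, of "r (q n)"] mult[OF i, of "r (q n)"] by (simp add: W_def Z_def a_def)
      finally show "smult (poly (E n) (W n i)) (lagrange_basis {..<m} (W n) i) =
          smult (a n * poly e (Z n i)) (lagrange_basis {..<m} (W n) i)" by simp
    qed
    finally have "poly (E n) t = poly (\<Sum>i<m. smult (a n * poly e (Z n i)) (lagrange_basis {..<m} (W n) i)) t"
      by (rule arg_cong)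
    then show ?thesis by (simp add: poly_sum A_def sum_distrib_left mult.assoc)
  qed
  \<comment> \<open>\<open>\<eta>\<close> is not fixed by the power map, so the nearby
    \<open>X n\<close> eventually lies on a genuine 2-cycle.\<close>
  have "\<eta> \<noteq> 0" using \<eta>(2) m by (auto simp: power_0_left)
  then have "\<eta> ^ Suc m - \<eta> \<noteq> 0" using \<eta>(1) by simp
  moreover have "(\<lambda>n. X' n - X n) \<longlonglongrightarrow> \<eta> ^ Suc m - \<eta>" by (intro tendsto_diff X' X)
  ultimately have "\<forall>\<^sub>F n in sequentially. X' n - X n \<noteq> 0" using tendsto_imp_eventually_ne by blast
  moreover have "\<forall>\<^sub>F n in sequentially. \<forall>i\<in>{..<m}. nonzero_multiplier m (W n) i \<noteq> 1"
  proof (intro eventually_ball_finite ballI)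
    fix i assume "i \<in> {..<m}"
    then have i: "i < m" by simp
    have "(\<lambda>n. nonzero_multiplier m (W n) i) \<longlonglongrightarrow> of_nat (m + 1)"
      using LIMSEQ_subseq_LIMSEQ[OF limzr[OF i] q(1)] mult[OF i] by (simp add: comp_def W_def)
    then show "\<forall>\<^sub>F n in sequentially. nonzero_multiplier m (W n) i \<noteq> 1"
      by (rule tendsto_imp_eventually_ne) (use m in simp)
  qed simp
  ultimately have ev: "\<forall>\<^sub>F n in sequentially. poly (S n) (Y n) * poly (S n) (Y' n) = 1 \<and>
      d * (poly e (X n) * poly (R n) (X' n) + poly e (X' n) * poly (R n) (X n)) + a n * (poly e (X n) * poly e (X' n)) =
      d * (A n (Y n) * poly (S n) (Y' n) + A n (Y' n) * poly (S n) (Y n)) + a n * (A n (Y n) * A n (Y' n))"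
  proof eventually_elim
    case (elim n)
    have inj: "inj_on (W n) {..<m}" using elim(2) by (intro nonzero_multiplier_distinct) auto
    have fx: "poly (f (q n)) (X n) \<noteq> X n" using elim(1) by (simp add: X'_def)
    have "good (q n) (Y n)" unfolding Y_def by (rule y(1)) (use fx in \<open>simp add: X_def\<close>)
    then have gy: "poly (g (q n)) (Y' n) = Y n" "Y' n \<noteq> Y n"
      and M: "poly (pderiv (f (q n))) (X n) * poly (pderiv (f (q n))) (X' n) =
        poly (pderiv (g (q n))) (Y n) * poly (pderiv (g (q n))) (Y' n)"
      by (simp_all add: good_def X_def X'_def Y'_def)
    have X0: "X n \<noteq> 0" using fx by (auto simp: fR)
    have Y0: "Y n \<noteq> 0" using gy(2) by (auto simp: Y'_def gS)
    have ff: "poly (f (q n)) (poly (f (q n)) (X n)) = X n" using x2 by (simp add: X_def)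
    have gg: "poly (g (q n)) (poly (g (q n)) (Y n)) = Y n" using gy(1) by (simp add: Y'_def)
    note C1 = cycle2_identity(2)[where m = m, OF ff[unfolded fR] X0, folded fR, folded X'_def, unfolded ER]
      and C2 = cycle2_identity(2)[where m = m, OF gg[unfolded gS] Y0, folded gS, folded Y'_def, folded E_def, unfolded EA[OF inj]]
      and C3 = cycle2_identity(1)[OF gg[unfolded gS] Y0, folded gS, folded Y'_def]
    \<comment> \<open>The constant \<open>d^2\<close> cancels in the equality of multipliers, and
      both remainders contain the nonzero factor \<open>a n\<close>.\<close>
    have "a n * (d * (poly e (X n) * poly (R n) (X' n) + poly e (X' n) * poly (R n) (X n)) + a n * (poly e (X n) * poly e (X' n))) =
      a n * (d * (A n (Y n) * poly (S n) (Y' n) + A n (Y' n) * poly (S n) (Y n)) + a n * (A n (Y n) * A n (Y' n)))"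
      using M C1 C2 unfolding d_def[symmetric] poly_smult by (simp add: algebra_simps)
    then show ?case using a(2)[of n] C3 by simp
  qed
  \<comment> \<open>The two points of the cycle of \<open>g\<close> might merge in the limit, so the
    relation on \<open>ys\<close> is drawn from the product of the values of \<open>S\<close>, which
    is continuous, and not from exact period 2.\<close>
  then have ev1: "\<forall>\<^sub>F n in sequentially. poly (S n) (Y n) * poly (S n) (Y' n) = 1"
    by (rule eventually_mono) blast
  have "(\<lambda>n. poly (S n) (Y n) * poly (S n) (Y' n)) \<longlonglongrightarrow> ys ^ m * (ys ^ Suc m) ^ m"
    by (intro tendsto_mult limS Y Y')
  then have "ys ^ m * (ys ^ Suc m) ^ m = 1"
    by (rule LIMSEQ_eventually_eq_unique[OF ev1 _ tendsto_const])
  moreover have "ys ^ m * (ys ^ Suc m) ^ m = ys ^ (m * (m + 2))"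
    by (simp add: power_mult[symmetric] power_add[symmetric] algebra_simps)
  ultimately have ys: "ys ^ (m * (m + 2)) = 1" by simp
  have ev2: "\<forall>\<^sub>F n in sequentially.
      d * (poly e (X n) * poly (R n) (X' n) + poly e (X' n) * poly (R n) (X n)) + a n * (poly e (X n) * poly e (X' n)) =
      d * (A n (Y n) * poly (S n) (Y' n) + A n (Y' n) * poly (S n) (Y n)) + a n * (A n (Y n) * A n (Y' n))"
    using ev by (rule eventually_mono) blast
  have L1: "(\<lambda>n. d * (poly e (X n) * poly (R n) (X' n) + poly e (X' n) * poly (R n) (X n)) + a n * (poly e (X n) * poly e (X' n)))
      \<longlonglongrightarrow> d * (poly e \<eta> * (\<eta> ^ Suc m) ^ m + poly e (\<eta> ^ Suc m) * \<eta> ^ m) + 0 * (poly e \<eta> * poly e (\<eta> ^ Suc m))"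
    by (intro tendsto_add tendsto_mult tendsto_const tendsto_poly limR X X' a(1))
  have L2: "(\<lambda>n. d * (A n (Y n) * poly (S n) (Y' n) + A n (Y' n) * poly (S n) (Y n)) + a n * (A n (Y n) * A n (Y' n)))
      \<longlonglongrightarrow> d * (poly A0 ys * (ys ^ Suc m) ^ m + poly A0 (ys ^ Suc m) * ys ^ m) + 0 * (poly A0 ys * poly A0 (ys ^ Suc m))"
    by (intro tendsto_add tendsto_mult tendsto_const limA limS Y Y' a(1))
  have "d * cycle_form m \<eta> e = d * cycle_form m ys A0"
    using LIMSEQ_eventually_eq_unique[OF ev2 L1 L2] by (simp add: cycle_form_def)
  moreover have "d \<noteq> 0" by (simp add: d_def del: of_nat_Suc)
  ultimately have "cycle_form m \<eta> e = cycle_form m ys A0" by simp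
  then show ?thesis using ys u(2,3) v(2,3) nrot unfolding A0_def e_def by blast
qed


section \<open>A direction outside finitely many hyperplanes\<close>

lemma finite_roots_of_one: "n \<ge> 1 \<Longrightarrow> finite {z :: complex. z ^ n = 1}"
proof -
  assume n: "n \<ge> 1"
  have "coeff (monom 1 n - 1 :: complex poly) n = 1" using n by (simp add: coeff_1)
  then have "monom 1 n - 1 \<noteq> (0 :: complex poly)" by (metis coeff_0 zero_neq_one)
  from poly_roots_finite[OF this] show ?thesis by (simp add: poly_monom)
qed

lemma cycle_form_linear: "cycle_form m x (p + smult t q) = cycle_form m x p + t * cycle_form m x q"
  by (simp add: cycle_form_def algebra_simps)

lemma error_poly_linear: "error_poly m (\<lambda>i. u i + t * w i) = error_poly m u + smult t (error_poly m w)"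
  by (rule poly_eqI) (simp add: coeff_error_poly)

text \<open>Were all polynomials with \<open>H\<close> nonzero bad or degenerate, a sequence of them
  tending to \<open>z^(m + 1)\<close> in the direction \<open>c\<close> would produce a limit
  configuration. There are finitely many candidates, each imposes a nontrivial linear equation on
  \<open>c\<close>, and \<open>c\<close> is chosen to violate them all.\<close>

lemma exists_good_polynomial:
  assumes m: "m \<ge> 1" and H: "H \<in> coord_ring (Suc m)"
    and inv: "\<And>f g. degree f = Suc m \<Longrightarrow> conjugate f g \<Longrightarrow> H g = H f"
    and nz: "\<exists>f. degree f = Suc m \<and> H f \<noteq> 0"
  shows "\<exists>f. degree f = Suc m \<and> H f \<noteq> 0 \<and> \<not> bad (Suc m) f \<and> \<not> degenerate f"
proof (rule ccontr)
  assume contra: "\<not> ?thesis"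
  \<comment> \<open>Then \<open>\<eta>^m\<close> is \<open>exp(2 pi i / (m + 2))\<close>, and
    \<open>m + 2\<close> >= 3 puts it in the open upper half plane, away from 1 and -1.\<close>
  define \<eta> where "\<eta> = cis (2 * pi / real (m * (m + 2)))"
  have s: "\<eta> ^ m = cis (2 * pi / real (m + 2))"
  proof -
    have "real m * (2 * pi / real (m * (m + 2))) = 2 * pi / real (m + 2)"
      unfolding of_nat_mult using m by (simp del: of_nat_add)
    then show ?thesis by (simp only: \<eta>_def DeMoivre)
  qed
  have "sin (2 * pi / real (m + 2)) > 0"
    using m by (intro sin_gt_zero) (simp_all add: field_simps)
  then have "Im (\<eta> ^ m) > 0" unfolding s by simp
  then have s1: "\<eta> ^ m \<noteq> 1" "\<eta> ^ m \<noteq> -1" by auto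
  have "m * (m + 2) \<noteq> 0" using m by simp
  then have "real (m * (m + 2)) \<noteq> 0" by (simp only: of_nat_eq_0_iff not_False_eq_True)
  then have "real (m * (m + 2)) * (2 * pi / real (m * (m + 2))) = 2 * pi"
    by (simp only: times_divide_eq_right nonzero_mult_div_cancel_left not_False_eq_True)
  then have \<eta>1: "\<eta> ^ (m * (m + 2)) = 1" unfolding \<eta>_def DeMoivre by simp
  then have s2: "(\<eta> ^ m) ^ (m + 2) = 1" by (simp only: power_mult)
  define \<phi> where "\<phi> = (\<lambda>(y, us, vs) c. cycle_form m \<eta> (error_poly m c) -
    cycle_form m y (\<Sum>i<m. smult (poly (error_poly m c) (vs ! i)) (lagrange_basis {..<m} (\<lambda>i. us ! i) i)))"
  \<comment> \<open>Labellings are stored as lists of length \<open>m\<close>, of which there are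
    finitely many, rather than as functions on all natural numbers.\<close>
  define Ls where "Ls = {us :: complex list. set us \<subseteq> {z. z ^ m = 1} \<and> length us = m}"
  define T where "T = {(y :: complex, us, vs). y ^ (m * (m + 2)) = 1 \<and> us \<in> Ls \<and> vs \<in> Ls \<and>
      inj_on (\<lambda>i. us ! i) {..<m} \<and> inj_on (\<lambda>i. vs ! i) {..<m} \<and>
      \<not> (\<exists>\<rho>. \<rho> ^ m = 1 \<and> (\<forall>i<m. vs ! i = \<rho> * us ! i))}"
  have "finite ({y :: complex. y ^ (m * (m + 2)) = 1} \<times> Ls \<times> Ls)"
    unfolding Ls_def using m by (intro finite_cartesian_product finite_lists_length_eq finite_roots_of_one) auto
  moreover have "T \<subseteq> {y :: complex. y ^ (m * (m + 2)) = 1} \<times> Ls \<times> Ls" unfolding T_def by auto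
  ultimately have finT: "finite T" using finite_subset by blast
  have lin: "line_poly (\<phi> \<tau>)" for \<tau>
  proof -
    obtain y us vs where \<tau>: "\<tau> = (y, us, vs)" by (metis surj_pair)
    have "(\<Sum>i<m. smult (poly (p + smult t q) (vs ! i)) (L i)) =
        (\<Sum>i<m. smult (poly p (vs ! i)) (L i)) + smult t (\<Sum>i<m. smult (poly q (vs ! i)) (L i))" for p q t and L :: "nat \<Rightarrow> complex poly"
      by (rule complex_poly_eqI) (simp add: poly_sum sum.distrib sum_distrib_left algebra_simps)
    then have "\<phi> \<tau> (\<lambda>i. u i + t * w i) = \<phi> \<tau> u + t * \<phi> \<tau> w" for u w t
      by (simp add: \<phi>_def \<tau> error_poly_linear cycle_form_linear algebra_simps)
    then show ?thesis by (rule line_poly_affine)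
  qed
  have nzT: "\<exists>c. \<phi> \<tau> c \<noteq> 0" if \<tau>T: "\<tau> \<in> T" for \<tau>
  proof (rule ccontr)
    assume no: "\<nexists>c. \<phi> \<tau> c \<noteq> 0"
    obtain y us vs where \<tau>: "\<tau> = (y, us, vs)" by (metis surj_pair)
    have t: "y ^ (m * (m + 2)) = 1" "us \<in> Ls" "vs \<in> Ls" "inj_on (\<lambda>i. us ! i) {..<m}" "inj_on (\<lambda>i. vs ! i) {..<m}"
      "\<not> (\<exists>\<rho>. \<rho> ^ m = 1 \<and> (\<forall>i<m. vs ! i = \<rho> * us ! i))" using \<tau>T unfolding \<tau> T_def by auto
    have "xs ! i ^ m = 1" if xs: "xs \<in> Ls" and i: "i < m" for xs i
    proof -
      have "xs ! i \<in> set xs" using xs i by (simp add: Ls_def)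
      moreover have "set xs \<subseteq> {z. z ^ m = 1}" using xs by (simp add: Ls_def)
      ultimately show ?thesis by blast
    qed
    then have r: "\<forall>i<m. us ! i ^ m = 1" "\<forall>i<m. vs ! i ^ m = 1" using t(2,3) by simp_all
    have "\<exists>\<rho>. \<rho> ^ m = 1 \<and> (\<forall>i<m. vs ! i = \<rho> * us ! i)"
    proof (rule cycle_form_rigidity[OF m t(4) r(1) t(5) r(2) refl s1 s2 t(1)])
      fix e :: "complex poly" assume e: "degree e < m"
      have "\<phi> \<tau> (coeff e) = 0" using no by blast
      then show "cycle_form m \<eta> e = cycle_form m y (\<Sum>i<m. smult (poly e (vs ! i)) (lagrange_basis {..<m} (\<lambda>i. us ! i) i))"
        by (simp add: \<phi>_def \<tau> error_poly_of_coeffs[OF e])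
    qed
    then show False using t(6) by blast
  qed
  \<comment> \<open>One family of conditions on \<open>c\<close>: the index \<open>None\<close>
    stands for the nonvanishing of \<open>H\<close>, the others for the linear forms.\<close>
  define \<psi> where "\<psi> j = (case j of None \<Rightarrow> (\<lambda>c. H (perturbed_power m c)) | Some \<tau> \<Rightarrow> \<phi> \<tau>)" for j
  have "\<exists>c. \<forall>j\<in>insert None (Some ` T). \<psi> j c \<noteq> 0"
  proof (rule line_poly_common_nonzero)
    show "finite (insert None (Some ` T))" using finT by simp
    show "line_poly (\<psi> j)" for j
      using lin coord_ring_line_poly[OF H] by (cases j) (simp_all add: \<psi>_def)
    fix j assume j: "j \<in> insert None (Some ` T)"
    show "\<exists>c. \<psi> j c \<noteq> 0"
    proof (cases j)
      case None
      obtain f where f: "degree f = Suc m" "H f \<noteq> 0" using nz by blast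
      obtain c where "conjugate f (perturbed_power m c)" using conjugate_perturbed_power[OF f(1) m] by blast
      then show ?thesis using inv[OF f(1)] f(2) None by (intro exI[of _ c]) (simp add: \<psi>_def)
    next
      case (Some \<tau>)
      then show ?thesis using nzT j by (auto simp: \<psi>_def)
    qed
  qed
  then obtain c where c: "\<And>j. j \<in> insert None (Some ` T) \<Longrightarrow> \<psi> j c \<noteq> 0" by blast
  have cH: "H (perturbed_power m c) \<noteq> 0" using c[of None] by (simp add: \<psi>_def)
  have cT: "\<phi> \<tau> c \<noteq> 0" if "\<tau> \<in> T" for \<tau> using c[of "Some \<tau>"] that by (simp add: \<psi>_def)
  \<comment> \<open>On the line from the power map through the chosen perturbation \<open>H\<close>
    is a polynomial, nonzero at 1; so it has finitely many zeros and small parameters off them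
    exist.\<close>
  obtain P where P: "\<And>t. H (perturbed_power m (\<lambda>i. t * c i)) = poly P t"
    using coord_ring_line_poly[OF H, unfolded line_poly_def, rule_format, of "\<lambda>_. 0" c] by auto
  have "P \<noteq> 0" using P[of 1] cH by auto
  obtain \<delta> where \<delta>: "\<delta> > 0" "\<And>\<epsilon>. cmod \<epsilon> < \<delta> \<Longrightarrow> \<not> degenerate (perturbed_power m (\<lambda>k. \<epsilon> * c k))"
    using perturbed_power_not_degenerate[OF m] by blast
  define h where "h n = complex_of_real (inverse (real (Suc n)))" for n
  have "(\<lambda>n. complex_of_real (inverse (real (Suc n)))) \<longlonglongrightarrow> complex_of_real 0"
    by (rule tendsto_of_real[OF LIMSEQ_inverse_real_of_nat])
  then have h: "h \<longlonglongrightarrow> 0" by (simp add: h_def[abs_def])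
  have "inj h" by (rule injI) (simp add: h_def)
  then have "finite (h -` {t. poly P t = 0})" by (intro finite_vimageI poly_roots_finite \<open>P \<noteq> 0\<close>)
  then have "\<forall>\<^sub>F n in sequentially. poly P (h n) \<noteq> 0"
    unfolding cofinite_eq_sequentially[symmetric] eventually_cofinite by (simp add: vimage_def)
  moreover have "\<forall>\<^sub>F n in sequentially. cmod (h n) < \<delta>" using tendstoD[OF h \<delta>(1)] by simp
  ultimately have "\<forall>\<^sub>F n in sequentially. poly P (h n) \<noteq> 0 \<and> cmod (h n) < \<delta>" by (rule eventually_conj)
  then obtain N where N: "\<And>n. n \<ge> N \<Longrightarrow> poly P (h n) \<noteq> 0 \<and> cmod (h n) < \<delta>"
    unfolding eventually_sequentially by blast
  \<comment> \<open>The tail of \<open>1 / (n + 1)\<close> that avoids the zeros of \<open>P\<close>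
    and stays below \<open>\<delta>\<close>.\<close>
  define \<epsilon> where "\<epsilon> n = h (n + N)" for n
  have \<epsilon>: "\<epsilon> \<longlonglongrightarrow> 0" using LIMSEQ_ignore_initial_segment[OF h, of N] by (simp add: \<epsilon>_def[abs_def])
  have \<epsilon>0: "\<epsilon> n \<noteq> 0" for n by (simp add: \<epsilon>_def h_def del: of_nat_Suc)
  have \<epsilon>1: "cmod (\<epsilon> n) \<le> 1" for n
    unfolding \<epsilon>_def h_def norm_of_real by (simp add: inverse_le_1_iff)
  have "\<exists>z w. perturbed_power m (\<lambda>k. \<epsilon> n * c k) = from_nonzero m z \<and>
      (\<forall>i<m. nonzero_multiplier m z i = nonzero_multiplier m w i) \<and>
      cycle2_multipliers (from_nonzero m z) \<subseteq> cycle2_multipliers (from_nonzero m w) \<and>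
      \<not> conjugate (from_nonzero m z) (from_nonzero m w)" for n
  proof -
    let ?f = "perturbed_power m (\<lambda>k. \<epsilon> n * c k)"
    have "H ?f \<noteq> 0" "\<not> degenerate ?f" using N[of "n + N"] P \<delta>(2) by (simp_all add: \<epsilon>_def)
    then have "bad (Suc m) ?f" using contra perturbed_power_monic(1) by blast
    then obtain g where g: "degree g = Suc m" "fixed_multipliers ?f = fixed_multipliers g"
      "cycle2_multipliers ?f \<subseteq> cycle2_multipliers g" "\<not> conjugate ?f g" unfolding bad_def by blast
    have "poly ?f 0 = 0" by (simp add: perturbed_power_def)
    then obtain z w where zw: "?f = from_nonzero m z" "conjugate g (from_nonzero m w)"
      "\<forall>i<m. nonzero_multiplier m z i = nonzero_multiplier m w i"
      using matched_nonzero_fixed_points[OF perturbed_power_monic(1,2) _ m g(1,2)] by blast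
    have "cycle2_multipliers (from_nonzero m w) = cycle2_multipliers g"
      by (rule conjugate_invariants(3)[OF zw(2)]) (use g(1) m in simp)
    moreover have "\<not> conjugate ?f (from_nonzero m w)"
      using g(4) conjugate_trans[OF _ conjugate_sym[OF zw(2)]] by blast
    ultimately show ?thesis using zw g(3) by (intro exI[of _ z] exI[of _ w]) simp
  qed
  then obtain z w where zw: "\<And>n. perturbed_power m (\<lambda>k. \<epsilon> n * c k) = from_nonzero m (z n)"
      "\<And>n i. i < m \<Longrightarrow> nonzero_multiplier m (z n) i = nonzero_multiplier m (w n) i"
      "\<And>n. cycle2_multipliers (from_nonzero m (z n)) \<subseteq> cycle2_multipliers (from_nonzero m (w n))"
      "\<And>n. \<not> conjugate (from_nonzero m (z n)) (from_nonzero m (w n))"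
    by metis
  obtain y u v where r: "y ^ (m * (m + 2)) = 1" "inj_on u {..<m}" "\<forall>i<m. u i ^ m = 1"
    "inj_on v {..<m}" "\<forall>i<m. v i ^ m = 1" "\<not> (\<exists>\<rho>. \<rho> ^ m = 1 \<and> (\<forall>i<m. v i = \<rho> * u i))"
    "cycle_form m \<eta> (error_poly m c) =
      cycle_form m y (\<Sum>i<m. smult (poly (error_poly m c) (v i)) (lagrange_basis {..<m} u i))"
    using limit_configuration[OF m \<epsilon> \<epsilon>0 \<epsilon>1 zw s1(1) \<eta>1] by blast
  let ?us = "map u [0..<m]" and ?vs = "map v [0..<m]"
  have "inj_on (\<lambda>i. ?us ! i) {..<m}" "inj_on (\<lambda>i. ?vs ! i) {..<m}"
    using r(2,4) by (simp_all add: inj_on_def)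
  moreover have "?us \<in> Ls" "?vs \<in> Ls" using r(3,5) by (auto simp: Ls_def)
  moreover have "\<not> (\<exists>\<rho>. \<rho> ^ m = 1 \<and> (\<forall>i<m. ?vs ! i = \<rho> * ?us ! i))" using r(6) by simp
  ultimately have "(y, ?us, ?vs) \<in> T" using r(1) unfolding T_def by blast
  then have "\<phi> (y, ?us, ?vs) c \<noteq> 0" by (rule cT)
  moreover have "(\<Sum>i<m. smult (poly (error_poly m c) (?vs ! i)) (lagrange_basis {..<m} (\<lambda>i. ?us ! i) i)) =
      (\<Sum>i<m. smult (poly (error_poly m c) (v i)) (lagrange_basis {..<m} u i))"
  proof (rule sum.cong[OF refl])
    fix i assume i: "i \<in> {..<m}"
    have "lagrange_basis {..<m} (\<lambda>i. ?us ! i) i = lagrange_basis {..<m} u i"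
      unfolding lagrange_basis_def by (rule prod.cong) (use i in auto)
    then show "smult (poly (error_poly m c) (?vs ! i)) (lagrange_basis {..<m} (\<lambda>i. ?us ! i) i) =
        smult (poly (error_poly m c) (v i)) (lagrange_basis {..<m} u i)" using i by simp
  qed
  ultimately show False using r(7) by (simp add: \<phi>_def)
qed


section \<open>From one good polynomial to an open set\<close>

lemma bad_conjugate:
  assumes "conjugate f f'" "degree f = d" "d \<ge> 2" "bad d f"
  shows "bad d f'"
proof -
  obtain g where g: "degree g = d" "fixed_multipliers f = fixed_multipliers g"
      "cycle2_multipliers f \<subseteq> cycle2_multipliers g" "\<not> conjugate f g" using assms(4) unfolding bad_def by blast
  have "\<not> conjugate f' g" using g(4) conjugate_trans[OF assms(1)] by blast
  then show ?thesis
    unfolding bad_def using g conjugate_invariants(2,3)[OF assms(1)] assms(2,3) by (intro exI[of _ g]) simp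
qed

lemma degenerate_iff_fixed_multipliers:
  assumes "degree f \<ge> 2"
  shows "degenerate f \<longleftrightarrow> (\<exists>l \<in># fixed_multipliers f. l ^ 2 = 1)"
proof -
  have "f - [:0, 1:] \<noteq> 0" using iterate_minus_X_nonzero[of f 1] iterate_1[of f] assms by simp
  then show ?thesis unfolding degenerate_def fixed_multipliers_def by auto
qed

lemma rat_poly_coord_ring:
  assumes "P \<in> rat_poly V" "\<And>v. v \<in> V \<Longrightarrow> (\<lambda>f. \<sigma> f v) \<in> coord_ring d"
  shows "(\<lambda>f. P (\<sigma> f)) \<in> coord_ring d"
  using assms(1)
proof (induction rule: rat_poly.induct)
  case (rp_const c)
  show ?case by (rule coord_ring.const)
next
  case (rp_var v)
  then show ?case by (rule assms(2))
next
  case (rp_add h k)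
  show ?case by (rule coord_ring.add[OF rp_add.IH])
next
  case (rp_mult h k)
  show ?case by (rule coord_ring.mult[OF rp_mult.IH])
qed

definition modulus_assignment :: "nat \<Rightarrow> complex poly \<Rightarrow> var \<Rightarrow> complex" where
  "modulus_assignment d f v = (case v of Coef k \<Rightarrow> modulus d f k | _ \<Rightarrow> 0)"

lemma generic_invariant:
  assumes d: "d \<ge> 2"
  shows "\<exists>H \<in> invariant_ring d. (\<exists>f\<in>Poly_deg d. H f \<noteq> 0) \<and>
    (\<forall>f\<in>Poly_deg d. H f \<noteq> 0 \<longrightarrow> \<not> bad d f \<and> \<not> degenerate f)"
proof -
  let ?\<sigma> = "modulus_assignment d"
  obtain m where m: "d = Suc m" "m \<ge> 1" using d by (cases d) auto
  obtain \<phi> where \<phi>: "definable (Coef ` slice d) \<phi>"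
    "\<And>x. x (Coef d) \<noteq> 0 \<Longrightarrow> (\<phi> x \<longleftrightarrow> bad d (normal_form d (\<lambda>k. x (Coef k))) \<or>
      degenerate (normal_form d (\<lambda>k. x (Coef k))))"
    using definable_bad[OF d] by blast
  obtain P where P: "P \<in> rat_poly (Coef ` slice d)" "\<exists>x. P x \<noteq> 0"
    and dich: "(\<forall>x. P x \<noteq> 0 \<longrightarrow> \<phi> x) \<or> (\<forall>x. P x \<noteq> 0 \<longrightarrow> \<not> \<phi> x)"
    using definable_generic[OF \<phi>(1)] by blast
  have ds: "d \<in> slice d" using d by (auto simp: slice_def)
  \<comment> \<open>The factor \<open>modulus d f d\<close> contains a positive power of the
    constant centered coefficient. Where it is nonzero, \<open>f\<close> is conjugate to its normal
    form, and the parameter at \<open>Coef d\<close> is nonzero as \<open>\<phi>\<close>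
    requires.\<close>
  define H where "H f = modulus d f d * P (?\<sigma> f)" for f
  have "(\<lambda>f. P (?\<sigma> f)) \<in> coord_ring d"
    by (rule rat_poly_coord_ring[OF P(1)]) (auto simp: modulus_assignment_def modulus_coord_ring[OF d])
  then have HC: "H \<in> coord_ring d"
    using coord_ring.mult[OF modulus_coord_ring[OF d, of d]] by (simp add: H_def[abs_def])
  have inv: "H g = H f" if "degree f = d" "conjugate f g" for f g
  proof -
    have k: "modulus d g k = modulus d f k" if "k \<in> slice d" for k
      using modulus_conjugate[OF d \<open>degree f = d\<close> \<open>conjugate f g\<close>, of k] that by (simp add: slice_def)
    have "P (?\<sigma> g) = P (?\<sigma> f)" by (rule rp_cong[OF P(1)]) (auto simp: modulus_assignment_def k)
    then show ?thesis unfolding H_def using k[OF ds] by simp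
  qed
  have nz: "\<exists>f. degree f = d \<and> H f \<noteq> 0"
  proof -
    have "\<exists>x. (x :: var \<Rightarrow> complex) (Coef d) \<noteq> 0" by (rule exI[of _ "\<lambda>_. 1"]) simp
    moreover have "(\<lambda>x. x (Coef d)) \<in> rat_poly (Coef ` slice d)" by (rule rp_var) (use ds in simp)
    ultimately obtain x where x: "x (Coef d) * P x \<noteq> 0" using rp_nonzero_mult[OF _ P(1) _ P(2)] by blast
    let ?f = "normal_form d (\<lambda>k. x (Coef k))"
    have "degree ?f = d" by (rule degree_normal_form[OF d]) (use x in auto)
    moreover have "P (?\<sigma> ?f) = P x"
      by (rule rp_cong[OF P(1)]) (auto simp: modulus_assignment_def modulus_normal_form[OF d])
    ultimately show ?thesis using x modulus_normal_form[OF d ds, of "\<lambda>k. x (Coef k)"]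
      by (intro exI[of _ ?f]) (simp add: H_def)
  qed
  have \<phi>f: "\<phi> (?\<sigma> f) \<longleftrightarrow> bad d f \<or> degenerate f" "P (?\<sigma> f) \<noteq> 0" if f: "degree f = d" "H f \<noteq> 0" for f
  proof -
    show "P (?\<sigma> f) \<noteq> 0" using f(2) by (simp add: H_def)
    have md: "modulus d f d \<noteq> 0" using f(2) by (simp add: H_def)
    then have "centered_coeff d f 0 \<noteq> 0" using d by (auto simp: modulus_def power_0_left)
    then have c: "conjugate f (normal_form d (modulus d f))" by (rule conjugate_normal_form[OF d f(1)])
    let ?g = "normal_form d (modulus d f)"
    have dg: "degree ?g = d" using conjugate_invariants(1)[OF c] f(1) d by simp
    have "bad d f \<longleftrightarrow> bad d ?g"
      using bad_conjugate[OF c f(1) d] bad_conjugate[OF conjugate_sym[OF c] dg d] by blast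
    moreover have "degenerate f \<longleftrightarrow> degenerate ?g"
      using conjugate_invariants(2)[OF c] f(1) dg d by (simp add: degenerate_iff_fixed_multipliers)
    moreover have "(\<lambda>k. ?\<sigma> f (Coef k)) = modulus d f" by (simp add: modulus_assignment_def fun_eq_iff)
    ultimately show "\<phi> (?\<sigma> f) \<longleftrightarrow> bad d f \<or> degenerate f"
      using \<phi>(2)[of "?\<sigma> f"] md by (simp add: modulus_assignment_def)
  qed
  \<comment> \<open>A single good polynomial where \<open>H\<close> is nonzero rules out the branch
    of the dichotomy in which \<open>\<phi>\<close> holds wherever \<open>P\<close> is
    nonzero.\<close>
  obtain f0 where f0: "degree f0 = d" "H f0 \<noteq> 0" "\<not> bad d f0" "\<not> degenerate f0"
    using exists_good_polynomial[OF m(2), of H] HC inv nz m(1) by auto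
  then have "\<not> \<phi> (?\<sigma> f0)" "P (?\<sigma> f0) \<noteq> 0" using \<phi>f[OF f0(1,2)] by simp_all
  then have "\<forall>x. P x \<noteq> 0 \<longrightarrow> \<not> \<phi> x" using dich by blast
  then have good: "\<not> bad d f \<and> \<not> degenerate f" if "degree f = d" "H f \<noteq> 0" for f
    using \<phi>f[OF that] by blast
  have "H \<in> invariant_ring d"
    unfolding invariant_ring_def Poly_deg_def
  proof (intro CollectI conjI HC ballI allI impI)
    fix f :: "complex poly" and \<alpha> \<beta> :: complex
    assume f: "f \<in> {f. degree f = d}" and a: "\<alpha> \<noteq> 0"
    have "(f, aff_conj \<alpha> \<beta> f) \<in> conj_rel" using a by (auto simp: conj_rel_def)
    then show "H (aff_conj \<alpha> \<beta> f) = H f" using inv[of f] f by (simp add: conj_rel_iff)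
  qed
  then show ?thesis using nz good unfolding Poly_deg_def by (intro bexI[of _ H]) auto
qed

theorem theorem3:
  fixes d :: nat
  assumes "d \<ge> 2"
  shows "(\<exists>U. zariski_open d U \<and> U \<subseteq> moduli d \<and> U \<noteq> {} \<and>
            (\<forall>f \<in> Poly_deg d. conj_class f \<in> U \<longrightarrow>
               (\<forall>g \<in> Poly_deg d.
                  (multipliers g 1 = multipliers f 1 \<and> multipliers g 2 = multipliers f 2)
                  \<longleftrightarrow> conj_class g = conj_class f)))
       \<and> (d \<in> {2, 3} \<longrightarrow>
            (\<forall>f \<in> Poly_deg d. \<forall>g \<in> Poly_deg d.
               multipliers g 1 = multipliers f 1 \<longleftrightarrow> conj_class g = conj_class f))"
proof (intro conjI impI ballI)
  obtain H where H: "H \<in> invariant_ring d" "\<exists>f\<in>Poly_deg d. H f \<noteq> 0"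
    "\<And>f. f \<in> Poly_deg d \<Longrightarrow> H f \<noteq> 0 \<Longrightarrow> \<not> bad d f \<and> \<not> degenerate f"
    using generic_invariant[OF assms] by blast
  define U where "U = {conj_class f | f. f \<in> Poly_deg d \<and> (\<exists>h\<in>{H}. h f \<noteq> 0)}"
  have "zariski_open d U"
    unfolding zariski_open_def U_def by (rule exI[of _ "{H}"]) (use H(1) in simp)
  moreover have "U \<subseteq> moduli d"
    unfolding U_def moduli_def conj_class_def by (auto intro: quotientI)
  moreover have "U \<noteq> {}" using H(2) unfolding U_def by blast
  moreover have "(multipliers g 1 = multipliers f 1 \<and> multipliers g 2 = multipliers f 2) \<longleftrightarrow>
      conj_class g = conj_class f"
    if f: "f \<in> Poly_deg d" "conj_class f \<in> U" and g: "g \<in> Poly_deg d" for f g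
  proof
    have deg: "degree f = d" "degree g = d" "degree f \<ge> 2" "degree g \<ge> 2"
      using f(1) g assms by (simp_all add: Poly_deg_def)
    obtain f' where f': "conj_class f = conj_class f'" "f' \<in> Poly_deg d" "H f' \<noteq> 0"
      using f(2) unfolding U_def by blast
    have "(f, f') \<in> conj_rel" using f'(1) by (simp add: conj_rel_iff conj_class_eq_iff)
    then obtain \<alpha> \<beta> where "\<alpha> \<noteq> 0" "f' = aff_conj \<alpha> \<beta> f" by (auto simp: conj_rel_def)
    \<comment> \<open>Membership in \<open>U\<close> is witnessed by some representative
      \<open>f'\<close>; invariance of \<open>H\<close> carries nonvanishing over to
      \<open>f\<close>.\<close>
    then have "H f \<noteq> 0" using H(1) f(1) f'(3) unfolding invariant_ring_def by auto
    then have good: "\<not> bad d f" "\<not> degenerate f" using H(3)[OF f(1)] by blast+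
    assume M: "multipliers g 1 = multipliers f 1 \<and> multipliers g 2 = multipliers f 2"
    have fm: "fixed_multipliers f = fixed_multipliers g"
      using M multipliers_1[OF deg(3)] multipliers_1[OF deg(4)] by simp
    \<comment> \<open>Degeneracy depends only on the fixed-point multipliers, so it is excluded for
      \<open>g\<close> too, and the multisets of period 2 of both polynomials have the 2-cycle
      values as supports.\<close>
    have "\<not> degenerate g" using good(2) deg fm by (simp add: degenerate_iff_fixed_multipliers)
    then have "cycle2_multipliers f = cycle2_multipliers g"
      using good(2) M set_multipliers_2[OF deg(3)] set_multipliers_2[OF deg(4)] unfolding degenerate_def by metis
    then have "conjugate f g" using good(1) deg(2) fm unfolding bad_def by blast
    then show "conj_class g = conj_class f" using conj_class_eq_iff by blast
  next
    assume "conj_class g = conj_class f"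
    then have "conjugate f g" using conj_class_eq_iff by blast
    then show "multipliers g 1 = multipliers f 1 \<and> multipliers g 2 = multipliers f 2"
      using conjugate_invariants(4,5)[of f g] f(1) assms by (simp add: Poly_deg_def)
  qed
  ultimately show "\<exists>U. zariski_open d U \<and> U \<subseteq> moduli d \<and> U \<noteq> {} \<and>
            (\<forall>f \<in> Poly_deg d. conj_class f \<in> U \<longrightarrow>
               (\<forall>g \<in> Poly_deg d.
                  (multipliers g 1 = multipliers f 1 \<and> multipliers g 2 = multipliers f 2)
                  \<longleftrightarrow> conj_class g = conj_class f))" by blast
next
  fix f g assume d: "d \<in> {2, 3}" and f: "f \<in> Poly_deg d" and g: "g \<in> Poly_deg d"
  have deg: "degree f = d" "degree g = d" "degree f \<ge> 2" "degree g \<ge> 2"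
    using f g assms by (simp_all add: Poly_deg_def)
  have "multipliers g 1 = multipliers f 1 \<longleftrightarrow> conjugate f g"
    using multipliers_1[OF deg(3)] multipliers_1[OF deg(4)] conjugate_invariants(4)[OF _ deg(3), of g]
      fixed_multipliers_determine_2[of f g] fixed_multipliers_determine_3[of f g] d deg(1,2) by auto
  then show "multipliers g 1 = multipliers f 1 \<longleftrightarrow> conj_class g = conj_class f"
    using conj_class_eq_iff by metis
qed

end
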